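(* Let $d\ge1$. There exist $r_0\in(0,1)$ and $\alpha\in(0,1)$ depending only on $d$ such that for every $\Lambda\ge 0$ there exist $h_0>0$, $C>1$ and $c>0$ depending only on $d$ and $\Lambda$ with the following property. Let $h\in(0,h_0)$, let $V:(h\mathbb{Z})^d\times\mathbb{R}_+\to\mathbb{R}$ be bounded with $\|V\|_{L^\infty((h\mathbb{Z})^d\times\mathbb{R}_+)}=\Lambda$, let $u\in H^1((h\mathbb{Z})^d)$, and let $\tilde u:(h\mathbb{Z})^d\times\mathbb{R}_+\to\mathbb{R}$ be a solution of $$(\partial_t^2+\Delta_{\mathrm d})\tilde u=V\tilde u\ \text{ in }(h\mathbb{Z})^d\times\mathbb{R}_+,\qquad \tilde u=u\ \text{ on }(h\mathbb{Z})^d\times\{0\}.$$ Then $$\|\tilde u\|_{L^2(B_{r_0}^+)}\le C\max\big\{\|\tilde u\|_{L^2(B_1^+)},\,\|u\|_{H^1(B_1')}+\|\partial_t\tilde u\|_{L^2(B_1')}\big\}^{1-\alpha}\big(\|u\|_{H^1(B_1')}+\|\partial_t\tilde u\|_{L^2(B_1')}\big)^{\alpha}+Ce^{-ch^{-1}}\|\tilde u\|_{L^2(B_1^+)}.$$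
   Context: Here $\mathbb{R}_+=(0,\infty)$ and $(h\mathbb{Z})^d=\{hj:j\in\mathbb{Z}^d\}$. The discrete Laplacian acts in the lattice variable: $\Delta_{\mathrm d}u(x)=\frac1{h^2}\sum_{k=1}^d\big(u(x+he_k)-2u(x)+u(x-he_k)\big)$, and $\nabla_{\mathrm d}$ is the symmetric discrete gradient with components $\frac{u(x+he_k)-u(x-he_k)}{2h}$, $k=1,\dots,d$. For $r>0$, $B_r^+=\{(x,t)\in(h\mathbb{Z})^d\times\mathbb{R}_+:\ |x|^2+t^2<r^2\}$ and $B_r'=\{(x,0): x\in(h\mathbb{Z})^d,\ |x|<r\}$. $L^2$ norms on subsets of the lattice are taken with respect to the counting measure times $h^d$, and on subsets of $(h\mathbb{Z})^d\times\mathbb{R}_+$ with respect to its product with Lebesgue measure $dt$ (the factor $h^d$ is immaterial for the estimate, since it is homogeneous). $\|u\|_{H^1(B_1')}=\|u\|_{L^2(B_1')}+\|\nabla_{\mathrm d}u\|_{L^2(B_1')}$; $H^1((h\mathbb{Z})^d)$ is the closure of finitely supported functions under $\|(1+|\nabla_{\mathrm d}|^2)^{1/2}u\|_{L^2}$, i.e. the norm given on the Fourier side by the multiplier $(1+h^{-2}\sum_{k=1}^d\sin^2(h\xi_k))^{1/2}$. A solution is understood as a function such that for each $x$, $\tilde u(x,\cdot)\in H^2_{loc}([0,\infty))$, the equation holds for a.e. $t>0$, and $\tilde u(x,0)=u(x)$; $\|\partial_t\tilde u\|_{L^2(B_1')}$ refers to $\partial_t\tilde u(\cdot,0)$. *)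

theory Defs
  imports "HOL-Analysis.Analysis" "HOL-Probability.Essential_Supremum"
begin

section \<open>The lattice and its difference operators\<close>

text \<open>Functions on the lattice are total functions on \<open>real ^ 'd\<close>; only their values at
  lattice points are ever used.\<close>

definition mesh :: "real \<Rightarrow> (real ^ 'd) set" where
  "mesh h = range (\<lambda>j::int ^ 'd. \<chi> k. h * of_int (j $ k))"

definition discrete_laplacian :: "real \<Rightarrow> (real ^ 'd::finite \<Rightarrow> real) \<Rightarrow> real ^ 'd \<Rightarrow> real" where
  "discrete_laplacian h u x =
     (\<Sum>k\<in>UNIV. u (x + h *\<^sub>R axis k 1) - 2 * u x + u (x - h *\<^sub>R axis k 1)) / h\<^sup>2"

definition discrete_grad :: "real \<Rightarrow> (real ^ 'd::finite \<Rightarrow> real) \<Rightarrow> real ^ 'd \<Rightarrow> real ^ 'd" where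
  "discrete_grad h u x =
     (\<chi> k. (u (x + h *\<^sub>R axis k 1) - u (x - h *\<^sub>R axis k 1)) / (2 * h))"

section \<open>Measures, balls and norms\<close>

definition mesh_measure :: "real \<Rightarrow> (real ^ 'd::finite) measure" where
  "mesh_measure h = density (count_space (mesh h)) (\<lambda>_. ennreal (h ^ CARD('d)))"

text \<open>Lebesgue (rather than Borel) measure in \<open>t\<close>, so that arbitrary Lebesgue measurable
  functions of \<open>t\<close> are admitted.\<close>

definition half_space_measure :: "real \<Rightarrow> ((real ^ 'd::finite) \<times> real) measure" where
  "half_space_measure h = mesh_measure h \<Otimes>\<^sub>M lebesgue_on {0<..}"

definition half_ball :: "real \<Rightarrow> real \<Rightarrow> ((real ^ 'd::finite) \<times> real) set" where
  "half_ball h r = {(x, t). x \<in> mesh h \<and> 0 < t \<and> (norm x)\<^sup>2 + t\<^sup>2 < r\<^sup>2}"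

text \<open>A boundary point \<open>(x, 0)\<close> is identified with \<open>x\<close>.\<close>

definition boundary_ball :: "real \<Rightarrow> real \<Rightarrow> (real ^ 'd::finite) set" where
  "boundary_ball h r = {x \<in> mesh h. norm x < r}"

text \<open>The Bochner integral of a non-integrable function is \<open>0\<close>, so this is the usual norm only
  for functions that are square integrable on \<open>A\<close>.\<close>

definition L2_norm :: "'a measure \<Rightarrow> 'a set \<Rightarrow> ('a \<Rightarrow> 'b::real_normed_vector) \<Rightarrow> real" where
  "L2_norm M A f = sqrt (LINT z:A|M. (norm (f z))\<^sup>2)"

definition H1_norm_boundary_ball :: "real \<Rightarrow> real \<Rightarrow> (real ^ 'd::finite \<Rightarrow> real) \<Rightarrow> real" where
  "H1_norm_boundary_ball h r u =
     L2_norm (mesh_measure h) (boundary_ball h r) u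
     + L2_norm (mesh_measure h) (boundary_ball h r) (discrete_grad h u)"

section \<open>The space \<open>H\<^sup>1\<close> of the lattice\<close>

definition finitely_supported :: "real \<Rightarrow> (real ^ 'd::finite \<Rightarrow> real) \<Rightarrow> bool" where
  "finitely_supported h v \<longleftrightarrow> finite {x \<in> mesh h. v x \<noteq> 0}"

definition mesh_fourier :: "real \<Rightarrow> (real ^ 'd::finite \<Rightarrow> real) \<Rightarrow> real ^ 'd \<Rightarrow> complex" where
  "mesh_fourier h v \<xi> =
     of_real (h ^ CARD('d)) *
       (\<Sum>x\<in>{x \<in> mesh h. v x \<noteq> 0}. of_real (v x) * cis (- (x \<bullet> \<xi>)))"

definition H1_norm :: "real \<Rightarrow> (real ^ 'd::finite \<Rightarrow> real) \<Rightarrow> real" where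
  "H1_norm h v =
     sqrt ((LINT \<xi>:cbox (\<chi> k. - pi / h) (\<chi> k. pi / h)|lborel.
              (sqrt (1 + (\<Sum>k\<in>UNIV. (sin (h * \<xi> $ k))\<^sup>2) / h\<^sup>2) * cmod (mesh_fourier h v \<xi>))\<^sup>2)
           / (2 * pi) ^ CARD('d))"

text \<open>The closure (completion) of the finitely supported functions.  Since \<open>H1_norm\<close> dominates
  the point values for fixed \<open>h\<close>, a Cauchy sequence converges pointwise and its limit in the
  completion is identified with the pointwise limit.\<close>

definition H1_space :: "real \<Rightarrow> (real ^ 'd::finite \<Rightarrow> real) set" where
  "H1_space h = {u. \<exists>v :: nat \<Rightarrow> real ^ 'd \<Rightarrow> real.
     (\<forall>n. finitely_supported h (v n)) \<and>
     (\<forall>e>0. \<exists>N. \<forall>m\<ge>N. \<forall>n\<ge>N. H1_norm h (\<lambda>x. v m x - v n x) < e) \<and>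
     (\<forall>x\<in>mesh h. (\<lambda>n. v n x) \<longlonglongrightarrow> u x)}"

section \<open>The space \<open>H\<^sup>2\<^sub>l\<^sub>o\<^sub>c\<close> of the closed half-line\<close>

definition L2_loc :: "(real \<Rightarrow> real) \<Rightarrow> bool" where
  "L2_loc f \<longleftrightarrow> f \<in> borel_measurable (lebesgue_on {0<..}) \<and>
     (\<forall>R>0. set_integrable lebesgue {0<..<R} (\<lambda>t. (f t)\<^sup>2))"

text \<open>Test functions are the compactly supported \<open>C\<^sup>1\<close> functions on the open half-line.\<close>

definition weak_derivative :: "(real \<Rightarrow> real) \<Rightarrow> (real \<Rightarrow> real) \<Rightarrow> bool" where
  "weak_derivative f g \<longleftrightarrow> (\<forall>\<phi> \<phi>' a b.
     0 < a \<and> (\<forall>t. t \<notin> {a..b} \<longrightarrow> \<phi> t = 0) \<and>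
     (\<forall>t. (\<phi> has_real_derivative \<phi>' t) (at t)) \<and> continuous_on UNIV \<phi>' \<longrightarrow>
     (LINT t:{0<..}|lebesgue. f t * \<phi>' t) = - (LINT t:{0<..}|lebesgue. g t * \<phi> t))"

definition H2_loc :: "(real \<Rightarrow> real) \<Rightarrow> bool" where
  "H2_loc f \<longleftrightarrow> L2_loc f \<and>
     (\<exists>g. L2_loc g \<and> weak_derivative f g \<and> (\<exists>g'. L2_loc g' \<and> weak_derivative g g'))"

text \<open>The choice is unique up to null sets whenever such a weak derivative exists.\<close>

definition weak_deriv :: "(real \<Rightarrow> real) \<Rightarrow> real \<Rightarrow> real" where
  "weak_deriv f = (SOME g. L2_loc g \<and> weak_derivative f g)"

text \<open>The value at \<open>0\<close> of the continuous representative on the closed half-line; it exists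
  for \<open>f\<close> and for \<open>weak_deriv f\<close> if \<open>H2_loc f\<close> holds.\<close>

definition trace_at_0 :: "(real \<Rightarrow> real) \<Rightarrow> real" where
  "trace_at_0 f = (THE a. \<exists>F. continuous_on {0..} F \<and>
     (AE t in lebesgue_on {0<..}. f t = F t) \<and> F 0 = a)"

section \<open>Solutions\<close>

definition is_solution ::
  "real \<Rightarrow> ((real ^ 'd::finite) \<times> real \<Rightarrow> real) \<Rightarrow> (real ^ 'd \<Rightarrow> real) \<Rightarrow>
   ((real ^ 'd) \<times> real \<Rightarrow> real) \<Rightarrow> bool" where
  "is_solution h V u U \<longleftrightarrow> (\<forall>x\<in>mesh h.
     H2_loc (\<lambda>t. U (x, t)) \<and>
     (AE t in lebesgue_on {0<..}.
        weak_deriv (weak_deriv (\<lambda>s. U (x, s))) t + discrete_laplacian h (\<lambda>y. U (y, t)) x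
          = V (x, t) * U (x, t)) \<and>
     trace_at_0 (\<lambda>t. U (x, t)) = u x)"

definition normal_derivative :: "((real ^ 'd::finite) \<times> real \<Rightarrow> real) \<Rightarrow> real ^ 'd \<Rightarrow> real" where
  "normal_derivative U x = trace_at_0 (weak_deriv (\<lambda>t. U (x, t)))"

definition boundary_data_norm ::
  "real \<Rightarrow> (real ^ 'd::finite \<Rightarrow> real) \<Rightarrow> ((real ^ 'd) \<times> real \<Rightarrow> real) \<Rightarrow> real" where
  "boundary_data_norm h u U =
     H1_norm_boundary_ball h 1 u
     + L2_norm (mesh_measure h) (boundary_ball h 1) (normal_derivative U)"

end

theory Submission
  imports Defs
begin

text \<open>
The estimate follows from a Carleman inequality for \<open>\<partial>\<^sub>t\<^sup>2 + \<Delta>\<^sub>d\<close> whose large parameter \<open>\<tau>\<close> may be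
  chosen anywhere up to \<open>1 / h\<close>, followed by the optimal choice of \<open>\<tau>\<close>.

  The weight is \<open>exp (\<tau> \<phi>)\<close> with \<open>\<phi> = (A (1 - t)\<^sup>2 - |x|\<^sup>2) / 2\<close>.  It separates the variables and is
  quadratic in every coordinate, so that conjugation by it multiplies the shift by \<open>h e\<^sub>k\<close> with
  \<open>exp (\<tau> h (x\<^sub>k + h / 2))\<close>.  The conjugated Laplacian is therefore \<open>S + K\<close>, where the symmetric part \<open>S\<close>
  has hyperbolic cosines and the antisymmetric part \<open>K\<close> hyperbolic sines as coefficients, and the
  commutator of \<open>S\<close> and \<open>K\<close> is known exactly (\<open>conj_commutator\<close>); no expansion in \<open>h\<close> is needed.  Both
  operators are constant in \<open>t\<close>.  The conjugated problem is an ordinary differential equation in \<open>t\<close> for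
  finitely supported functions, and \<open>carleman_pointwise\<close> is a differential inequality for a suitable
  energy of it.  The convexity of \<open>\<phi>\<close> in \<open>t\<close>, measured by a large constant \<open>A\<close> depending on the dimension,
  dominates the negative commutator that comes from the concavity of \<open>\<phi>\<close> in \<open>x\<close>.  Since \<open>\<phi>\<close> decreases in
  \<open>t\<close>, the tangential gradient on \<open>t = 0\<close> enters with the favourable sign, and the boundary terms are
  controlled by the function and its normal derivative (\<open>carleman_boundary\<close>).  The restriction
  \<open>\<tau> h \<le> 1\<close> keeps the arguments of the hyperbolic functions bounded; it is the source of the error
  \<open>exp (- c / h)\<close> in the theorem.

  The inequality is applied to the solution times a cutoff function.  The commutator with the cutoff is
  supported where \<open>\<phi>\<close> is smaller, by a margin \<open>\<kappa> / 2\<close>, than it is on the small half ball, and it contains first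
  differences of the solution, which the Caccioppoli inequality (\<open>caccioppoli\<close>) bounds.  The potential is absorbed as
  soon as \<open>\<tau>\<^sup>3 \<ge> 4 \<Lambda>\<^sup>2\<close>.  With \<open>M\<close> the norm on the unit half ball and \<open>B\<close> the boundary norm this gives
  (\<open>local_estimate\<close>), up to a constant factor, the bound \<open>exp (- \<kappa> \<tau> / 2) M + exp ((\<kappa> + 1) \<tau> / 2) B\<close> on the small half
  ball.  The exponents depend on the dimension only, whereas \<open>\<Lambda>\<close> enters the constant factor and the lower bound for
  \<open>\<tau>\<close>; hence the Hoelder exponent \<open>\<alpha>\<close> depends on the dimension only.

  Solutions are in \<open>H\<^sup>2\<close> in time with a merely measurable second derivative.  By a du Bois-Reymond argument
  (\<open>H2_loc_representative\<close>) they are twice iterated primitives, by the equation even of bounded functions, and the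
  product rule for such primitives (\<open>primitive_mult\<close>) is all the differential calculus in \<open>t\<close> that the energy arguments use.
\<close>

section \<open>Primitives of integrable functions of the time variable\<close>

definition bounded_measurable :: "real \<Rightarrow> (real \<Rightarrow> real) \<Rightarrow> bool" where
  "bounded_measurable T f \<longleftrightarrow>
     f \<in> borel_measurable (lebesgue_on {0..T}) \<and> (\<exists>M. \<forall>t\<in>{0..T}. \<bar>f t\<bar> \<le> M)"

text \<open>Absolutely continuous functions, described through their derivative \<open>g\<close>.  Stating the fundamental theorem of
  calculus instead of differentiability almost everywhere avoids Lebesgue's differentiation theorem.\<close>

definition primitive :: "real \<Rightarrow> (real \<Rightarrow> real) \<Rightarrow> (real \<Rightarrow> real) \<Rightarrow> bool" where
  "primitive T f g \<longleftrightarrow>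
     g absolutely_integrable_on {0..T} \<and> (\<forall>t\<in>{0..T}. (g has_integral (f t - f 0)) {0..t})"

lemma bounded_measurable_add:
  assumes "bounded_measurable T f" "bounded_measurable T g"
  shows "bounded_measurable T (\<lambda>t. f t + g t)"
proof -
  obtain M N where "\<forall>t\<in>{0..T}. \<bar>f t\<bar> \<le> M" "\<forall>t\<in>{0..T}. \<bar>g t\<bar> \<le> N"
    using assms unfolding bounded_measurable_def by blast
  then have "\<forall>t\<in>{0..T}. \<bar>f t + g t\<bar> \<le> M + N"
    by (meson abs_triangle_ineq add_mono order_trans)
  with assms show ?thesis unfolding bounded_measurable_def by (auto intro!: borel_measurable_add)
qed

lemma bounded_measurable_mult:
  assumes "bounded_measurable T f" "bounded_measurable T g"
  shows "bounded_measurable T (\<lambda>t. f t * g t)"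
proof -
  obtain M N where MN: "\<forall>t\<in>{0..T}. \<bar>f t\<bar> \<le> M" "\<forall>t\<in>{0..T}. \<bar>g t\<bar> \<le> N"
    using assms unfolding bounded_measurable_def by blast
  have "\<bar>f t * g t\<bar> \<le> M * N" if "t \<in> {0..T}" for t
    using MN that unfolding abs_mult by (intro mult_mono) (auto intro: order_trans[of 0 "\<bar>f t\<bar>"])
  then have "\<exists>K. \<forall>t\<in>{0..T}. \<bar>f t * g t\<bar> \<le> K" by blast
  with assms show ?thesis unfolding bounded_measurable_def by (auto intro!: borel_measurable_times)
qed

lemma bounded_measurable_continuous:
  assumes "continuous_on {0..T} f" shows "bounded_measurable T f"
proof -
  have "f \<in> borel_measurable (lebesgue_on {0..T})"
    by (rule continuous_imp_measurable_on_sets_lebesgue) (auto intro: assms)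
  moreover have "bounded (f ` {0..T})"
    by (intro compact_imp_bounded compact_continuous_image assms) auto
  ultimately show ?thesis unfolding bounded_measurable_def by (force simp: bounded_iff)
qed

lemma bounded_measurable_const: "bounded_measurable T (\<lambda>t. c)"
  by (intro bounded_measurable_continuous continuous_intros)

lemma bounded_measurable_cmult:
  "bounded_measurable T f \<Longrightarrow> bounded_measurable T (\<lambda>t. c * f t)"
  by (intro bounded_measurable_mult bounded_measurable_const)

lemma bounded_measurable_minus:
  "bounded_measurable T f \<Longrightarrow> bounded_measurable T (\<lambda>t. - f t)"
  using bounded_measurable_cmult[of T f "-1"] by simp

lemma bounded_measurable_diff:
  assumes "bounded_measurable T f" "bounded_measurable T g"
  shows "bounded_measurable T (\<lambda>t. f t - g t)"
  using bounded_measurable_add[OF assms(1) bounded_measurable_minus[OF assms(2)]] by simp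

lemma bounded_measurable_sum:
  "(\<And>x. x \<in> Q \<Longrightarrow> bounded_measurable T (f x)) \<Longrightarrow> bounded_measurable T (\<lambda>t. \<Sum>x\<in>Q. f x t)"
  by (induction Q rule: infinite_finite_induct)
    (auto intro: bounded_measurable_const bounded_measurable_add)

lemma bounded_measurable_power:
  "bounded_measurable T f \<Longrightarrow> bounded_measurable T (\<lambda>t. f t ^ n)"
  by (induction n) (auto intro: bounded_measurable_const bounded_measurable_mult)

lemmas bounded_measurable_intros =
  bounded_measurable_add bounded_measurable_diff bounded_measurable_mult bounded_measurable_const
  bounded_measurable_minus bounded_measurable_sum bounded_measurable_power

lemma bounded_measurable_absolutely_integrable_mult:
  assumes "g absolutely_integrable_on {0..T}" "bounded_measurable T f"
  shows "(\<lambda>t. g t * f t) absolutely_integrable_on {0..T}"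
proof -
  obtain M where M: "\<forall>t\<in>{0..T}. \<bar>f t\<bar> \<le> M"
    using assms unfolding bounded_measurable_def by blast
  have "(\<lambda>t. f t * g t) absolutely_integrable_on {0..T}"
    using M assms unfolding bounded_measurable_def
    by (intro absolutely_integrable_bounded_measurable_product_real)
      (auto simp: bounded_iff)
  then show ?thesis by (simp add: mult.commute)
qed

lemma bounded_measurable_absolutely_integrable:
  "bounded_measurable T f \<Longrightarrow> f absolutely_integrable_on {0..T}"
  using bounded_measurable_absolutely_integrable_mult[where g="\<lambda>_. 1" and f=f and T=T, OF absolutely_integrable_continuous_real]
  by auto

lemma bounded_measurable_integrable: "bounded_measurable T f \<Longrightarrow> f integrable_on {0..T}"
  using bounded_measurable_absolutely_integrable absolutely_integrable_on_def by blast

lemma primitive_integral: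
  assumes "primitive T f g" "t \<in> {0..T}"
  shows "integral {0..t} g = f t - f 0"
  using assms unfolding primitive_def by auto

lemma primitive_continuous:
  assumes "primitive T f g" shows "continuous_on {0..T} f"
proof -
  have "g integrable_on {0..T}"
    using assms unfolding primitive_def absolutely_integrable_on_def by auto
  then have "continuous_on {0..T} (\<lambda>t. f 0 + integral {0..t} g)"
    by (intro continuous_intros indefinite_integral_continuous_1)
  then show ?thesis
    by (rule continuous_on_eq) (use assms primitive_integral in auto)
qed

lemma primitive_bounded_measurable: "primitive T f g \<Longrightarrow> bounded_measurable T f"
  by (intro bounded_measurable_continuous primitive_continuous)

lemma primitive_interval:
  assumes "primitive T f g" "0 \<le> s" "s \<le> t" "t \<le> T"
  shows "(g has_integral (f t - f s)) {s..t}"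
proof -
  have gi: "g integrable_on {0..T}"
    using assms unfolding primitive_def absolutely_integrable_on_def by auto
  have "g integrable_on {0..t}"
    by (rule integrable_on_subinterval[OF gi]) (use assms in auto)
  then have "integral {0..s} g + integral {s..t} g = integral {0..t} g"
    by (intro Henstock_Kurzweil_Integration.integral_combine) (use assms in auto)
  moreover have "integral {0..s} g = f s - f 0" "integral {0..t} g = f t - f 0"
    using assms by (auto intro!: primitive_integral)
  moreover have "g integrable_on {s..t}"
    by (rule integrable_on_subinterval[OF gi]) (use assms in auto)
  ultimately show ?thesis by (simp add: has_integral_integrable_integral)
qed

lemma primitive_add:
  assumes "primitive T f g" "primitive T f' g'"
  shows "primitive T (\<lambda>t. f t + f' t) (\<lambda>t. g t + g' t)"
  using assms unfolding primitive_def
  by (auto intro!: has_integral_add simp: add_diff_add)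

lemma primitive_const: "primitive T (\<lambda>t. c) (\<lambda>t. 0)"
  unfolding primitive_def by (auto intro: has_integral_0)

lemma primitive_sum:
  "(\<And>x. x \<in> Q \<Longrightarrow> primitive T (f x) (g x)) \<Longrightarrow>
     primitive T (\<lambda>t. \<Sum>x\<in>Q. f x t) (\<lambda>t. \<Sum>x\<in>Q. g x t)"
  by (induction Q rule: infinite_finite_induct) (auto intro: primitive_const primitive_add)

lemma primitive_C1:
  assumes "\<And>t. t \<in> {0..T} \<Longrightarrow> (f has_real_derivative g t) (at t within {0..T})"
    and "continuous_on {0..T} g"
  shows "primitive T f g"
proof -
  have "(g has_integral (f t - f 0)) {0..t}" if t: "t \<in> {0..T}" for t
  proof (rule fundamental_theorem_of_calculus)
    show "(f has_vector_derivative g x) (at x within {0..t})" if "x \<in> {0..t}" for x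
      using has_field_derivative_subset[OF assms(1)[of x], of "{0..t}"] that t
      by (auto simp: has_real_derivative_iff_has_vector_derivative)
  qed (use t in auto)
  with assms(2) show ?thesis
    unfolding primitive_def by (auto intro: absolutely_integrable_continuous_real)
qed

text \<open>The function \<open>H = f1 f2 - \<integral> (g1 f2 + g2 f1)\<close> is constant.  Its increment over \<open>{s..t}\<close> is
  \<open>\<integral> g1 (r) (f2 (t) - f2 (r)) + g2 (r) (f1 (s) - f1 (r)) dr\<close>, and since \<open>f2\<close> is Lipschitz this is at most a
  constant times \<open>(t - s) \<integral> |g1|\<close>, where the last factor tends to \<open>0\<close>; so \<open>H\<close> has derivative \<open>0\<close>
  everywhere, although neither factor need be differentiable everywhere.\<close>

lemma primitive_mult:
  assumes "primitive T f1 g1" "primitive T f2 g2" and bd: "bounded_measurable T g2"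
  shows "primitive T (\<lambda>t. f1 t * f2 t) (\<lambda>t. g1 t * f2 t + g2 t * f1 t)"
proof -
  define J where "J t = g1 t * f2 t + g2 t * f1 t" for t
  have g1: "g1 absolutely_integrable_on {0..T}"
    using assms unfolding primitive_def by auto
  have Jabs: "J absolutely_integrable_on {0..T}"
    unfolding J_def using assms g1
    by (intro set_integral_add bounded_measurable_absolutely_integrable_mult
        bounded_measurable_absolutely_integrable[OF bd] primitive_bounded_measurable[of T f2 g2]
        primitive_bounded_measurable[of T f1 g1])
  then have Jint: "J integrable_on {0..T}" unfolding absolutely_integrable_on_def by auto
  have g1a: "(\<lambda>t. \<bar>g1 t\<bar>) integrable_on {0..T}"
    using g1 unfolding absolutely_integrable_on_def by auto
  obtain M where M: "\<And>t. t \<in> {0..T} \<Longrightarrow> \<bar>g2 t\<bar> \<le> M"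
    using bd unfolding bounded_measurable_def by blast
  define A where "A t = integral {0..t} (\<lambda>t. \<bar>g1 t\<bar>)" for t
  have Acont: "continuous_on {0..T} A"
    unfolding A_def by (intro indefinite_integral_continuous_1 g1a)
  have Adiff: "integral {s..t} (\<lambda>t. \<bar>g1 t\<bar>) = A t - A s" if "0 \<le> s" "s \<le> t" "t \<le> T" for s t
    unfolding A_def using that Henstock_Kurzweil_Integration.integral_combine[of 0 s t "\<lambda>t. \<bar>g1 t\<bar>"]
      integrable_on_subinterval[OF g1a, of 0 t] by force
  have Amono: "A s \<le> A t" if "0 \<le> s" "s \<le> t" "t \<le> T" for s t
    using Adiff[OF that] integral_nonneg[of "\<lambda>t. \<bar>g1 t\<bar>" "{s..t}"]
      integrable_on_subinterval[OF g1a, of s t] that by force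
  define H where "H t = f1 t * f2 t - integral {0..t} J" for t
  have Hdiff: "\<bar>H t - H s\<bar> \<le> 2 * M * (t - s) * (A t - A s)" if st: "0 \<le> s" "s \<le> t" "t \<le> T" for s t
  proof -
    have sub: "{s..t} \<subseteq> {0..T}" using st by auto
    have M0: "0 \<le> M" using M[of s] st by force
    have J1: "(J has_integral (integral {0..t} J - integral {0..s} J)) {s..t}"
      using st Henstock_Kurzweil_Integration.integral_combine[of 0 s t J]
        integrable_on_subinterval[OF Jint, of 0 t] integrable_on_subinterval[OF Jint, of s t]
      by (force simp: has_integral_integrable_integral)
    have J2: "((\<lambda>r. f2 t * g1 r + f1 s * g2 r) has_integral
        (f2 t * (f1 t - f1 s) + f1 s * (f2 t - f2 s))) {s..t}"
      using assms st
      by (intro has_integral_add has_integral_mult_right primitive_interval[of T]) auto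
    have D: "((\<lambda>r. g1 r * (f2 t - f2 r) + g2 r * (f1 s - f1 r)) has_integral (H t - H s)) {s..t}"
      using has_integral_diff[OF J2 J1] unfolding J_def H_def by (simp add: algebra_simps)
    have f2L: "\<bar>f2 t - f2 r\<bar> \<le> M * (t - s)" if r: "r \<in> {s..t}" for r
    proof -
      have "(g2 has_integral (f2 t - f2 r)) {r..t}"
        using assms st r by (intro primitive_interval[of T]) auto
      moreover have "((\<lambda>_. M) has_integral M * (t - r)) {r..t}"
        using has_integral_const_real[of M r t] r by (simp add: mult.commute)
      ultimately have "norm (f2 t - f2 r) \<le> M * (t - r)"
        using integral_norm_bound_integral[of g2 "{r..t}" "\<lambda>_. M"] M st r
        by (auto simp: has_integral_iff mult.commute)
      also have "\<dots> \<le> M * (t - s)" using r M0 by (auto intro: mult_left_mono)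
      finally show ?thesis by simp
    qed
    have f1L: "\<bar>f1 s - f1 r\<bar> \<le> A t - A s" if r: "r \<in> {s..t}" for r
    proof -
      have g: "(g1 has_integral (f1 r - f1 s)) {s..r}"
        using assms st r by (intro primitive_interval[of T]) auto
      have "\<bar>integral {s..r} g1\<bar> \<le> integral {s..r} (\<lambda>t. \<bar>g1 t\<bar>)"
        using integral_norm_bound_integral[of g1 "{s..r}" "\<lambda>t. \<bar>g1 t\<bar>"] g
          integrable_on_subinterval[OF g1a, of s r] r st by force
      also have "\<dots> \<le> A t - A s" using Adiff[of s r] Amono[of r t] r st by auto
      finally show ?thesis using g by (simp add: integral_unique abs_minus_commute)
    qed
    have I: "((\<lambda>r. \<bar>g1 r\<bar> * (M * (t - s)) + M * (A t - A s)) has_integral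
        ((A t - A s) * (M * (t - s)) + (t - s) * (M * (A t - A s)))) {s..t}"
      using st Adiff[OF st] integrable_on_subinterval[OF g1a, of s t]
        has_integral_const_real[of "M * (A t - A s)" s t]
      by (intro has_integral_add has_integral_mult_left) (auto simp: has_integral_integrable_integral)
    have "norm (integral {s..t} (\<lambda>r. g1 r * (f2 t - f2 r) + g2 r * (f1 s - f1 r)))
        \<le> integral {s..t} (\<lambda>r. \<bar>g1 r\<bar> * (M * (t - s)) + M * (A t - A s))"
    proof (rule integral_norm_bound_integral)
      show "norm (g1 r * (f2 t - f2 r) + g2 r * (f1 s - f1 r))
          \<le> \<bar>g1 r\<bar> * (M * (t - s)) + M * (A t - A s)" if r: "r \<in> {s..t}" for r
        using mult_left_mono[OF f2L[OF r], of "\<bar>g1 r\<bar>"] r st M0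
          mult_mono[OF M[of r] f1L[OF r]]
        by (auto simp: abs_mult intro!: order_trans[OF abs_triangle_ineq] add_mono)
    qed (use D I in auto)
    then show ?thesis using D I by (simp add: integral_unique algebra_simps)
  qed
  have M0: "0 \<le> M" if "0 \<le> T" using M[of 0] that by force
  have "(H has_field_derivative 0) (at t within {0..T})" if t: "t \<in> {0..T}" for t
  proof -
    have "((\<lambda>s. (H s - H t) / (s - t)) \<longlongrightarrow> 0) (at t within {0..T})"
    proof (rule Lim_null_comparison)
      have "norm ((H s - H t) / (s - t)) \<le> 2 * M * \<bar>A s - A t\<bar>" if s: "s \<in> {0..T}" "s \<noteq> t" for s
      proof -
        have "\<bar>H s - H t\<bar> \<le> 2 * M * \<bar>A s - A t\<bar> * \<bar>s - t\<bar>"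
          using Hdiff[of s t] Hdiff[of t s] Amono[of s t] Amono[of t s] s t
          by (cases "s \<le> t") (auto simp: abs_minus_commute algebra_simps)
        then show ?thesis using s by (simp add: field_simps)
      qed
      then show "\<forall>\<^sub>F s in at t within {0..T}. norm ((H s - H t) / (s - t)) \<le> 2 * M * \<bar>A s - A t\<bar>"
        by (auto simp: eventually_at_filter)
      have "(A \<longlongrightarrow> A t) (at t within {0..T})"
        using Acont t by (auto simp: continuous_on_def)
      then have "((\<lambda>s. 2 * M * \<bar>A s - A t\<bar>) \<longlongrightarrow> 2 * M * \<bar>A t - A t\<bar>) (at t within {0..T})"
        by (intro tendsto_intros)
      then show "((\<lambda>s. 2 * M * \<bar>A s - A t\<bar>) \<longlongrightarrow> 0) (at t within {0..T})" by simp
    qed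
    then show ?thesis by (simp add: has_field_derivative_iff)
  qed
  then obtain C where "\<And>t. t \<in> {0..T} \<Longrightarrow> H t = C"
    using has_field_derivative_zero_constant[of "{0..T}" H] by auto
  then have const: "H t = H 0" if "t \<in> {0..T}" for t using that by force
  have "(J has_integral (f1 t * f2 t - f1 0 * f2 0)) {0..t}" if t: "t \<in> {0..T}" for t
    using const[OF t] integrable_on_subinterval[OF Jint, of 0 t] t
    unfolding H_def by (auto simp: has_integral_integrable_integral)
  with Jabs show ?thesis unfolding primitive_def J_def by auto
qed

text \<open>The class of time dependences in all energy arguments: it is closed under sums and products and contains the
  solution and its time derivative.\<close>

definition lipschitz_primitive :: "real \<Rightarrow> (real \<Rightarrow> real) \<Rightarrow> (real \<Rightarrow> real) \<Rightarrow> bool" where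
  "lipschitz_primitive T f g \<longleftrightarrow> primitive T f g \<and> bounded_measurable T g"

lemma lipschitz_primitive_bounded_measurable:
  assumes "lipschitz_primitive T f g"
  shows "bounded_measurable T f" "bounded_measurable T g"
  using assms primitive_bounded_measurable unfolding lipschitz_primitive_def by auto

lemma lipschitz_primitive_cong:
  assumes "lipschitz_primitive T f g" "\<And>t. f t = f' t" "\<And>t. g t = g' t"
  shows "lipschitz_primitive T f' g'"
proof -
  have "f = f'" "g = g'" using assms by auto
  then show ?thesis using assms(1) by simp
qed

lemma lipschitz_primitive_const: "lipschitz_primitive T (\<lambda>t. c) (\<lambda>t. 0)"
  unfolding lipschitz_primitive_def by (intro conjI primitive_const bounded_measurable_const)

lemma lipschitz_primitive_mult:
  "lipschitz_primitive T f g \<Longrightarrow> lipschitz_primitive T f' g' \<Longrightarrow>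
     lipschitz_primitive T (\<lambda>t. f t * f' t) (\<lambda>t. g t * f' t + g' t * f t)"
  unfolding lipschitz_primitive_def
  by (intro conjI primitive_mult bounded_measurable_add bounded_measurable_mult)
    (auto intro: primitive_bounded_measurable)

lemma lipschitz_primitive_add:
  "lipschitz_primitive T f g \<Longrightarrow> lipschitz_primitive T f' g' \<Longrightarrow>
     lipschitz_primitive T (\<lambda>t. f t + f' t) (\<lambda>t. g t + g' t)"
  unfolding lipschitz_primitive_def by (intro conjI primitive_add bounded_measurable_add) auto

lemma lipschitz_primitive_cmult:
  "lipschitz_primitive T f g \<Longrightarrow> lipschitz_primitive T (\<lambda>t. c * f t) (\<lambda>t. c * g t)"
  by (rule lipschitz_primitive_cong[OF lipschitz_primitive_mult[OF lipschitz_primitive_const]]) auto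

lemma lipschitz_primitive_diff:
  "lipschitz_primitive T f g \<Longrightarrow> lipschitz_primitive T f' g' \<Longrightarrow>
     lipschitz_primitive T (\<lambda>t. f t - f' t) (\<lambda>t. g t - g' t)"
  by (rule lipschitz_primitive_cong[OF lipschitz_primitive_add[OF _ lipschitz_primitive_cmult[where c = "-1"]]])
    auto

lemma lipschitz_primitive_divide:
  "lipschitz_primitive T f g \<Longrightarrow> lipschitz_primitive T (\<lambda>t. f t / c) (\<lambda>t. g t / c)"
  by (rule lipschitz_primitive_cong[OF lipschitz_primitive_cmult[where c = "1 / c"]]) auto

lemma lipschitz_primitive_sum:
  "(\<And>x. x \<in> Q \<Longrightarrow> lipschitz_primitive T (f x) (g x)) \<Longrightarrow>
     lipschitz_primitive T (\<lambda>t. \<Sum>x\<in>Q. f x t) (\<lambda>t. \<Sum>x\<in>Q. g x t)"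
  unfolding lipschitz_primitive_def by (auto intro: primitive_sum bounded_measurable_sum)

lemma lipschitz_primitive_C1:
  assumes "\<And>t. (f has_real_derivative g t) (at t)" and "continuous_on UNIV g"
  shows "lipschitz_primitive T f g"
  unfolding lipschitz_primitive_def
  by (intro conjI primitive_C1 bounded_measurable_continuous
      has_field_derivative_at_within[OF assms(1)] continuous_on_subset[OF assms(2)]) auto

lemmas lipschitz_primitive_intros =
  lipschitz_primitive_add lipschitz_primitive_diff lipschitz_primitive_cmult
  lipschitz_primitive_divide lipschitz_primitive_sum lipschitz_primitive_mult

lemma lipschitz_primitive_integral:
  assumes "lipschitz_primitive T f g" "0 \<le> T"
  shows "integral {0..T} g = f T - f 0"
  using assms primitive_integral[of T f g T] unfolding lipschitz_primitive_def by auto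

section \<open>Continuous representatives of weakly differentiable functions\<close>

lemma AE_lebesgue_on_iff_negligible:
  fixes S :: "real set"
  assumes "S \<in> sets lebesgue"
  shows "(AE t in lebesgue_on S. P t) \<longleftrightarrow> (\<exists>N. negligible N \<and> (\<forall>t\<in>S - N. P t))"
proof -
  have "(AE t in lebesgue_on S. P t) \<longleftrightarrow> (AE t in lebesgue. t \<in> S \<longrightarrow> P t)"
    using assms by (subst AE_restrict_space_iff) auto
  also have "\<dots> \<longleftrightarrow> (\<exists>N. negligible N \<and> (\<forall>t\<in>S - N. P t))"
  proof
    assume "AE t in lebesgue. t \<in> S \<longrightarrow> P t"
    then obtain N where "N \<in> null_sets lebesgue" "{t \<in> space lebesgue. \<not> (t \<in> S \<longrightarrow> P t)} \<subseteq> N"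
      unfolding eventually_ae_filter by blast
    then show "\<exists>N. negligible N \<and> (\<forall>t\<in>S - N. P t)"
      by (intro exI[of _ N]) (auto simp: negligible_iff_null_sets)
  next
    assume "\<exists>N. negligible N \<and> (\<forall>t\<in>S - N. P t)"
    then obtain N where "negligible N" "\<forall>t\<in>S - N. P t" by blast
    then show "AE t in lebesgue. t \<in> S \<longrightarrow> P t"
      by (intro AE_I'[of N]) (auto simp: negligible_iff_null_sets)
  qed
  finally show ?thesis .
qed

text \<open>At almost every point the averages over short intervals to the right converge to the value of the function.\<close>

lemma AE_zero_if_interval_integrals_zero:
  fixes D :: "real \<Rightarrow> real"
  assumes "\<And>T. D integrable_on {0..T}"
    and zero: "\<And>a b. 0 < a \<Longrightarrow> a \<le> b \<Longrightarrow> integral {a..b} D = 0"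
  shows "\<exists>N. negligible N \<and> (\<forall>t>0. t \<notin> N \<longrightarrow> D t = 0)"
proof -
  define E where "E t = (if t \<in> {0..} then D t else 0)" for t
  have "E integrable_on cbox a b" for a b :: real
  proof -
    have "E integrable_on {0..b}"
      using assms(1)[of b] by (rule integrable_eq) (auto simp: E_def)
    moreover have "{a..b} \<inter> {0..} = {0..b} \<inter> {a..b}" by auto
    moreover have "D integrable_on {max 0 a..b}"
      using assms(1)[of b] by (rule integrable_on_subinterval) auto
    moreover have "{a..b} \<inter> {0..} = {max 0 a..b}" by auto
    ultimately show ?thesis
      unfolding E_def by (subst integrable_restrict_Int[of "{0..}"]) (simp add: Int_commute)
  qed
  then obtain N where N: "negligible N" "\<And>x e. \<lbrakk>x \<notin> N; 0 < e\<rbrakk> \<Longrightarrow>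
      \<exists>d>0. \<forall>h. 0 < h \<and> h < d \<longrightarrow>
        norm (integral (cbox x (x + h *\<^sub>R One)) E /\<^sub>R h ^ DIM(real) - E x) < e"
    by (rule integrable_ccontinuous_explicit) blast
  have "D t = 0" if t: "t > 0" "t \<notin> N" for t
  proof (rule ccontr)
    assume "D t \<noteq> 0"
    then obtain d where d: "d > 0" "\<forall>h. 0 < h \<and> h < d \<longrightarrow>
        norm (integral (cbox t (t + h *\<^sub>R One)) E /\<^sub>R h ^ DIM(real) - E t) < \<bar>D t\<bar>"
      using N(2)[OF t(2), of "\<bar>D t\<bar>"] by auto
    have "integral {t..t + d / 2} E = integral {t..t + d / 2} D"
      using t by (intro integral_cong) (auto simp: E_def)
    then have "integral (cbox t (t + (d / 2) *\<^sub>R One)) E = 0"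
      using zero[of t "t + d / 2"] t d by simp
    with d(2)[rule_format, of "d / 2"] d(1) t show False by (simp add: E_def)
  qed
  with N(1) show ?thesis by blast
qed

text \<open>Continuous approximations from below of the indicator function of an open interval.\<close>

definition trapezoid :: "real \<Rightarrow> real \<Rightarrow> nat \<Rightarrow> real \<Rightarrow> real" where
  "trapezoid p q n t = max 0 (min 1 (real n * min (t - p) (q - t)))"

lemma trapezoid_continuous: "continuous_on A (trapezoid p q n)"
  unfolding trapezoid_def by (intro continuous_intros)

lemma trapezoid_outside:
  assumes "t \<notin> {p<..<q}" shows "trapezoid p q n t = 0"
proof -
  have "min (t - p) (q - t) \<le> 0" using assms by auto
  then have "real n * min (t - p) (q - t) \<le> 0" by (intro mult_nonneg_nonpos) auto
  then show ?thesis unfolding trapezoid_def by linarith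
qed

lemma trapezoid_bounds: "0 \<le> trapezoid p q n t" "trapezoid p q n t \<le> 1"
  unfolding trapezoid_def by auto

lemma trapezoid_tendsto:
  "(\<lambda>n. trapezoid p q n t) \<longlonglongrightarrow> (if t \<in> {p<..<q} then 1 else 0)"
proof (cases "t \<in> {p<..<q}")
  case True
  define m where "m = min (t - p) (q - t)"
  have "m > 0" using True by (auto simp: m_def)
  then obtain k where "1 < real k * m" using reals_Archimedean3 by blast
  then have "trapezoid p q n t = 1" if "n \<ge> k" for n
  proof -
    have "real k * m \<le> real n * m" using that \<open>m > 0\<close> by simp
    then show ?thesis using \<open>1 < real k * m\<close> by (simp add: trapezoid_def flip: m_def)
  qed
  then have "\<forall>\<^sub>F n in sequentially. trapezoid p q n t = 1"
    by (auto simp: eventually_sequentially)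
  then show ?thesis using True by (auto intro: tendsto_eventually)
next
  case False
  then have "trapezoid p q n t = 0" for n by (rule trapezoid_outside)
  then have "(\<lambda>n. trapezoid p q n t) \<longlonglongrightarrow> 0" by simp
  with False show ?thesis by auto
qed

lemma AE_zero_if_orthogonal_to_continuous:
  fixes D :: "real \<Rightarrow> real"
  assumes D: "\<And>T. D absolutely_integrable_on {0..T}"
    and orth: "\<And>\<zeta> a b. 0 < a \<Longrightarrow> a \<le> b \<Longrightarrow> continuous_on UNIV \<zeta> \<Longrightarrow>
      (\<And>t. t \<notin> {a..b} \<Longrightarrow> \<zeta> t = 0) \<Longrightarrow> integral {0..b} (\<lambda>t. D t * \<zeta> t) = 0"
  shows "\<exists>N. negligible N \<and> (\<forall>t>0. t \<notin> N \<longrightarrow> D t = 0)"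
proof (rule AE_zero_if_interval_integrals_zero)
  show "D integrable_on {0..T}" for T
    using D absolutely_integrable_on_def by blast
  fix p q :: real assume pq: "0 < p" "p \<le> q"
  have "(\<lambda>n. integral {0..q} (\<lambda>t. D t * trapezoid p q n t)) \<longlonglongrightarrow>
      integral {0..q} (\<lambda>t. D t * (if t \<in> {p<..<q} then 1 else 0))"
  proof (rule dominated_convergence)
    show "(\<lambda>t. D t * trapezoid p q n t) integrable_on {0..q}" for n
      using bounded_measurable_absolutely_integrable_mult[OF D
          bounded_measurable_continuous[OF trapezoid_continuous]]
      by (auto simp: absolutely_integrable_on_def)
    show "(\<lambda>t. \<bar>D t\<bar>) integrable_on {0..q}"
      using D[of q] by (auto simp: absolutely_integrable_on_def)
    show "norm (D t * trapezoid p q n t) \<le> \<bar>D t\<bar>" for n t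
      using trapezoid_bounds[of p q n t] by (auto simp: abs_mult intro: mult_left_le)
    show "(\<lambda>n. D t * trapezoid p q n t) \<longlonglongrightarrow> D t * (if t \<in> {p<..<q} then 1 else 0)" for t
      by (intro tendsto_intros trapezoid_tendsto)
  qed
  moreover have "integral {0..q} (\<lambda>t. D t * trapezoid p q n t) = 0" for n
    using pq by (intro orth[of p q "trapezoid p q n"] trapezoid_continuous trapezoid_outside) auto
  ultimately have "(\<lambda>n::nat. 0) \<longlonglongrightarrow> integral {0..q} (\<lambda>t. D t * (if t \<in> {p<..<q} then 1 else 0))"
    by simp
  then have "integral {0..q} (\<lambda>t. D t * (if t \<in> {p<..<q} then 1 else 0)) = 0"
    by (rule LIMSEQ_unique) simp
  also have "(\<lambda>t. D t * (if t \<in> {p<..<q} then 1 else 0)) = (\<lambda>t. if t \<in> {p<..<q} then D t else 0)"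
    by auto
  also have "integral {0..q} \<dots> = integral ({p<..<q} \<inter> {0..q}) D"
    by (rule integral_restrict_Int)
  also have "{p<..<q} \<inter> {0..q} = {p<..<q}" using pq by auto
  finally show "integral {p..q} D = 0" by (simp add: integral_open_interval_real)
qed

lemma set_integral_open_half_line:
  fixes f :: "real \<Rightarrow> real"
  assumes "f absolutely_integrable_on {0..T}" and "\<And>t. t \<notin> {a..T} \<Longrightarrow> f t = 0" and "0 < a"
  shows "(LINT t:{0<..}|lebesgue. f t) = integral {0..T} f"
proof -
  have "(LINT t:{0<..}|lebesgue. f t) = (LINT t:{0..T}|lebesgue. f t)"
    unfolding set_lebesgue_integral_def using assms(2,3)
    by (intro Bochner_Integration.integral_cong) (auto simp: indicator_def)
  also have "\<dots> = integral {0..T} f" using assms(1) by (rule set_lebesgue_integral_eq_integral)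
  finally show ?thesis .
qed

text \<open>Subtracting the primitive \<open>G\<close> of \<open>g\<close> leaves a function \<open>D\<close> with weak derivative \<open>0\<close>.  Every continuous
  function with compact support and mean value zero is the derivative of an admissible test function, so \<open>D\<close> is
  orthogonal to it.  Hence the integral of \<open>D \<zeta>\<close> is a fixed multiple \<open>c\<close> of the integral of \<open>\<zeta>\<close> for all continuous \<open>\<zeta>\<close>
  with compact support, which means \<open>D = c\<close> almost everywhere.\<close>

lemma du_Bois_Reymond:
  assumes f: "\<And>T. f absolutely_integrable_on {0..T}"
    and g: "\<And>T. g absolutely_integrable_on {0..T}"
    and wd: "weak_derivative f g"
  shows "\<exists>c N. negligible N \<and> (\<forall>t>0. t \<notin> N \<longrightarrow> f t = c + integral {0..t} g)"
proof -
  define G where "G t = integral {0..t} g" for t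
  have pG: "primitive T G g" for T
    unfolding primitive_def G_def using g[of T]
    by (auto simp: has_integral_integrable_integral absolutely_integrable_on_def
        intro: integrable_on_subinterval)
  have G: "G absolutely_integrable_on {0..T}" for T
    using pG by (intro bounded_measurable_absolutely_integrable primitive_bounded_measurable)
  define D where "D t = f t - G t" for t
  have D: "D absolutely_integrable_on {0..T}" for T
    unfolding D_def by (intro set_integral_diff f G)
  have int_cont: "(\<lambda>t. k t * \<zeta> t) absolutely_integrable_on {0..T}"
    if "k absolutely_integrable_on {0..T}" "continuous_on UNIV \<zeta>" for k \<zeta> :: "real \<Rightarrow> real" and T
    by (intro bounded_measurable_absolutely_integrable_mult bounded_measurable_continuous that
        continuous_on_subset[OF that(2)]) auto
  have mean_zero: "integral {0..b} (\<lambda>t. D t * \<zeta> t) = 0"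
    if ab: "0 < a" "a \<le> b" and \<zeta>: "continuous_on UNIV \<zeta>" "\<And>t. t \<notin> {a..b} \<Longrightarrow> \<zeta> t = 0"
      "integral {0..b} \<zeta> = 0" for \<zeta> a b
  proof -
    define \<phi> where "\<phi> t = integral {0..t} \<zeta>" for t
    have \<phi>0: "\<phi> t = 0" if "t < a" for t
    proof -
      have "\<phi> t = integral {0..t} (\<lambda>_. 0)" unfolding \<phi>_def
        using that by (intro integral_cong \<zeta>(2)) auto
      then show ?thesis by simp
    qed
    have \<zeta>i: "\<zeta> integrable_on {s..t}" for s t
      by (intro integrable_continuous_real continuous_on_subset[OF \<zeta>(1)]) auto
    have \<phi>1: "\<phi> t = 0" if "t > b" for t
    proof -
      have "\<phi> t = integral {0..b} \<zeta> + integral {b..t} \<zeta>" unfolding \<phi>_def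
        using that ab \<zeta>i by (intro Henstock_Kurzweil_Integration.integral_combine[symmetric]) auto
      also have "integral {b..t} \<zeta> = integral {b..t} (\<lambda>_. 0)"
        by (rule integral_spike[of "{b}"]) (use \<zeta>(2) in auto)
      finally show ?thesis using \<zeta>(3) by simp
    qed
    have der: "(\<phi> has_real_derivative \<zeta> t) (at t)" for t
    proof (cases "t > 0")
      case True
      have "(\<phi> has_real_derivative \<zeta> t) (at t within {0..t + 1})" unfolding \<phi>_def
        using True
        by (intro integral_has_real_derivative continuous_on_subset[OF \<zeta>(1)]) auto
      then show ?thesis using True by (simp add: at_within_Icc_at)
    next
      case False
      then have "\<zeta> t = 0" using \<zeta>(2)[of t] ab by auto
      moreover have "\<forall>\<^sub>F s in nhds t. s < a"
        using False ab by (intro order_tendstoD[OF filterlim_ident]) auto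
      then have "\<forall>\<^sub>F s in nhds t. \<phi> s = 0" by eventually_elim (rule \<phi>0)
      ultimately show ?thesis using DERIV_cong_ev[of t t \<phi> "\<lambda>_. 0" 0 0] by auto
    qed
    have \<phi>c: "continuous_on UNIV \<phi>"
      using der by (intro continuous_at_imp_continuous_on ballI DERIV_isCont)
    have out: "\<phi> t = 0" if "t \<notin> {a..b}" for t
      using that \<phi>0[of t] \<phi>1[of t] by (auto simp: not_le)
    have "(LINT t:{0<..}|lebesgue. f t * \<zeta> t) = - (LINT t:{0<..}|lebesgue. g t * \<phi> t)"
      using wd ab out der \<zeta>(1) unfolding weak_derivative_def by blast
    then have e1: "integral {0..b} (\<lambda>t. f t * \<zeta> t) = - integral {0..b} (\<lambda>t. g t * \<phi> t)"
      using ab \<zeta> out set_integral_open_half_line[OF int_cont[OF f \<zeta>(1)], of a b]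
        set_integral_open_half_line[OF int_cont[OF g \<phi>c], of a b] by auto
    have "primitive b (\<lambda>t. G t * \<phi> t) (\<lambda>t. g t * \<phi> t + \<zeta> t * G t)"
      by (intro primitive_mult pG primitive_C1 has_field_derivative_at_within[OF der]
          bounded_measurable_continuous continuous_on_subset[OF \<zeta>(1)]) auto
    then have "integral {0..b} (\<lambda>t. g t * \<phi> t + \<zeta> t * G t) = G b * \<phi> b - G 0 * \<phi> 0"
      using primitive_integral[of b _ _ b] ab by auto
    also have "\<dots> = 0" using \<phi>0[of 0] ab \<zeta>(3) by (simp add: \<phi>_def)
    finally have "integral {0..b} (\<lambda>t. g t * \<phi> t) + integral {0..b} (\<lambda>t. G t * \<zeta> t) = 0"
      using int_cont[OF g \<phi>c, of b] int_cont[OF G \<zeta>(1), of b]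
      by (subst (asm) integral_add) (auto simp: absolutely_integrable_on_def mult.commute)
    moreover have "integral {0..b} (\<lambda>t. D t * \<zeta> t) =
        integral {0..b} (\<lambda>t. f t * \<zeta> t) - integral {0..b} (\<lambda>t. G t * \<zeta> t)"
      unfolding D_def left_diff_distrib using int_cont[OF f \<zeta>(1), of b] int_cont[OF G \<zeta>(1), of b]
      by (intro integral_diff) (auto simp: absolutely_integrable_on_def)
    ultimately show ?thesis using e1 by simp
  qed
  \<comment> \<open>Subtracting a multiple of this function with non-zero integral makes the mean value of a
    given test function vanish.\<close>
  define \<zeta>0 :: "real \<Rightarrow> real" where "\<zeta>0 = trapezoid 1 2 1"
  define \<kappa> where "\<kappa> = integral {1..2} \<zeta>0"
  have \<zeta>0c: "continuous_on A \<zeta>0" for A unfolding \<zeta>0_def by (rule trapezoid_continuous)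
  have \<zeta>0o: "\<zeta>0 t = 0" if "t \<notin> {1..2}" for t
    unfolding \<zeta>0_def using that by (intro trapezoid_outside) auto
  have "\<kappa> \<noteq> 0"
  proof
    assume "\<kappa> = 0"
    then have "\<forall>t\<in>{1..2}. \<zeta>0 t = 0" unfolding \<kappa>_def
      by (subst (asm) integral_eq_0_iff) (auto simp: \<zeta>0_def trapezoid_bounds trapezoid_continuous)
    then have "\<zeta>0 (3 / 2) = 0" by auto
    then show False by (simp add: \<zeta>0_def trapezoid_def)
  qed
  have restr: "integral {0..b} k = integral {c..d} k"
    if "\<And>t. t \<notin> {c..d} \<Longrightarrow> k t = 0" "{c..d} \<subseteq> {0..b}" for b c d and k :: "real \<Rightarrow> real"
  proof -
    have "k = (\<lambda>t. if t \<in> {c..d} then k t else 0)" using that(1) by auto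
    then have "integral {0..b} k = integral ({c..d} \<inter> {0..b}) k"
      using integral_restrict_Int[of "{0..b}" "{c..d}" k] by simp
    also have "{c..d} \<inter> {0..b} = {c..d}" using that(2) by blast
    finally show ?thesis .
  qed
  define c where "c = integral {0..2} (\<lambda>t. D t * \<zeta>0 t) / \<kappa>"
  have "\<exists>N. negligible N \<and> (\<forall>t>0. t \<notin> N \<longrightarrow> D t - c = 0)"
  proof (rule AE_zero_if_orthogonal_to_continuous)
    show "(\<lambda>t. D t - c) absolutely_integrable_on {0..T}" for T
      by (intro set_integral_diff D absolutely_integrable_continuous_real continuous_intros)
    fix \<zeta> :: "real \<Rightarrow> real" and a b :: real
    assume ab: "0 < a" "a \<le> b" and \<zeta>: "continuous_on UNIV \<zeta>" "\<And>t. t \<notin> {a..b} \<Longrightarrow> \<zeta> t = 0"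
    define m B where "m = integral {0..b} \<zeta> / \<kappa>" and "B = max b 2"
    have B: "0 \<le> b" "b \<le> B" "2 \<le> B" using ab by (auto simp: B_def)
    have i1: "integral {0..B} \<zeta> = integral {0..b} \<zeta>"
      by (intro restr) (use \<zeta> B ab in auto)
    have i2: "integral {0..B} \<zeta>0 = \<kappa>" unfolding \<kappa>_def
      by (intro restr \<zeta>0o) (use B in auto)
    have i3: "integral {0..B} (\<lambda>t. D t * \<zeta>0 t) = c * \<kappa>"
      using \<open>\<kappa> \<noteq> 0\<close> B \<zeta>0o restr[of 0 2 "\<lambda>t. D t * \<zeta>0 t" B] unfolding c_def by auto
    have i4: "integral {0..B} (\<lambda>t. D t * \<zeta> t) = integral {0..b} (\<lambda>t. D t * \<zeta> t)"
      by (intro restr) (use \<zeta> B ab in auto)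
    have ci: "\<zeta> integrable_on {0..t}" "\<zeta>0 integrable_on {0..t}"
      "(\<lambda>t. D t * \<zeta> t) integrable_on {0..t}" "(\<lambda>t. D t * \<zeta>0 t) integrable_on {0..t}" for t
      using int_cont[OF D \<zeta>(1), of t] int_cont[OF D \<zeta>0c, of t]
      by (auto simp: absolutely_integrable_on_def intro!: integrable_continuous_real
        continuous_on_subset[OF \<zeta>(1)] \<zeta>0c)
    have "integral {0..B} (\<lambda>t. D t * (\<zeta> t - m * \<zeta>0 t)) = 0"
    proof (rule mean_zero)
      show "0 < min a 1" "min a 1 \<le> B" using ab B by auto
      show "continuous_on UNIV (\<lambda>t. \<zeta> t - m * \<zeta>0 t)" by (intro continuous_intros \<zeta> \<zeta>0c)
      show "\<zeta> t - m * \<zeta>0 t = 0" if "t \<notin> {min a 1..B}" for t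
        using that \<zeta>(2)[of t] \<zeta>0o[of t] B by (auto simp: min_le_iff_disj)
      have "integral {0..B} (\<lambda>t. \<zeta> t - m * \<zeta>0 t) = integral {0..B} \<zeta> - m * integral {0..B} \<zeta>0"
        using ci by (subst integral_diff) (auto intro!: integrable_on_mult_right)
      then show "integral {0..B} (\<lambda>t. \<zeta> t - m * \<zeta>0 t) = 0"
        using i1 i2 \<open>\<kappa> \<noteq> 0\<close> by (simp add: m_def)
    qed
    moreover have "integral {0..B} (\<lambda>t. D t * (\<zeta> t - m * \<zeta>0 t)) =
        integral {0..B} (\<lambda>t. D t * \<zeta> t) - m * integral {0..B} (\<lambda>t. D t * \<zeta>0 t)"
      using ci unfolding right_diff_distrib mult.left_commute[of _ m]
      by (subst integral_diff) (auto intro!: integrable_on_mult_right)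
    moreover have "integral {0..b} (\<lambda>t. (D t - c) * \<zeta> t) =
        integral {0..b} (\<lambda>t. D t * \<zeta> t) - c * integral {0..b} \<zeta>"
      using ci unfolding left_diff_distrib
      by (subst integral_diff) (auto intro!: integrable_on_mult_right)
    ultimately show "integral {0..b} (\<lambda>t. (D t - c) * \<zeta> t) = 0"
      using i3 i4 \<open>\<kappa> \<noteq> 0\<close> by (simp add: m_def)
  qed
  then show ?thesis unfolding D_def G_def by (metis diff_eq_eq eq_iff_diff_eq_0)
qed

lemma L2_loc_absolutely_integrable:
  assumes "L2_loc f" shows "f absolutely_integrable_on {0..T}"
proof (cases "T > 0")
  case True
  have m: "f \<in> borel_measurable (lebesgue_on {0<..<T})"
    using assms unfolding L2_loc_def by (auto intro: measurable_restrict_mono)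
  have sq: "(\<lambda>t. (f t)\<^sup>2) integrable_on {0<..<T}"
    using assms True unfolding L2_loc_def by (auto dest: set_lebesgue_integral_eq_integral(1))
  have "(\<lambda>t. 1 + (f t)\<^sup>2) integrable_on {0<..<T}"
    using sq by (intro integrable_add) (auto simp: integrable_on_open_interval_real)
  moreover have "norm (f t) \<le> 1 + (f t)\<^sup>2" for t
    using sum_squares_bound[of 1 "\<bar>f t\<bar>"] by simp
  ultimately have "f absolutely_integrable_on {0<..<T}"
    using m by (intro measurable_bounded_by_integrable_imp_absolutely_integrable) auto
  then show ?thesis by (simp add: absolutely_integrable_on_Icc_iff_Ioo)
next
  case False
  then have "negligible {0..T}" by (cases "T = 0") auto
  then show ?thesis by (rule absolutely_integrable_negligible)
qed

text \<open>Null sets have empty interior.\<close>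

lemma continuous_AE_zero:
  fixes K :: "real \<Rightarrow> real"
  assumes "continuous_on {0..} K" "negligible N" "\<And>t. t > 0 \<Longrightarrow> t \<notin> N \<Longrightarrow> K t = 0" "t \<ge> 0"
  shows "K t = 0"
proof (rule ccontr)
  assume "K t \<noteq> 0"
  then obtain d where d: "d > 0" "\<And>s. s \<ge> 0 \<Longrightarrow> dist s t < d \<Longrightarrow> dist (K s) (K t) < \<bar>K t\<bar>"
    using assms(1,4) unfolding continuous_on_iff by (metis atLeast_iff zero_less_abs_iff)
  have "{t<..<t + d} \<subseteq> N"
  proof
    fix s assume s: "s \<in> {t<..<t + d}"
    then have "K s \<noteq> 0" using d(2)[of s] assms(4) by (auto simp: dist_real_def)
    then show "s \<in> N" using assms(3)[of s] assms(4) s by auto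
  qed
  then have "negligible {t<..<t + d}" using assms(2) negligible_subset by blast
  then show False using open_not_negligible[of "{t<..<t + d}"] d(1) by auto
qed

lemma trace_at_0_eq:
  assumes "continuous_on {0..} F" "negligible N" "\<And>t. t > 0 \<Longrightarrow> t \<notin> N \<Longrightarrow> f t = F t"
  shows "trace_at_0 f = F 0"
  unfolding trace_at_0_def
proof (rule the_equality)
  show "\<exists>F'. continuous_on {0..} F' \<and> (AE t in lebesgue_on {0<..}. f t = F' t) \<and> F' 0 = F 0"
    using assms by (intro exI[of _ F]) (auto simp: AE_lebesgue_on_iff_negligible)
  fix a assume "\<exists>F'. continuous_on {0..} F' \<and> (AE t in lebesgue_on {0<..}. f t = F' t) \<and> F' 0 = a"
  then obtain F' N' where F': "continuous_on {0..} F'" "negligible N'"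
    "\<And>t. t > 0 \<Longrightarrow> t \<notin> N' \<Longrightarrow> f t = F' t" "F' 0 = a"
    by (auto simp: AE_lebesgue_on_iff_negligible)
  have "F' 0 - F 0 = 0"
  proof (rule continuous_AE_zero[where K = "\<lambda>t. F' t - F t" and t = 0])
    show "continuous_on {0..} (\<lambda>t. F' t - F t)" by (intro continuous_intros assms F')
    show "negligible (N \<union> N')" using assms F' by simp
    show "F' t - F t = 0" if "t > 0" "t \<notin> N \<union> N'" for t
      using assms(3)[of t] F'(3)[of t] that by simp
  qed simp
  then show "a = F 0" using F'(4) by simp
qed

lemma primitive_continuous_half_line:
  assumes "\<And>T. primitive T F g" shows "continuous_on {0..} F"
  unfolding continuous_on_eq_continuous_within
proof
  fix t :: real assume t: "t \<in> {0..}"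
  have "continuous (at t within {0..t + 1}) F"
    using primitive_continuous[OF assms, of "t + 1"] t by (auto simp: continuous_on_eq_continuous_within)
  moreover have "at t within {0..t + 1} = at t within {0..}"
    by (rule at_within_nhd[of _ "{..<t + 1}"]) (use t in auto)
  ultimately show "continuous (at t within {0..}) F" by simp
qed

lemma weak_derivative_AE_cong:
  assumes "weak_derivative f g" "negligible N" "\<And>t. t > 0 \<Longrightarrow> t \<notin> N \<Longrightarrow> f' t = f t"
    and "L2_loc f" "L2_loc f'"
  shows "weak_derivative f' g"
proof -
  have "(LINT t:{0<..}|lebesgue. f' t * \<phi> t) = (LINT t:{0<..}|lebesgue. f t * \<phi> t)"
    if "continuous_on UNIV \<phi>" for \<phi> :: "real \<Rightarrow> real"
  proof -
    have \<phi>: "\<phi> \<in> borel_measurable (lebesgue_on {0<..})"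
      using that by (intro continuous_imp_measurable_on_sets_lebesgue continuous_on_subset[OF that]) auto
    have "(LINT t|lebesgue_on {0<..}. f' t * \<phi> t) = (LINT t|lebesgue_on {0<..}. f t * \<phi> t)"
    proof (rule integral_cong_AE)
      show "AE t in lebesgue_on {0<..}. f' t * \<phi> t = f t * \<phi> t"
        using assms(2,3) by (subst AE_lebesgue_on_iff_negligible) (auto intro!: exI[of _ N])
    qed (use assms(4,5) \<phi> in \<open>auto simp: L2_loc_def intro!: borel_measurable_times\<close>)
    then show ?thesis
      by (simp add: set_lebesgue_integral_def integral_restrict_space)
  qed
  then show ?thesis using assms(1) unfolding weak_derivative_def by metis
qed

text \<open>The chosen weak derivatives are determined up to null sets only.  The argument of du Bois-Reymond is used for both the chosen
  first derivative and the one from the definition of \<open>H\<^sup>2\<close>, to see that the former is again weakly differentiable.\<close>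

lemma H2_loc_representative:
  assumes "H2_loc f"
  obtains F P N where "\<And>T. primitive T F P" "\<And>T. primitive T P (weak_deriv (weak_deriv f))"
    "negligible N" "\<And>t. t > 0 \<Longrightarrow> t \<notin> N \<Longrightarrow> f t = F t"
    "trace_at_0 f = F 0" "trace_at_0 (weak_deriv f) = P 0"
proof -
  obtain g g' where fg: "L2_loc f" "L2_loc g" "weak_derivative f g" "L2_loc g'" "weak_derivative g g'"
    using assms unfolding H2_loc_def by blast
  define p where "p = weak_deriv f"
  have p: "L2_loc p" "weak_derivative f p"
    using someI[of "\<lambda>g. L2_loc g \<and> weak_derivative f g" g] fg unfolding p_def weak_deriv_def by auto
  have prim: "primitive T (\<lambda>t. c + integral {0..t} k) k" if "L2_loc k" for k c T
    unfolding primitive_def using L2_loc_absolutely_integrable[OF that, of T]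
    by (auto simp: has_integral_integrable_integral absolutely_integrable_on_def
        intro: integrable_on_subinterval)
  obtain c N where cN: "negligible N" "\<And>t. t > 0 \<Longrightarrow> t \<notin> N \<Longrightarrow> f t = c + integral {0..t} p"
    using du_Bois_Reymond[OF L2_loc_absolutely_integrable L2_loc_absolutely_integrable p(2)] fg p by blast
  obtain c2 N2 where cN2: "negligible N2" "\<And>t. t > 0 \<Longrightarrow> t \<notin> N2 \<Longrightarrow> f t = c2 + integral {0..t} g"
    using du_Bois_Reymond[OF L2_loc_absolutely_integrable L2_loc_absolutely_integrable fg(3)] fg p by blast
  \<comment> \<open>Both representations of \<open>f\<close> are continuous up to \<open>0\<close>, so they agree everywhere.\<close>
  have eq: "c + integral {0..t} p - (c2 + integral {0..t} g) = 0" if "t \<ge> 0" for t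
  proof (rule continuous_AE_zero[OF _ _ _ that])
    show "continuous_on {0..} (\<lambda>t. c + integral {0..t} p - (c2 + integral {0..t} g))"
      by (intro continuous_on_diff primitive_continuous_half_line[OF prim] p fg)
    show "negligible (N \<union> N2)" using cN cN2 by simp
    show "c + integral {0..t} p - (c2 + integral {0..t} g) = 0" if "t > 0" "t \<notin> N \<union> N2" for t
      using cN(2)[of t] cN2(2)[of t] that by simp
  qed
  have int: "p integrable_on {0..t}" "g integrable_on {0..t}" for t
    using L2_loc_absolutely_integrable p(1) fg(2) absolutely_integrable_on_def by blast+
  have "\<exists>N. negligible N \<and> (\<forall>t>0. t \<notin> N \<longrightarrow> p t - g t = 0)"
  proof (rule AE_zero_if_interval_integrals_zero)
    show "(\<lambda>t. p t - g t) integrable_on {0..T}" for T by (intro integrable_diff int)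
    fix a b :: real assume ab: "0 < a" "a \<le> b"
    have i0: "integral {0..t} (\<lambda>t. p t - g t) = c2 - c" if "t \<ge> 0" for t
      using eq[OF that] int by (simp add: integral_diff)
    show "integral {a..b} (\<lambda>t. p t - g t) = 0"
      using ab i0[of a] i0[of b] int
        Henstock_Kurzweil_Integration.integral_combine[of 0 a b "\<lambda>t. p t - g t"]
      by (force intro: integrable_diff)
  qed
  then obtain N3 where N3: "negligible N3" "\<And>t. t > 0 \<Longrightarrow> t \<notin> N3 \<Longrightarrow> p t = g t" by auto
  then have "weak_derivative p g'" using weak_derivative_AE_cong[OF fg(5)] p(1) fg(2) by blast
  define q where "q = weak_deriv p"
  have q: "L2_loc q" "weak_derivative p q"
    using someI[of "\<lambda>g. L2_loc g \<and> weak_derivative p g" g'] fg \<open>weak_derivative p g'\<close>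
    unfolding q_def weak_deriv_def by auto
  obtain c4 N4 where cN4: "negligible N4" "\<And>t. t > 0 \<Longrightarrow> t \<notin> N4 \<Longrightarrow> p t = c4 + integral {0..t} q"
    using du_Bois_Reymond[OF L2_loc_absolutely_integrable L2_loc_absolutely_integrable q(2)] q p by blast
  define F where "F t = c + integral {0..t} p" for t
  define P where "P t = c4 + integral {0..t} q" for t
  have P: "primitive T P q" for T unfolding P_def by (rule prim[OF q(1)])
  have Fp: "primitive T F p" for T unfolding F_def by (rule prim[OF p(1)])
  have F: "primitive T F P" for T
    unfolding primitive_def
  proof (intro conjI ballI)
    show "P absolutely_integrable_on {0..T}"
      by (intro bounded_measurable_absolutely_integrable primitive_bounded_measurable[OF P])
    fix t assume t: "t \<in> {0..T}"
    show "(P has_integral F t - F 0) {0..t}"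
    proof (rule has_integral_spike)
      show "negligible (insert 0 N4)" using cN4 by simp
      show "P s = p s" if "s \<in> {0..t} - insert 0 N4" for s
        using cN4(2)[of s] that by (simp add: P_def)
      show "(p has_integral F t - F 0) {0..t}" using Fp[of T] t unfolding primitive_def by blast
    qed
  qed
  have fF: "f t = F t" if "t > 0" "t \<notin> N" for t using cN(2)[OF that] by (simp add: F_def)
  have "trace_at_0 f = F 0"
    by (rule trace_at_0_eq[OF primitive_continuous_half_line[OF F] cN(1) fF])
  moreover have "trace_at_0 (weak_deriv f) = P 0"
    using cN4 by (intro trace_at_0_eq[OF primitive_continuous_half_line[OF P] cN4(1)])
      (auto simp: P_def p_def)
  ultimately show thesis
    using that[OF F P[unfolded q_def p_def] cN(1) fF] by blast
qed

section \<open>Finitely supported functions on the lattice\<close>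

abbreviation fwd :: "real \<Rightarrow> 'd \<Rightarrow> real ^ 'd::finite \<Rightarrow> real ^ 'd" where
  "fwd h k x \<equiv> x + h *\<^sub>R axis k 1"

abbreviation bwd :: "real \<Rightarrow> 'd \<Rightarrow> real ^ 'd::finite \<Rightarrow> real ^ 'd" where
  "bwd h k x \<equiv> x - h *\<^sub>R axis k 1"

text \<open>Summation by parts on the lattice: the translation is harmless as long as the summand does not reach the edge of
  the finite set.\<close>

lemma sum_shift:
  fixes F :: "'a::ab_group_add \<Rightarrow> real"
  assumes "finite Q" and "\<And>x. F x \<noteq> 0 \<Longrightarrow> x \<in> Q \<and> x - a \<in> Q"
  shows "(\<Sum>x\<in>Q. F (x + a)) = (\<Sum>x\<in>Q. F x)"
proof -
  have "(\<Sum>x\<in>Q. F (x + a)) = (\<Sum>x\<in>(\<lambda>x. x + a) ` Q. F x)"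
    by (subst sum.reindex) (auto simp: inj_on_def)
  also have "\<dots> = (\<Sum>x\<in>{x. F x \<noteq> 0}. F x)"
  proof (rule sum.mono_neutral_right)
    show "{x. F x \<noteq> 0} \<subseteq> (\<lambda>x. x + a) ` Q"
    proof
      fix x assume "x \<in> {x. F x \<noteq> 0}"
      then have "x - a \<in> Q" using assms(2) by simp
      then show "x \<in> (\<lambda>x. x + a) ` Q" by (rule rev_image_eqI) simp
    qed
  qed (use assms in auto)
  also have "\<dots> = (\<Sum>x\<in>Q. F x)"
    by (rule sum.mono_neutral_left) (use assms in auto)
  finally show ?thesis .
qed

text \<open>A function supported here can be shifted by one lattice step inside \<open>Q\<close>, so sums over \<open>Q\<close> of products with it
  behave like sums over the whole lattice.\<close>

definition margin :: "real \<Rightarrow> (real ^ 'd::finite) set \<Rightarrow> (real ^ 'd) set" where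
  "margin h Q = {x \<in> Q. \<forall>k. fwd h k x \<in> Q \<and> bwd h k x \<in> Q}"

lemma axis_shift_nth [simp]:
  "(fwd h k x) $ j = x $ j + (if j = k then h else 0)"
  "(bwd h k x) $ j = x $ j - (if j = k then h else (0::real))"
  by (auto simp: axis_def)

lemma sum_shift_up:
  fixes c f g :: "real ^ 'd::finite \<Rightarrow> real"
  assumes "finite Q" and "\<And>x. f x \<noteq> 0 \<Longrightarrow> x \<in> margin h Q"
  shows "(\<Sum>x\<in>Q. c x * f (fwd h k x) * g x) =
    (\<Sum>x\<in>Q. c (bwd h k x) * f x * g (bwd h k x))"
  using sum_shift[OF assms(1), of "\<lambda>x. c (bwd h k x) * f x * g (bwd h k x)"
      "h *\<^sub>R axis k 1"] assms(2)
  by (auto simp: margin_def)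

lemma sum_shift_down:
  fixes c f g :: "real ^ 'd::finite \<Rightarrow> real"
  assumes "finite Q" and "\<And>x. f x \<noteq> 0 \<Longrightarrow> x \<in> margin h Q"
  shows "(\<Sum>x\<in>Q. c x * f (bwd h k x) * g x) =
    (\<Sum>x\<in>Q. c (fwd h k x) * f x * g (fwd h k x))"
  using sum_shift[OF assms(1), of "\<lambda>x. c (fwd h k x) * f x * g (fwd h k x)"
      "- h *\<^sub>R axis k 1"] assms(2)
  by (auto simp: margin_def)

lemma mesh_shift:
  assumes "x \<in> mesh h"
  shows "fwd h k x \<in> mesh h" "bwd h k x \<in> mesh h"
proof -
  obtain j :: "int ^ 'a" where j: "x = (\<chi> k. h * of_int (j $ k))"
    using assms unfolding mesh_def by blast
  have "fwd h k x = (\<chi> i. h * of_int ((j + axis k 1) $ i))"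
    "bwd h k x = (\<chi> i. h * of_int ((j - axis k 1) $ i))"
    unfolding j vec_eq_iff by (auto simp: axis_def algebra_simps)
  then show "fwd h k x \<in> mesh h" "bwd h k x \<in> mesh h"
    unfolding mesh_def by blast+
qed

lemma mesh_shift_iff:
  "fwd h k x \<in> mesh h \<longleftrightarrow> x \<in> mesh h" "bwd h k x \<in> mesh h \<longleftrightarrow> x \<in> mesh h"
  using mesh_shift(1)[of x h k] mesh_shift(2)[of x h k] mesh_shift(2)[of "fwd h k x" h k]
    mesh_shift(1)[of "bwd h k x" h k] unfolding add_diff_cancel_right' diff_add_cancel by blast+

definition mesh_box :: "real \<Rightarrow> real \<Rightarrow> (real ^ 'd::finite) set" where
  "mesh_box h R = {x \<in> mesh h. \<forall>k. \<bar>x $ k\<bar> \<le> R}"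

lemma finite_mesh_box:
  assumes "0 < h" shows "finite (mesh_box h R :: (real ^ 'd::finite) set)"
proof -
  define N where "N = \<lceil>R / h\<rceil>"
  let ?B = "vec_lambda ` (UNIV \<rightarrow>\<^sub>E {-N..N}) :: (int ^ 'd) set"
  have "(mesh_box h R :: (real ^ 'd) set) \<subseteq> (\<lambda>j. \<chi> k. h * of_int (j $ k)) ` ?B"
  proof
    fix x :: "real ^ 'd" assume x: "x \<in> mesh_box h R"
    then obtain j :: "int ^ 'd" where j: "x = (\<chi> k. h * of_int (j $ k))"
      unfolding mesh_box_def mesh_def by blast
    have "j $ k \<in> {-N..N}" for k
    proof -
      have "\<bar>h * of_int (j $ k)\<bar> \<le> R" using x unfolding mesh_box_def j by simp
      then have "\<bar>of_int (j $ k)\<bar> \<le> R / h" using assms by (simp add: abs_mult field_simps)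
      also have "R / h \<le> of_int N" unfolding N_def by (rule le_of_int_ceiling)
      finally have "\<bar>j $ k\<bar> \<le> N" by linarith
      then show ?thesis by auto
    qed
    then have "j \<in> ?B" by (intro image_eqI[of _ _ "vec_nth j"]) (auto simp: PiE_UNIV_domain)
    then show "x \<in> (\<lambda>j. \<chi> k. h * of_int (j $ k)) ` ?B" unfolding j by blast
  qed
  moreover have "finite ?B" by (intro finite_imageI finite_PiE) auto
  ultimately show ?thesis using finite_subset by blast
qed

lemma mesh_box_margin:
  assumes "x \<in> mesh_box h R" "R + h \<le> S" "0 < h"
  shows "x \<in> margin h (mesh_box h S)"
proof -
  have b: "\<bar>x $ j\<bar> \<le> R" for j using assms(1) by (simp add: mesh_box_def)
  have "\<bar>x $ j\<bar> \<le> S" "\<bar>(fwd h k x) $ j\<bar> \<le> S" "\<bar>(bwd h k x) $ j\<bar> \<le> S" for j k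
    using b[of j] assms(2,3) unfolding axis_shift_nth by (auto simp: abs_le_iff)
  then show ?thesis
    using assms(1) mesh_shift[of x h] unfolding margin_def mesh_box_def by blast
qed

section \<open>The Laplacian conjugated by a Gaussian weight\<close>

lemma square_le_if_abs_le: "\<bar>a\<bar> \<le> b \<Longrightarrow> a\<^sup>2 \<le> (b::real)\<^sup>2"
  by (metis abs_ge_zero power2_abs power_mono)

lemma sinh_le_quadratic:
  fixes y :: real assumes "0 \<le> y" "y \<le> 1" shows "sinh y \<le> y + y\<^sup>2 / 2"
proof -
  have "exp y \<le> 1 + y + y\<^sup>2" using assms by (rule exp_bound)
  moreover have "1 - y \<le> exp (- y)" using exp_ge_add_one_self[of "- y"] by simp
  ultimately show ?thesis by (simp add: sinh_field_def field_simps)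
qed

lemma sinh_le_double:
  fixes y :: real assumes "0 \<le> y" "y \<le> 1" shows "sinh y \<le> 2 * y"
proof -
  have "y\<^sup>2 \<le> y" using assms by (simp add: power2_eq_square mult_left_le)
  with sinh_le_quadratic[OF assms] show ?thesis using assms by linarith
qed

lemma cosh_minus_one_le_square:
  fixes y :: real assumes "\<bar>y\<bar> \<le> 1" shows "cosh y - 1 \<le> y\<^sup>2"
proof -
  define z where "z = \<bar>y\<bar> / 2"
  have z: "0 \<le> z" "z \<le> 1 / 2" using assms by (auto simp: z_def)
  have "z\<^sup>2 \<le> z / 2" using mult_left_mono[of z "1/2" z] z by (simp add: power2_eq_square)
  then have "sinh z \<le> 5 / 4 * z" using sinh_le_quadratic[of z] z by simp
  then have "(sinh z)\<^sup>2 \<le> (5 / 4 * z)\<^sup>2" using z by (intro power_mono) auto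
  moreover have "cosh \<bar>y\<bar> = 1 + 2 * (sinh z)\<^sup>2"
    using cosh_double[of z] cosh_square_eq[of z] by (simp add: z_def)
  moreover have "cosh \<bar>y\<bar> = cosh y" by (simp add: abs_if)
  moreover have "(5 / 4 * z)\<^sup>2 * 2 \<le> y\<^sup>2" by (simp add: z_def power2_eq_square)
  ultimately show ?thesis by linarith
qed

lemma sinh_square_le: "(sinh y)\<^sup>2 \<le> 4 * y\<^sup>2" if "\<bar>y\<bar> \<le> 1" for y :: real
proof -
  have "sinh \<bar>y\<bar> \<le> 2 * \<bar>y\<bar>" "0 \<le> sinh \<bar>y\<bar>" using sinh_le_double[of "\<bar>y\<bar>"] that by auto
  then have "(sinh \<bar>y\<bar>)\<^sup>2 \<le> (2 * \<bar>y\<bar>)\<^sup>2" by (intro power_mono) auto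
  then show ?thesis by (auto simp: abs_if power_mult_distrib split: if_splits)
qed


lemma sinh_mult_square_le:
  fixes \<beta> y :: real assumes \<beta>: "0 \<le> \<beta>" "\<beta> \<le> 1" and y: "\<bar>y\<bar> \<le> 1"
  shows "(sinh (\<beta> * y))\<^sup>2 \<le> 4 * \<beta>\<^sup>2"
proof -
  have b: "\<bar>\<beta> * y\<bar> \<le> \<beta>" using y \<beta> by (auto simp: abs_mult mult_left_le)
  then have "(sinh (\<beta> * y))\<^sup>2 \<le> 4 * (\<beta> * y)\<^sup>2" using \<beta> by (intro sinh_square_le) auto
  also have "(\<beta> * y)\<^sup>2 \<le> \<beta>\<^sup>2" using b by (rule square_le_if_abs_le)
  finally show ?thesis by simp
qed

lemma sinh_quotient_bounds:
  fixes \<tau> h :: real assumes h: "0 < h" "h \<le> 1" and \<tau>: "0 \<le> \<tau>" "\<tau> * h \<le> 1"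
  shows "0 \<le> sinh (\<tau> * h * h) / h\<^sup>2" "sinh (\<tau> * h * h) / h\<^sup>2 \<le> 2 * \<tau>"
proof -
  show "0 \<le> sinh (\<tau> * h * h) / h\<^sup>2" using h \<tau> by simp
  have "\<tau> * h * h \<le> 1" using mult_mono[of "\<tau> * h" 1 h 1] h \<tau> by auto
  then have "sinh (\<tau> * h * h) \<le> 2 * (\<tau> * h * h)" using h \<tau> by (intro sinh_le_double) auto
  then show "sinh (\<tau> * h * h) / h\<^sup>2 \<le> 2 * \<tau>" using h by (simp add: field_simps power2_eq_square)
qed

text \<open>With \<open>\<beta> = \<tau> h\<close>, conjugating the second difference in direction \<open>k\<close> by \<open>exp (- \<tau> |x|\<^sup>2 / 2)\<close> multiplies the shifts
  by \<open>exp (\<plusminus> \<beta> (x\<^sub>k \<plusminus> h / 2))\<close>, the argument being the midpoint of the edge.  This is the part that is symmetric for the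
  counting measure; \<open>conj_anti1\<close> is the antisymmetric one.\<close>

definition conj_sym1 :: "real \<Rightarrow> real \<Rightarrow> 'd \<Rightarrow> (real ^ 'd::finite \<Rightarrow> real) \<Rightarrow> real ^ 'd \<Rightarrow> real" where
  "conj_sym1 h \<beta> k f x =
     (cosh (\<beta> * (x $ k + h / 2)) * f (fwd h k x)
      + cosh (\<beta> * (x $ k - h / 2)) * f (bwd h k x) - 2 * f x) / h\<^sup>2"

definition conj_anti1 :: "real \<Rightarrow> real \<Rightarrow> 'd \<Rightarrow> (real ^ 'd::finite \<Rightarrow> real) \<Rightarrow> real ^ 'd \<Rightarrow> real" where
  "conj_anti1 h \<beta> k f x =
     (sinh (\<beta> * (x $ k + h / 2)) * f (fwd h k x)
      - sinh (\<beta> * (x $ k - h / 2)) * f (bwd h k x)) / h\<^sup>2"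

definition conj_sym :: "real \<Rightarrow> real \<Rightarrow> (real ^ 'd::finite \<Rightarrow> real) \<Rightarrow> real ^ 'd \<Rightarrow> real" where
  "conj_sym h \<beta> f x = (\<Sum>k\<in>UNIV. conj_sym1 h \<beta> k f x)"

definition conj_anti :: "real \<Rightarrow> real \<Rightarrow> (real ^ 'd::finite \<Rightarrow> real) \<Rightarrow> real ^ 'd \<Rightarrow> real" where
  "conj_anti h \<beta> f x = (\<Sum>k\<in>UNIV. conj_anti1 h \<beta> k f x)"

lemma conj_sym1_symmetric:
  assumes "finite Q" and "\<And>x. f x \<noteq> 0 \<Longrightarrow> x \<in> margin h Q"
  shows "(\<Sum>x\<in>Q. conj_sym1 h \<beta> k f x * g x) = (\<Sum>x\<in>Q. f x * conj_sym1 h \<beta> k g x)"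
proof -
  have half: "z - h + h / 2 = z - h / 2" "z + h - h / 2 = z + h / 2" for z :: real by simp_all
  have up: "(\<Sum>x\<in>Q. cosh (\<beta> * (x $ k + h / 2)) * f (fwd h k x) * g x) =
      (\<Sum>x\<in>Q. cosh (\<beta> * (x $ k - h / 2)) * f x * g (bwd h k x))"
    using sum_shift_up[OF assms, where c = "\<lambda>x. cosh (\<beta> * (x $ k + h / 2))" and k = k and g = g] by (simp add: half)
  have down: "(\<Sum>x\<in>Q. cosh (\<beta> * (x $ k - h / 2)) * f (bwd h k x) * g x) =
      (\<Sum>x\<in>Q. cosh (\<beta> * (x $ k + h / 2)) * f x * g (fwd h k x))"
    using sum_shift_down[OF assms, where c = "\<lambda>x. cosh (\<beta> * (x $ k - h / 2))" and k = k and g = g] by (simp add: half)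
  have "(\<Sum>x\<in>Q. conj_sym1 h \<beta> k f x * g x) =
    ((\<Sum>x\<in>Q. cosh (\<beta> * (x $ k + h / 2)) * f (fwd h k x) * g x)
     + (\<Sum>x\<in>Q. cosh (\<beta> * (x $ k - h / 2)) * f (bwd h k x) * g x)
     - (\<Sum>x\<in>Q. 2 * f x * g x)) / h\<^sup>2"
    unfolding conj_sym1_def sum.distrib[symmetric] sum_subtractf[symmetric] sum_divide_distrib
    by (rule sum.cong) (auto simp: algebra_simps add_divide_distrib diff_divide_distrib)
  also have "\<dots> = (\<Sum>x\<in>Q. f x * conj_sym1 h \<beta> k g x)"
    unfolding up down
    unfolding conj_sym1_def sum.distrib[symmetric] sum_subtractf[symmetric] sum_divide_distrib
    by (rule sum.cong) (auto simp: algebra_simps add_divide_distrib diff_divide_distrib)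
  finally show ?thesis .
qed

lemma conj_anti1_antisymmetric:
  assumes "finite Q" and "\<And>x. f x \<noteq> 0 \<Longrightarrow> x \<in> margin h Q"
  shows "(\<Sum>x\<in>Q. conj_anti1 h \<beta> k f x * g x) = - (\<Sum>x\<in>Q. f x * conj_anti1 h \<beta> k g x)"
proof -
  have half: "z - h + h / 2 = z - h / 2" "z + h - h / 2 = z + h / 2" for z :: real by simp_all
  have up: "(\<Sum>x\<in>Q. sinh (\<beta> * (x $ k + h / 2)) * f (fwd h k x) * g x) =
      (\<Sum>x\<in>Q. sinh (\<beta> * (x $ k - h / 2)) * f x * g (bwd h k x))"
    using sum_shift_up[OF assms, where c = "\<lambda>x. sinh (\<beta> * (x $ k + h / 2))" and k = k and g = g] by (simp add: half)
  have down: "(\<Sum>x\<in>Q. sinh (\<beta> * (x $ k - h / 2)) * f (bwd h k x) * g x) =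
      (\<Sum>x\<in>Q. sinh (\<beta> * (x $ k + h / 2)) * f x * g (fwd h k x))"
    using sum_shift_down[OF assms, where c = "\<lambda>x. sinh (\<beta> * (x $ k - h / 2))" and k = k and g = g] by (simp add: half)
  have "(\<Sum>x\<in>Q. conj_anti1 h \<beta> k f x * g x) =
    ((\<Sum>x\<in>Q. sinh (\<beta> * (x $ k + h / 2)) * f (fwd h k x) * g x)
     - (\<Sum>x\<in>Q. sinh (\<beta> * (x $ k - h / 2)) * f (bwd h k x) * g x)) / h\<^sup>2"
    unfolding conj_anti1_def sum_subtractf[symmetric] sum_divide_distrib
    by (rule sum.cong) (auto simp: algebra_simps diff_divide_distrib)
  also have "\<dots> = - (\<Sum>x\<in>Q. f x * conj_anti1 h \<beta> k g x)"
    unfolding up down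
    unfolding conj_anti1_def sum_subtractf[symmetric] sum_divide_distrib sum_negf[symmetric]
    by (rule sum.cong) (auto simp: algebra_simps diff_divide_distrib)
  finally show ?thesis .
qed

text \<open>The coefficients for one direction are invariant under shifts in another direction.\<close>

lemma conj_commute:
  fixes f :: "real ^ 'd::finite \<Rightarrow> real"
  assumes "j \<noteq> k"
  shows "conj_sym1 h \<beta> j (conj_anti1 h \<beta> k f) x = conj_anti1 h \<beta> k (conj_sym1 h \<beta> j f) x"
proof -
  have s: "fwd h k (fwd h j x) = fwd h j (fwd h k x)"
    "bwd h k (fwd h j x) = fwd h j (bwd h k x)"
    "fwd h k (bwd h j x) = bwd h j (fwd h k x)"
    "bwd h k (bwd h j x) = bwd h j (bwd h k x)"
    by (auto simp: algebra_simps)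
  have jk: "(j = k) = False" "(k = j) = False" using assms by auto
  define p q where "p = cosh (\<beta> * (x $ j + h / 2))" and "q = cosh (\<beta> * (x $ j - h / 2))"
  define m n where "m = sinh (\<beta> * (x $ k + h / 2))" and "n = sinh (\<beta> * (x $ k - h / 2))"
  have "conj_sym1 h \<beta> j (conj_anti1 h \<beta> k f) x =
    (p * (m * f (fwd h j (fwd h k x)) - n * f (fwd h j (bwd h k x)))
      + q * (m * f (bwd h j (fwd h k x)) - n * f (bwd h j (bwd h k x)))
      - 2 * (m * f (fwd h k x) - n * f (bwd h k x))) / (h\<^sup>2 * h\<^sup>2)"
    unfolding conj_sym1_def conj_anti1_def axis_shift_nth jk if_False add_0_right diff_0_right s p_def q_def m_def n_def
    by (simp only: times_divide_eq_right divide_divide_eq_left diff_divide_distrib[symmetric] add_divide_distrib[symmetric])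
  also have "\<dots> =
    (m * (p * f (fwd h j (fwd h k x)) + q * f (bwd h j (fwd h k x))
        - 2 * f (fwd h k x))
      - n * (p * f (fwd h j (bwd h k x)) + q * f (bwd h j (bwd h k x))
        - 2 * f (bwd h k x))) / (h\<^sup>2 * h\<^sup>2)"
    by (rule arg_cong[where f = "\<lambda>z. z / (h\<^sup>2 * h\<^sup>2)"]) algebra
  also have "\<dots> = conj_anti1 h \<beta> k (conj_sym1 h \<beta> j f) x"
    unfolding conj_sym1_def conj_anti1_def axis_shift_nth jk if_False add_0_right diff_0_right p_def q_def m_def n_def
    by (simp only: times_divide_eq_right divide_divide_eq_left diff_divide_distrib[symmetric] add_divide_distrib[symmetric])
  finally show ?thesis .
qed

text \<open>All coefficients of the double steps and of the diagonal are values of one addition formula,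
  \<open>sinh (u - v) = sinh u cosh v - cosh u sinh v\<close> with \<open>u - v = \<beta> h\<close>, or of its double angle version.\<close>

lemma conj_commutator:
  fixes f :: "real ^ 'd::finite \<Rightarrow> real"
  assumes "h \<noteq> 0"
  shows "conj_sym1 h \<beta> k (conj_anti1 h \<beta> k f) x - conj_anti1 h \<beta> k (conj_sym1 h \<beta> k f) x =
    sinh (\<beta> * h) / h ^ 4 * (f (fwd h k (fwd h k x))
      + f (bwd h k (bwd h k x)) - 2 * cosh (2 * \<beta> * x $ k) * f x)"
proof -
  define y a where "y = \<beta> * x $ k" and "a = \<beta> * h / 2"
  have c: "\<beta> * (x $ k + h / 2) = y + a" "\<beta> * (x $ k - h / 2) = y - a"
    "\<beta> * (x $ k + h + h / 2) = y + 3 * a" "\<beta> * (x $ k + h - h / 2) = y + a"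
    "\<beta> * (x $ k - h + h / 2) = y - a" "\<beta> * (x $ k - h - h / 2) = y - 3 * a"
    "\<beta> * h = 2 * a" "2 * \<beta> * x $ k = 2 * y"
    by (auto simp: y_def a_def algebra_simps)
  have 1: "cosh (y + a) * sinh (y + 3 * a) - sinh (y + a) * cosh (y + 3 * a) = sinh (2 * a)"
    using sinh_diff[of "y + 3 * a" "y + a"] by (simp add: algebra_simps)
  have 2: "sinh (y - a) * cosh (y - 3 * a) - cosh (y - a) * sinh (y - 3 * a) = sinh (2 * a)"
    using sinh_diff[of "y - a" "y - 3 * a"] by (simp add: algebra_simps)
  have 3: "sinh (y + a) * cosh (y + a) - sinh (y - a) * cosh (y - a) = cosh (2 * y) * sinh (2 * a)"
  proof -
    have "2 * (sinh (y + a) * cosh (y + a)) = sinh (2 * y + 2 * a)"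
      "2 * (sinh (y - a) * cosh (y - a)) = sinh (2 * y - 2 * a)"
      using sinh_double[of "y + a"] sinh_double[of "y - a"] by (auto simp: algebra_simps)
    moreover have "sinh (2 * y + 2 * a) - sinh (2 * y - 2 * a) = 2 * (cosh (2 * y) * sinh (2 * a))"
      by (simp add: sinh_add sinh_diff)
    ultimately show ?thesis by linarith
  qed
  have x: "bwd h k (fwd h k x) = x" "fwd h k (bwd h k x) = x" by auto
  define e where "e = h *\<^sub>R (axis k 1 :: real ^ 'd)"
  have anti: "conj_anti1 h \<beta> k f (x + e) = (sinh (y + 3 * a) * f (x + e + e) - sinh (y + a) * f x) / h\<^sup>2"
    "conj_anti1 h \<beta> k f (x - e) = (sinh (y - a) * f x - sinh (y - 3 * a) * f (x - e - e)) / h\<^sup>2"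
    "conj_anti1 h \<beta> k f x = (sinh (y + a) * f (x + e) - sinh (y - a) * f (x - e)) / h\<^sup>2"
    by (simp_all only: conj_anti1_def axis_shift_nth e_def x c if_True simp_thms)
  have sym: "conj_sym1 h \<beta> k f (x + e) = (cosh (y + 3 * a) * f (x + e + e) + cosh (y + a) * f x - 2 * f (x + e)) / h\<^sup>2"
    "conj_sym1 h \<beta> k f (x - e) = (cosh (y - a) * f x + cosh (y - 3 * a) * f (x - e - e) - 2 * f (x - e)) / h\<^sup>2"
    by (simp_all only: conj_sym1_def axis_shift_nth e_def x c if_True simp_thms)
  have S: "conj_sym1 h \<beta> k (conj_anti1 h \<beta> k f) x =
      (cosh (y + a) * conj_anti1 h \<beta> k f (x + e) + cosh (y - a) * conj_anti1 h \<beta> k f (x - e)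
        - 2 * conj_anti1 h \<beta> k f x) / h\<^sup>2"
    by (simp only: conj_sym1_def c e_def)
  have K: "conj_anti1 h \<beta> k (conj_sym1 h \<beta> k f) x =
      (sinh (y + a) * conj_sym1 h \<beta> k f (x + e) - sinh (y - a) * conj_sym1 h \<beta> k f (x - e)) / h\<^sup>2"
    by (simp only: conj_anti1_def c e_def)
  have "conj_sym1 h \<beta> k (conj_anti1 h \<beta> k f) x - conj_anti1 h \<beta> k (conj_sym1 h \<beta> k f) x
    = ((cosh (y + a) * sinh (y + 3 * a) - sinh (y + a) * cosh (y + 3 * a)) * f (x + e + e)
      + (sinh (y - a) * cosh (y - 3 * a) - cosh (y - a) * sinh (y - 3 * a)) * f (x - e - e)
      - 2 * (sinh (y + a) * cosh (y + a) - sinh (y - a) * cosh (y - a)) * f x) / (h\<^sup>2 * h\<^sup>2)"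
    unfolding S K anti sym times_divide_eq_right divide_divide_eq_left diff_divide_distrib[symmetric]
      add_divide_distrib[symmetric]
    by (rule arg_cong[where f = "\<lambda>z. z / (h\<^sup>2 * h\<^sup>2)"]) algebra
  also have "h\<^sup>2 * h\<^sup>2 = h ^ 4" by (simp add: power_numeral_reduce)
  finally show ?thesis unfolding 1 2 3 e_def c by (simp add: field_simps)
qed

text \<open>Writing \<open>2 f f\<^sup>+ = f\<^sup>2 + (f\<^sup>+)\<^sup>2 - (f\<^sup>+ - f)\<^sup>2\<close> for \<open>f\<^sup>+\<close> the neighbouring value turns the quadratic form into
  minus a Dirichlet form plus a zero order term that is small because the coefficients are close to \<open>1\<close>.\<close>

lemma conj_sym1_form:
  assumes "finite Q" and "\<And>x. f x \<noteq> 0 \<Longrightarrow> x \<in> margin h Q" and "h \<noteq> 0"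
  shows "h\<^sup>2 * (\<Sum>x\<in>Q. f x * conj_sym1 h \<beta> k f x) =
    - (\<Sum>x\<in>Q. cosh (\<beta> * (x $ k + h / 2)) * (f (fwd h k x) - f x)\<^sup>2)
    + (\<Sum>x\<in>Q. (cosh (\<beta> * (x $ k + h / 2)) + cosh (\<beta> * (x $ k - h / 2)) - 2) * (f x)\<^sup>2)"
proof -
  have half: "z - h + h / 2 = z - h / 2" "z + h - h / 2 = z + h / 2" for z :: real by simp_all
  have e: "fwd h k (bwd h k x) = x" for x :: "real ^ 'a" by simp
  let ?c = "\<lambda>x. cosh (\<beta> * (x $ k + h / 2))"
  let ?d = "\<lambda>x. cosh (\<beta> * (x $ k - h / 2))"
  have 1: "(\<Sum>x\<in>Q. ?d x * f (bwd h k x) * f x) = (\<Sum>x\<in>Q. ?c x * f x * f (fwd h k x))"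
    using sum_shift_down[OF assms(1,2), where c = ?d and k = k and g = f] by (simp add: half)
  have 2: "(\<Sum>x\<in>Q. ?c x * f (fwd h k x) * f (fwd h k x)) = (\<Sum>x\<in>Q. ?d x * f x * f x)"
    using sum_shift_up[OF assms(1,2), where c = ?c and k = k and g = "\<lambda>x. f (fwd h k x)"]
    by (simp add: half)
  have "h\<^sup>2 * (\<Sum>x\<in>Q. f x * conj_sym1 h \<beta> k f x) =
      (\<Sum>x\<in>Q. ?c x * f x * f (fwd h k x)) + (\<Sum>x\<in>Q. ?d x * f (bwd h k x) * f x)
      - (\<Sum>x\<in>Q. 2 * (f x)\<^sup>2)"
    unfolding sum_distrib_left conj_sym1_def sum.distrib[symmetric] sum_subtractf[symmetric]
    using assms(3) by (intro sum.cong refl) (simp add: field_simps power2_eq_square)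
  also have "\<dots> = 2 * (\<Sum>x\<in>Q. ?c x * f x * f (fwd h k x)) - (\<Sum>x\<in>Q. 2 * (f x)\<^sup>2)
      - (\<Sum>x\<in>Q. ?c x * f (fwd h k x) * f (fwd h k x)) + (\<Sum>x\<in>Q. ?d x * f x * f x)"
    using 1 2 by linarith
  also have "\<dots> = - (\<Sum>x\<in>Q. ?c x * (f (fwd h k x) - f x)\<^sup>2)
    + (\<Sum>x\<in>Q. (?c x + ?d x - 2) * (f x)\<^sup>2)"
    unfolding sum_distrib_left sum_negf[symmetric] sum.distrib[symmetric] sum_subtractf[symmetric]
    by (intro sum.cong refl) (simp add: power2_eq_square algebra_simps)
  finally show ?thesis .
qed

lemma conj_sym1_le:
  assumes Q: "finite Q" "\<And>x. f x \<noteq> 0 \<Longrightarrow> x \<in> margin h Q" and h: "h > 0"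
    and small: "\<And>x. f x \<noteq> 0 \<Longrightarrow> \<bar>x $ k\<bar> + h / 2 \<le> 1"
    and \<tau>: "0 \<le> \<tau>" "\<tau> * h \<le> 1"
  shows "(\<Sum>x\<in>Q. f x * conj_sym1 h (\<tau> * h) k f x) \<le>
    - (\<Sum>x\<in>Q. (f (fwd h k x) - f x)\<^sup>2) / h\<^sup>2 + 2 * \<tau>\<^sup>2 * (\<Sum>x\<in>Q. (f x)\<^sup>2)"
proof -
  define \<beta> where "\<beta> = \<tau> * h"
  have \<beta>: "0 \<le> \<beta>" "\<beta> \<le> 1" using \<tau> h by (auto simp: \<beta>_def)
  have c1: "cosh (\<beta> * y) - 1 \<le> \<beta>\<^sup>2" if "\<bar>y\<bar> \<le> 1" for y
  proof -
    have b: "\<bar>\<beta> * y\<bar> \<le> \<beta>" using that \<beta> by (auto simp: abs_mult mult_left_le)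
    then have "cosh (\<beta> * y) - 1 \<le> (\<beta> * y)\<^sup>2" using \<beta> by (intro cosh_minus_one_le_square) auto
    also have "\<dots> \<le> \<beta>\<^sup>2" using b by (metis abs_le_square_iff abs_of_nonneg \<beta>(1))
    finally show ?thesis .
  qed
  have "(\<Sum>x\<in>Q. (cosh (\<beta> * (x $ k + h / 2)) + cosh (\<beta> * (x $ k - h / 2)) - 2) * (f x)\<^sup>2)
      \<le> (\<Sum>x\<in>Q. (2 * \<beta>\<^sup>2) * (f x)\<^sup>2)"
  proof (rule sum_mono)
    fix x
    show "(cosh (\<beta> * (x $ k + h / 2)) + cosh (\<beta> * (x $ k - h / 2)) - 2) * (f x)\<^sup>2 \<le> (2 * \<beta>\<^sup>2) * (f x)\<^sup>2"
    proof (cases "f x = 0")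
      case False
      have "\<bar>x $ k + h / 2\<bar> \<le> 1" "\<bar>x $ k - h / 2\<bar> \<le> 1" using small[OF False] h by auto
      from this[THEN c1] show ?thesis by (intro mult_right_mono) auto
    qed simp
  qed
  moreover have "(\<Sum>x\<in>Q. (f (fwd h k x) - f x)\<^sup>2)
      \<le> (\<Sum>x\<in>Q. cosh (\<beta> * (x $ k + h / 2)) * (f (fwd h k x) - f x)\<^sup>2)"
    by (intro sum_mono) (simp add: mult_le_cancel_right1 cosh_real_ge_1)
  ultimately have "h\<^sup>2 * (\<Sum>x\<in>Q. f x * conj_sym1 h \<beta> k f x) \<le>
      - (\<Sum>x\<in>Q. (f (fwd h k x) - f x)\<^sup>2) + 2 * \<beta>\<^sup>2 * (\<Sum>x\<in>Q. (f x)\<^sup>2)"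
    using conj_sym1_form[OF Q, where \<beta> = \<beta> and k = k] h by (simp add: sum_distrib_left)
  then show ?thesis using h unfolding \<beta>_def by (simp add: field_simps power_mult_distrib)
qed

lemma sum_backward_difference:
  fixes f :: "real ^ 'd::finite \<Rightarrow> real"
  assumes "finite Q" and "\<And>x. f x \<noteq> 0 \<Longrightarrow> x \<in> margin h Q"
  shows "(\<Sum>x\<in>Q. (f x - f (bwd h k x))\<^sup>2) = (\<Sum>x\<in>Q. (f (fwd h k x) - f x)\<^sup>2)"
proof -
  have "x \<in> Q \<and> bwd h k x \<in> Q" if "(f x - f (bwd h k x))\<^sup>2 \<noteq> 0" for x
  proof -
    have "f x \<noteq> 0 \<or> f (bwd h k x) \<noteq> 0" using that by auto
    then show ?thesis
      using assms(2)[of x] assms(2)[of "bwd h k x"] unfolding margin_def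
      by (metis (no_types, lifting) diff_add_cancel mem_Collect_eq)
  qed
  then have "(\<Sum>x\<in>Q. (f (fwd h k x) - f (bwd h k (fwd h k x)))\<^sup>2) =
      (\<Sum>x\<in>Q. (f x - f (bwd h k x))\<^sup>2)"
    by (intro sum_shift[OF assms(1)])
  from this[symmetric] show ?thesis unfolding add_diff_cancel_right' .
qed

lemma power2_sum_le: "(a + b)\<^sup>2 \<le> 2 * a\<^sup>2 + 2 * (b::real)\<^sup>2"
  using sum_squares_bound[of a b] by (simp add: power2_sum)

text \<open>After one summation by parts the right side is minus the sum of \<open>(E f - E\<^sup>-\<^sup>1 f)\<^sup>2\<close> for the shift \<open>E\<close>; the
  double step is then split into a forward and a backward difference.\<close>

lemma sum_double_step:
  fixes f :: "real ^ 'd::finite \<Rightarrow> real"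
  assumes Q: "finite Q" "\<And>x. f x \<noteq> 0 \<Longrightarrow> x \<in> margin h Q"
  shows "- 4 * (\<Sum>x\<in>Q. (f (fwd h k x) - f x)\<^sup>2) \<le>
    (\<Sum>x\<in>Q. f x * (f (fwd h k (fwd h k x))
      + f (bwd h k (bwd h k x)) - 2 * f x))"
proof -
  define g where "g x = f (fwd h k x) - f (bwd h k x)" for x
  have "(\<Sum>x\<in>Q. (g x)\<^sup>2) = (\<Sum>x\<in>Q. 1 * f (fwd h k x) * g x) - (\<Sum>x\<in>Q. 1 * f (bwd h k x) * g x)"
    unfolding sum_subtractf[symmetric] by (intro sum.cong refl) (simp add: g_def power2_eq_square algebra_simps)
  also have "\<dots> = (\<Sum>x\<in>Q. 1 * f x * g (bwd h k x)) - (\<Sum>x\<in>Q. 1 * f x * g (fwd h k x))"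
    using sum_shift_up[OF Q, where c = "\<lambda>_. 1" and k = k and g = g]
      sum_shift_down[OF Q, where c = "\<lambda>_. 1" and k = k and g = g] by simp
  also have "\<dots> = - (\<Sum>x\<in>Q. f x * (f (fwd h k (fwd h k x))
      + f (bwd h k (bwd h k x)) - 2 * f x))"
    unfolding sum_subtractf[symmetric] sum_negf[symmetric]
    by (intro sum.cong refl) (simp add: g_def algebra_simps)
  finally have 1: "(\<Sum>x\<in>Q. (g x)\<^sup>2) = - (\<Sum>x\<in>Q. f x * (f (fwd h k (fwd h k x))
      + f (bwd h k (bwd h k x)) - 2 * f x))" .
  have "(\<Sum>x\<in>Q. (g x)\<^sup>2) \<le> (\<Sum>x\<in>Q. 2 * (f (fwd h k x) - f x)\<^sup>2 + 2 * (f x - f (bwd h k x))\<^sup>2)"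
  proof (rule sum_mono)
    fix x
    show "(g x)\<^sup>2 \<le> 2 * (f (fwd h k x) - f x)\<^sup>2 + 2 * (f x - f (bwd h k x))\<^sup>2"
      using power2_sum_le[of "f (fwd h k x) - f x" "f x - f (bwd h k x)"]
      by (simp add: g_def)
  qed
  also have "\<dots> = 4 * (\<Sum>x\<in>Q. (f (fwd h k x) - f x)\<^sup>2)"
    unfolding sum.distrib sum_distrib_left[symmetric] using sum_backward_difference[OF Q, where k = k] by simp
  finally show ?thesis using 1 by linarith
qed

text \<open>The commutator is minus the square of a difference over two steps, minus a zero order term.  Differences over
  two steps are bounded by differences over one step, that is, by the Dirichlet form in \<open>conj_sym1_le\<close>.  The
  factor \<open>\<theta>\<close> plays the role of \<open>\<tau>\<close>, to which it converges as \<open>h\<close> tends to \<open>0\<close>.\<close>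

lemma conj_commutator_ge:
  fixes f :: "real ^ 'd::finite \<Rightarrow> real" and \<tau> h \<theta> :: real
  assumes Q: "finite Q" "\<And>x. f x \<noteq> 0 \<Longrightarrow> x \<in> margin h Q" and h: "h > 0"
    and small: "\<And>x. f x \<noteq> 0 \<Longrightarrow> \<bar>x $ k\<bar> + h / 2 \<le> 1"
    and \<tau>: "0 \<le> \<tau>" "\<tau> * h \<le> 1"
  defines "\<theta> \<equiv> sinh (\<tau> * h * h) / h\<^sup>2"
  shows "4 * \<theta> * (\<Sum>x\<in>Q. f x * conj_sym1 h (\<tau> * h) k f x) - 24 * \<theta> * \<tau>\<^sup>2 * (\<Sum>x\<in>Q. (f x)\<^sup>2)
    \<le> (\<Sum>x\<in>Q. f x * (conj_sym1 h (\<tau> * h) k (conj_anti1 h (\<tau> * h) k f) x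
          - conj_anti1 h (\<tau> * h) k (conj_sym1 h (\<tau> * h) k f) x))"
proof -
  define \<beta> where "\<beta> = \<tau> * h"
  have \<beta>: "0 \<le> \<beta>" "\<beta> \<le> 1" using \<tau> h by (auto simp: \<beta>_def)
  have \<theta>: "0 \<le> \<theta>" unfolding \<theta>_def using \<tau> h by simp
  define D where "D = (\<Sum>x\<in>Q. (f (fwd h k x) - f x)\<^sup>2)"
  define N where "N = (\<Sum>x\<in>Q. (f x)\<^sup>2)"
  have "(\<Sum>x\<in>Q. f x * (conj_sym1 h \<beta> k (conj_anti1 h \<beta> k f) x - conj_anti1 h \<beta> k (conj_sym1 h \<beta> k f) x))
    = \<theta> / h\<^sup>2 * ((\<Sum>x\<in>Q. f x * (f (fwd h k (fwd h k x))
      + f (bwd h k (bwd h k x)) - 2 * f x)) - (\<Sum>x\<in>Q. 4 * (sinh (\<beta> * x $ k))\<^sup>2 * (f x)\<^sup>2))"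
  proof -
    have c: "cosh (2 * \<beta> * y) = 1 + 2 * (sinh (\<beta> * y))\<^sup>2" for y
      using cosh_double[of "\<beta> * y"] cosh_square_eq[of "\<beta> * y"] by (simp add: mult.assoc)
    have t: "sinh (\<beta> * h) / h ^ 4 = \<theta> / h\<^sup>2" by (simp add: \<theta>_def \<beta>_def power_numeral_reduce)
    show ?thesis
      unfolding conj_commutator[OF less_imp_neq[OF h, symmetric]] c t sum_subtractf[symmetric] sum_distrib_left
      by (intro sum.cong refl) (simp add: power2_eq_square algebra_simps)
  qed
  moreover have "\<theta> / h\<^sup>2 * (- 4 * D - 16 * \<beta>\<^sup>2 * N) \<le> \<theta> / h\<^sup>2 * ((\<Sum>x\<in>Q. f x * (f (fwd h k (fwd h k x))
      + f (bwd h k (bwd h k x)) - 2 * f x)) - (\<Sum>x\<in>Q. 4 * (sinh (\<beta> * x $ k))\<^sup>2 * (f x)\<^sup>2))"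
  proof (intro mult_left_mono diff_mono)
    show "- 4 * D \<le> (\<Sum>x\<in>Q. f x * (f (fwd h k (fwd h k x))
      + f (bwd h k (bwd h k x)) - 2 * f x))"
      unfolding D_def by (rule sum_double_step[OF Q])
    show "(\<Sum>x\<in>Q. 4 * (sinh (\<beta> * x $ k))\<^sup>2 * (f x)\<^sup>2) \<le> 16 * \<beta>\<^sup>2 * N"
      unfolding N_def sum_distrib_left
    proof (rule sum_mono)
      fix x
      show "4 * (sinh (\<beta> * x $ k))\<^sup>2 * (f x)\<^sup>2 \<le> 16 * \<beta>\<^sup>2 * (f x)\<^sup>2"
      proof (cases "f x = 0")
        case False
        then have "\<bar>x $ k\<bar> \<le> 1" using small[OF False] h by auto
        then show ?thesis
          using mult_left_mono[OF sinh_mult_square_le[OF \<beta>], of "x $ k" 4] by (intro mult_right_mono) auto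
      qed simp
    qed
  qed (use \<theta> h in auto)
  moreover have "\<theta> / h\<^sup>2 * (- 4 * D - 16 * \<beta>\<^sup>2 * N) = 4 * \<theta> * (- D / h\<^sup>2) - 16 * \<theta> * \<tau>\<^sup>2 * N"
    using h by (simp add: \<beta>_def field_simps power_mult_distrib)
  moreover have "4 * \<theta> * (\<Sum>x\<in>Q. f x * conj_sym1 h \<beta> k f x) \<le> 4 * \<theta> * (- D / h\<^sup>2 + 2 * \<tau>\<^sup>2 * N)"
    unfolding D_def N_def \<beta>_def using \<theta> by (intro mult_left_mono conj_sym1_le[OF Q h small \<tau>]) auto
  ultimately show ?thesis unfolding \<beta>_def[symmetric] N_def[symmetric] by (simp add: algebra_simps)
qed

text \<open>Only the commutators in equal directions survive.\<close>

lemma conj_sym_anti_ge: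
  fixes f :: "real ^ 'd::finite \<Rightarrow> real" and \<tau> h \<theta> :: real
  assumes Q: "finite Q" "\<And>x. f x \<noteq> 0 \<Longrightarrow> x \<in> margin h Q" and h: "h > 0"
    and small: "\<And>x k. f x \<noteq> 0 \<Longrightarrow> \<bar>x $ k\<bar> + h / 2 \<le> 1"
    and \<tau>: "0 \<le> \<tau>" "\<tau> * h \<le> 1"
  defines "\<theta> \<equiv> sinh (\<tau> * h * h) / h\<^sup>2"
  shows "4 * \<theta> * (\<Sum>x\<in>Q. f x * conj_sym h (\<tau> * h) f x) - 24 * real CARD('d) * \<theta> * \<tau>\<^sup>2 * (\<Sum>x\<in>Q. (f x)\<^sup>2)
    \<le> 2 * (\<Sum>x\<in>Q. conj_sym h (\<tau> * h) f x * conj_anti h (\<tau> * h) f x)"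
proof -
  define \<beta> where "\<beta> = \<tau> * h"
  define a where "a j k = (\<Sum>x\<in>Q. conj_sym1 h \<beta> j f x * conj_anti1 h \<beta> k f x)" for j k
  have a2: "2 * a j k = (\<Sum>x\<in>Q. f x * (conj_sym1 h \<beta> j (conj_anti1 h \<beta> k f) x
          - conj_anti1 h \<beta> k (conj_sym1 h \<beta> j f) x))" for j k
  proof -
    have "a j k = (\<Sum>x\<in>Q. f x * conj_sym1 h \<beta> j (conj_anti1 h \<beta> k f) x)"
      unfolding a_def by (rule conj_sym1_symmetric[OF Q])
    moreover have "a j k = - (\<Sum>x\<in>Q. f x * conj_anti1 h \<beta> k (conj_sym1 h \<beta> j f) x)"
      unfolding a_def mult.commute[of "conj_sym1 h \<beta> j f _"] by (rule conj_anti1_antisymmetric[OF Q])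
    ultimately show ?thesis by (simp add: right_diff_distrib sum_subtractf)
  qed
  have off: "a j k = 0" if "j \<noteq> k" for j k
    using a2[of j k] conj_commute[OF that] by simp
  have "(\<Sum>x\<in>Q. conj_sym h \<beta> f x * conj_anti h \<beta> f x) = (\<Sum>j\<in>UNIV. \<Sum>k\<in>UNIV. a j k)"
  proof -
    have "(\<Sum>x\<in>Q. conj_sym h \<beta> f x * conj_anti h \<beta> f x) =
        (\<Sum>x\<in>Q. \<Sum>j\<in>UNIV. \<Sum>k\<in>UNIV. conj_sym1 h \<beta> j f x * conj_anti1 h \<beta> k f x)"
      unfolding conj_sym_def conj_anti_def sum_product ..
    also have "\<dots> = (\<Sum>j\<in>UNIV. \<Sum>x\<in>Q. \<Sum>k\<in>UNIV. conj_sym1 h \<beta> j f x * conj_anti1 h \<beta> k f x)"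
      by (rule sum.swap)
    also have "\<dots> = (\<Sum>j\<in>UNIV. \<Sum>k\<in>UNIV. a j k)"
      unfolding a_def by (intro sum.cong refl sum.swap)
    finally show ?thesis .
  qed
  also have "\<dots> = (\<Sum>k\<in>UNIV. a k k)"
  proof (rule sum.cong)
    fix j :: 'd
    have "(\<Sum>k\<in>UNIV. a j k) = (\<Sum>k\<in>{j}. a j k)"
      by (rule sum.mono_neutral_right) (auto simp: off)
    then show "(\<Sum>k\<in>UNIV. a j k) = a j j" by simp
  qed simp
  finally have "2 * (\<Sum>x\<in>Q. conj_sym h \<beta> f x * conj_anti h \<beta> f x) = (\<Sum>k\<in>UNIV. 2 * a k k)"
    by (simp add: sum_distrib_left)
  moreover have "(\<Sum>k\<in>UNIV. 4 * \<theta> * (\<Sum>x\<in>Q. f x * conj_sym1 h \<beta> k f x) - 24 * \<theta> * \<tau>\<^sup>2 * (\<Sum>x\<in>Q. (f x)\<^sup>2))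
      \<le> (\<Sum>k\<in>UNIV. 2 * a k k)"
    unfolding a2 \<beta>_def \<theta>_def by (intro sum_mono conj_commutator_ge[OF Q h small \<tau>])
  moreover have "(\<Sum>k\<in>UNIV. 4 * \<theta> * (\<Sum>x\<in>Q. f x * conj_sym1 h \<beta> k f x) - 24 * \<theta> * \<tau>\<^sup>2 * (\<Sum>x\<in>Q. (f x)\<^sup>2))
    = 4 * \<theta> * (\<Sum>x\<in>Q. f x * conj_sym h \<beta> f x) - 24 * real CARD('d) * \<theta> * \<tau>\<^sup>2 * (\<Sum>x\<in>Q. (f x)\<^sup>2)"
  proof -
    have "(\<Sum>x\<in>Q. f x * conj_sym h \<beta> f x) = (\<Sum>k\<in>UNIV. \<Sum>x\<in>Q. f x * conj_sym1 h \<beta> k f x)"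
      unfolding conj_sym_def sum_distrib_left by (rule sum.swap)
    then show ?thesis unfolding sum_subtractf sum_distrib_left[symmetric] by simp
  qed
  ultimately show ?thesis unfolding \<beta>_def by linarith
qed

section \<open>The Carleman estimate\<close>

text \<open>Here \<open>p\<close>, \<open>q\<close>, \<open>r\<close> stand for the conjugated function and its first two time derivatives, \<open>s = 1 - t\<close>, and the
  left side is the time derivative of the energy \<open>e\<close> in \<open>carleman_estimate\<close>.  The square on the right is
  \<open>|SS + AA|\<^sup>2\<close>, where \<open>SS\<close> is the symmetric and \<open>AA\<close> the antisymmetric part of the conjugated operator in
  space and time.  Up to a total time derivative, \<open>2 \<langle>SS, AA\<rangle>\<close> is the commutator of the two parts:
  \<open>4 \<tau>\<^sup>3 A\<^sup>3 s\<^sup>2 |p|\<^sup>2 + 4 \<tau> A |q|\<^sup>2\<close> from the convexity in \<open>t\<close>, and the spatial commutator, which is negative and, by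
  \<open>conj_sym_anti_ge\<close>, controlled by the Dirichlet form \<open>\<theta> \<langle>- S p, p\<rangle>\<close>.  The latter is replaced, by means of
  \<open>S p = SS - r - \<tau>\<^sup>2 A\<^sup>2 s\<^sup>2 p\<close>, by quantities that the positive terms control; the last term of the energy is there for
  this replacement.  Its main cost is \<open>8 \<tau>\<^sup>3 A\<^sup>2 s\<^sup>2 |p|\<^sup>2\<close>, which is of lower order in \<open>A\<close>.\<close>

lemma carleman_pointwise:
  fixes p q r :: "real ^ 'd::finite \<Rightarrow> real" and \<tau> h \<theta> A s :: real
  assumes Q: "finite Q" and p: "\<And>x. p x \<noteq> 0 \<Longrightarrow> x \<in> margin h Q"
    and q: "\<And>x. q x \<noteq> 0 \<Longrightarrow> x \<in> margin h Q"
    and h: "0 < h" "h \<le> 1" and small: "\<And>x k. p x \<noteq> 0 \<Longrightarrow> \<bar>x $ k\<bar> + h / 2 \<le> 1"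
    and \<tau>: "1 \<le> \<tau>" "\<tau> * h \<le> 1" and s: "1 / 2 \<le> s" and A: "A \<ge> 4 + 48 * real CARD('d)"
  defines "\<theta> \<equiv> sinh (\<tau> * h * h) / h\<^sup>2"
    and "S \<equiv> conj_sym h (\<tau> * h)" and "K \<equiv> conj_anti h (\<tau> * h)"
  shows "(\<Sum>x\<in>Q. 2 * \<tau> * A * (2 * s * q x * r x - (q x)\<^sup>2) - 2 * \<tau> * A * (r x * p x + (q x)\<^sup>2)
      + 2 * (r x * K p x + q x * K q x) + 2 * \<tau> ^ 3 * A ^ 3 * (2 * s ^ 3 * p x * q x - 3 * s\<^sup>2 * (p x)\<^sup>2)
      + 2 * \<tau> * A * (s * (q x * S p x + p x * S q x) - p x * S p x) - 4 * \<theta> * (r x * p x + (q x)\<^sup>2))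
    \<le> (\<Sum>x\<in>Q. (r x + \<tau>\<^sup>2 * A\<^sup>2 * s\<^sup>2 * p x + S p x + 2 * \<tau> * A * s * q x - \<tau> * A * p x + K p x)\<^sup>2)
      - \<tau> ^ 3 * (\<Sum>x\<in>Q. (p x)\<^sup>2)"
proof -
  define N where "N = (\<Sum>x\<in>Q. (p x)\<^sup>2)"
  define SS where "SS x = r x + \<tau>\<^sup>2 * A\<^sup>2 * s\<^sup>2 * p x + S p x" for x
  define AA where "AA x = 2 * \<tau> * A * s * q x - \<tau> * A * p x + K p x" for x
  have N0: "0 \<le> N" unfolding N_def by (intro sum_nonneg) auto
  have \<theta>0: "0 \<le> \<theta>" and \<theta>: "\<theta> \<le> 2 * \<tau>"
    unfolding \<theta>_def using sinh_quotient_bounds[OF h, of \<tau>] \<tau> by auto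
  have sym: "(\<Sum>x\<in>Q. S f x * g x) = (\<Sum>x\<in>Q. f x * S g x)" if "\<And>x. f x \<noteq> 0 \<Longrightarrow> x \<in> margin h Q" for f g
  proof -
    have "(\<Sum>x\<in>Q. S f x * g x) = (\<Sum>k\<in>UNIV. \<Sum>x\<in>Q. conj_sym1 h (\<tau> * h) k f x * g x)"
      unfolding S_def conj_sym_def sum_distrib_right by (rule sum.swap)
    also have "\<dots> = (\<Sum>k\<in>UNIV. \<Sum>x\<in>Q. f x * conj_sym1 h (\<tau> * h) k g x)"
      by (intro sum.cong refl conj_sym1_symmetric[OF Q that])
    also have "\<dots> = (\<Sum>x\<in>Q. f x * S g x)"
      unfolding S_def conj_sym_def sum_distrib_left by (rule sum.swap)
    finally show ?thesis .
  qed
  have anti: "(\<Sum>x\<in>Q. f x * K f x) = 0" if "\<And>x. f x \<noteq> 0 \<Longrightarrow> x \<in> margin h Q" for f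
  proof -
    have "(\<Sum>x\<in>Q. f x * conj_anti1 h (\<tau> * h) k f x) = 0" for k
    proof -
      have "(\<Sum>x\<in>Q. conj_anti1 h (\<tau> * h) k f x * f x) = (\<Sum>x\<in>Q. f x * conj_anti1 h (\<tau> * h) k f x)"
        by (simp only: mult.commute)
      moreover have "(\<Sum>x\<in>Q. conj_anti1 h (\<tau> * h) k f x * f x) = - (\<Sum>x\<in>Q. f x * conj_anti1 h (\<tau> * h) k f x)"
        by (rule conj_anti1_antisymmetric[OF Q that])
      ultimately show ?thesis by linarith
    qed
    moreover have "(\<Sum>x\<in>Q. f x * K f x) = (\<Sum>k\<in>UNIV. \<Sum>x\<in>Q. f x * conj_anti1 h (\<tau> * h) k f x)"
      unfolding K_def conj_anti_def sum_distrib_left by (rule sum.swap)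
    ultimately show ?thesis by simp
  qed
  have pS: "(\<Sum>x\<in>Q. p x * S q x - q x * S p x) = 0"
    using sym[of p q] p by (simp add: sum_subtractf mult.commute)
  have comm: "4 * \<theta> * (\<Sum>x\<in>Q. p x * S p x) - 24 * real CARD('d) * \<theta> * \<tau>\<^sup>2 * N
      \<le> 2 * (\<Sum>x\<in>Q. S p x * K p x)"
    unfolding S_def K_def N_def \<theta>_def using \<tau> by (intro conj_sym_anti_ge[OF Q p h(1) small]) auto
  have "(\<Sum>x\<in>Q. 2 * \<tau> * A * (2 * s * q x * r x - (q x)\<^sup>2) - 2 * \<tau> * A * (r x * p x + (q x)\<^sup>2)
      + 2 * (r x * K p x + q x * K q x) + 2 * \<tau> ^ 3 * A ^ 3 * (2 * s ^ 3 * p x * q x - 3 * s\<^sup>2 * (p x)\<^sup>2)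
      + 2 * \<tau> * A * (s * (q x * S p x + p x * S q x) - p x * S p x) - 4 * \<theta> * (r x * p x + (q x)\<^sup>2))
    = (\<Sum>x\<in>Q. (SS x + AA x)\<^sup>2 - (SS x)\<^sup>2 - (AA x)\<^sup>2 - 4 * \<tau> * A * (q x)\<^sup>2
        - 4 * \<tau> ^ 3 * A ^ 3 * s\<^sup>2 * (p x)\<^sup>2 - 2 * (S p x * K p x) - 4 * \<theta> * (q x)\<^sup>2
        - 4 * \<theta> * (SS x * p x) + 4 * \<theta> * \<tau>\<^sup>2 * A\<^sup>2 * s\<^sup>2 * (p x)\<^sup>2 + 4 * \<theta> * (p x * S p x)
        + 2 * (q x * K q x) - 2 * \<tau>\<^sup>2 * A\<^sup>2 * s\<^sup>2 * (p x * K p x)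
        + 2 * \<tau> * A * s * (p x * S q x - q x * S p x))"
    by (intro sum.cong refl) (simp add: SS_def AA_def power2_eq_square power3_eq_cube algebra_simps)
  also have "\<dots> = (\<Sum>x\<in>Q. (SS x + AA x)\<^sup>2) - (\<Sum>x\<in>Q. (SS x)\<^sup>2 + 4 * \<theta> * (SS x * p x)) - (\<Sum>x\<in>Q. (AA x)\<^sup>2)
      - 4 * \<tau> * A * (\<Sum>x\<in>Q. (q x)\<^sup>2) - 4 * \<theta> * (\<Sum>x\<in>Q. (q x)\<^sup>2)
      - 4 * \<tau> ^ 3 * A ^ 3 * s\<^sup>2 * N + 4 * \<theta> * \<tau>\<^sup>2 * A\<^sup>2 * s\<^sup>2 * N
      - 2 * (\<Sum>x\<in>Q. S p x * K p x) + 4 * \<theta> * (\<Sum>x\<in>Q. p x * S p x)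
      + 2 * (\<Sum>x\<in>Q. q x * K q x) - 2 * \<tau>\<^sup>2 * A\<^sup>2 * s\<^sup>2 * (\<Sum>x\<in>Q. p x * K p x)
      + 2 * \<tau> * A * s * (\<Sum>x\<in>Q. p x * S q x - q x * S p x)"
    unfolding N_def sum_distrib_left sum.distrib[symmetric] sum_subtractf[symmetric]
    by (intro sum.cong refl) (simp add: mult.assoc)
  also have "\<dots> \<le> (\<Sum>x\<in>Q. (SS x + AA x)\<^sup>2) + 4 * \<theta>\<^sup>2 * N - 4 * \<tau> ^ 3 * A ^ 3 * s\<^sup>2 * N
      + 4 * \<theta> * \<tau>\<^sup>2 * A\<^sup>2 * s\<^sup>2 * N + 24 * real CARD('d) * \<theta> * \<tau>\<^sup>2 * N"
  proof -
    \<comment> \<open>The square of \<open>SS\<close> pays for the product that the replacement of the Dirichlet form creates.\<close>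
    have "(\<Sum>x\<in>Q. - 4 * \<theta>\<^sup>2 * (p x)\<^sup>2) \<le> (\<Sum>x\<in>Q. (SS x)\<^sup>2 + 4 * \<theta> * (SS x * p x))"
    proof (rule sum_mono)
      fix x
      have "0 \<le> (SS x + 2 * \<theta> * p x)\<^sup>2" by simp
      then show "- 4 * \<theta>\<^sup>2 * (p x)\<^sup>2 \<le> (SS x)\<^sup>2 + 4 * \<theta> * (SS x * p x)"
        by (simp add: power2_sum power_mult_distrib algebra_simps)
    qed
    then have 1: "- 4 * \<theta>\<^sup>2 * N \<le> (\<Sum>x\<in>Q. (SS x)\<^sup>2 + 4 * \<theta> * (SS x * p x))"
      by (simp add: N_def sum_distrib_left)
    have 2: "0 \<le> (\<Sum>x\<in>Q. (AA x)\<^sup>2)" "0 \<le> 4 * \<tau> * A * (\<Sum>x\<in>Q. (q x)\<^sup>2)" "0 \<le> 4 * \<theta> * (\<Sum>x\<in>Q. (q x)\<^sup>2)"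
      using \<theta>0 \<tau> A by (auto intro!: sum_nonneg mult_nonneg_nonneg)
    have 3: "(\<Sum>x\<in>Q. p x * K p x) = 0" "(\<Sum>x\<in>Q. q x * K q x) = 0"
      using anti[of p] anti[of q] p q by auto
    show ?thesis unfolding 3 pS using 1 2 comm by linarith
  qed
  also have "\<dots> \<le> (\<Sum>x\<in>Q. (SS x + AA x)\<^sup>2) - \<tau> ^ 3 * N"
  proof -
    have "4 * \<theta>\<^sup>2 \<le> 16 * \<tau> ^ 3"
    proof -
      have "\<theta>\<^sup>2 \<le> (2 * \<tau>)\<^sup>2" using \<theta> \<theta>0 by (intro power_mono) auto
      moreover have "\<tau>\<^sup>2 \<le> \<tau> ^ 3" using \<tau> by (intro power_increasing) auto
      ultimately show ?thesis by (simp add: power_mult_distrib)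
    qed
    moreover have "4 * \<theta> * \<tau>\<^sup>2 * A\<^sup>2 * s\<^sup>2 \<le> 8 * \<tau> ^ 3 * A\<^sup>2 * s\<^sup>2"
      using mult_right_mono[OF \<theta>, of "4 * (\<tau>\<^sup>2 * (A\<^sup>2 * s\<^sup>2))"] by (simp add: power3_eq_cube power2_eq_square)
    moreover have "24 * real CARD('d) * \<theta> * \<tau>\<^sup>2 \<le> 48 * real CARD('d) * \<tau> ^ 3"
      using mult_right_mono[OF \<theta>, of "24 * (real CARD('d) * \<tau>\<^sup>2)"] by (simp add: power3_eq_cube power2_eq_square)
    moreover have "\<tau> ^ 3 * (16 + 48 * real CARD('d) + 1) \<le> \<tau> ^ 3 * (4 * A\<^sup>2 * s\<^sup>2 * (A - 2))"
    proof (rule mult_left_mono)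
      have s4: "1 \<le> 4 * s\<^sup>2" using power_mono[OF s, of 2] by (simp add: power2_eq_square)
      have A16: "16 \<le> A\<^sup>2" using power_mono[of 4 A 2] A by simp
      have "16 * (2 + 48 * real CARD('d)) \<le> A\<^sup>2 * (A - 2)"
        using A A16 by (intro mult_mono) auto
      also have "\<dots> \<le> (4 * s\<^sup>2) * (A\<^sup>2 * (A - 2))"
        using mult_right_mono[OF s4, of "A\<^sup>2 * (A - 2)"] A by simp
      finally show "16 + 48 * real CARD('d) + 1 \<le> 4 * A\<^sup>2 * s\<^sup>2 * (A - 2)" by (simp add: algebra_simps)
    qed (use \<tau> in simp)
    ultimately have "4 * \<theta>\<^sup>2 - 4 * \<tau> ^ 3 * A ^ 3 * s\<^sup>2 + 4 * \<theta> * \<tau>\<^sup>2 * A\<^sup>2 * s\<^sup>2 + 24 * real CARD('d) * \<theta> * \<tau>\<^sup>2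
        \<le> - (\<tau> ^ 3)"
      by (simp add: algebra_simps power3_eq_cube power2_eq_square)
    from mult_right_mono[OF this N0] show ?thesis by (simp add: algebra_simps)
  qed
  finally show ?thesis unfolding SS_def AA_def N_def by (simp add: algebra_simps)
qed


text \<open>In terms of the two differences and of \<open>p\<close> itself, the operator has coefficients of size \<open>\<tau> / h\<close> and \<open>\<tau>\<close>,
  respectively, because \<open>sinh (\<beta> y)\<close> is of size \<open>\<beta> = \<tau> h\<close> and changes by \<open>O (\<beta> h)\<close> over one step.\<close>

lemma conj_anti1_square_le:
  fixes p :: "real ^ 'd::finite \<Rightarrow> real" and \<tau> h :: real
  assumes h: "0 < h" and small: "\<And>x. p x \<noteq> 0 \<Longrightarrow> \<bar>x $ k\<bar> + h / 2 \<le> 1"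
    and \<tau>: "0 \<le> \<tau>" "\<tau> * h \<le> 1"
  shows "(conj_anti1 h (\<tau> * h) k p x)\<^sup>2 \<le>
    12 * \<tau>\<^sup>2 / h\<^sup>2 * ((p (fwd h k x) - p x)\<^sup>2 + (p x - p (bwd h k x))\<^sup>2) + 48 * \<tau>\<^sup>2 * (p x)\<^sup>2"
proof -
  define \<beta> where "\<beta> = \<tau> * h"
  have \<beta>: "0 \<le> \<beta>" "\<beta> \<le> 1" using \<tau> h by (auto simp: \<beta>_def)
  define a b c where "a = sinh (\<beta> * (x $ k + h / 2)) * (p (fwd h k x) - p x)"
    and "b = sinh (\<beta> * (x $ k - h / 2)) * (p x - p (bwd h k x))"
    and "c = (sinh (\<beta> * (x $ k + h / 2)) - sinh (\<beta> * (x $ k - h / 2))) * p x"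
  note sinhb = sinh_mult_square_le[OF \<beta>]
  have a: "a\<^sup>2 \<le> 4 * \<beta>\<^sup>2 * (p (fwd h k x) - p x)\<^sup>2"
  proof (cases "p (fwd h k x) - p x = 0")
    case False
    then consider "p x \<noteq> 0" | "p (fwd h k x) \<noteq> 0" by force
    then have "\<bar>x $ k + h / 2\<bar> \<le> 1"
      using small[of x] small[of "fwd h k x"] h by cases auto
    then show ?thesis unfolding a_def power_mult_distrib by (intro mult_right_mono sinhb) auto
  qed (simp add: a_def)
  have b: "b\<^sup>2 \<le> 4 * \<beta>\<^sup>2 * (p x - p (bwd h k x))\<^sup>2"
  proof (cases "p x - p (bwd h k x) = 0")
    case False
    then consider "p x \<noteq> 0" | "p (bwd h k x) \<noteq> 0" by force
    then have "\<bar>x $ k - h / 2\<bar> \<le> 1"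
      using small[of x] small[of "bwd h k x"] h by cases auto
    then show ?thesis unfolding b_def power_mult_distrib by (intro mult_right_mono sinhb) auto
  qed (simp add: b_def)
  have c: "c\<^sup>2 \<le> 16 * \<beta>\<^sup>2 * h\<^sup>2 * (p x)\<^sup>2"
  proof (cases "p x = 0")
    case False
    have x1: "\<bar>x $ k\<bar> \<le> 1" "h / 2 \<le> 1" using small[OF False] h by auto
    have "sinh (\<beta> * (x $ k + h / 2)) - sinh (\<beta> * (x $ k - h / 2)) = 2 * cosh (\<beta> * x $ k) * sinh (\<beta> * (h / 2))"
      by (simp add: ring_distribs sinh_add sinh_diff)
    moreover have "\<bar>\<beta> * x $ k\<bar> \<le> 1" using x1 \<beta> by (simp add: abs_mult mult_le_one)
    then have "cosh (\<beta> * x $ k) \<le> 2"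
      using cosh_minus_one_le_square[of "\<beta> * x $ k"] power_le_one[of "\<bar>\<beta> * x $ k\<bar>" 2] by simp
    moreover have "0 \<le> sinh (\<beta> * (h / 2))" "sinh (\<beta> * (h / 2)) \<le> \<beta> * h"
      using sinh_le_double[of "\<beta> * (h / 2)"] mult_le_one[of \<beta> "h / 2"] \<beta> h x1 by auto
    ultimately have "\<bar>sinh (\<beta> * (x $ k + h / 2)) - sinh (\<beta> * (x $ k - h / 2))\<bar> \<le> 4 * (\<beta> * h)"
      using mult_mono[of "cosh (\<beta> * x $ k)" 2 "sinh (\<beta> * (h / 2))" "\<beta> * h"] by (simp add: abs_mult)
    then have "(sinh (\<beta> * (x $ k + h / 2)) - sinh (\<beta> * (x $ k - h / 2)))\<^sup>2 \<le> (4 * (\<beta> * h))\<^sup>2"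
      by (metis abs_ge_zero abs_le_square_iff abs_of_nonneg order_trans)
    then show ?thesis unfolding c_def power_mult_distrib by (intro mult_right_mono) auto
  qed (simp add: c_def)
  have "(conj_anti1 h \<beta> k p x)\<^sup>2 = (a + b + c)\<^sup>2 / h ^ 4"
    unfolding conj_anti1_def a_def b_def c_def power_divide
    by (simp add: algebra_simps flip: power_mult)
  also have "\<dots> \<le> (3 * (a\<^sup>2 + b\<^sup>2 + c\<^sup>2)) / h ^ 4"
  proof (rule divide_right_mono)
    have "0 \<le> (a - b)\<^sup>2 + (b - c)\<^sup>2 + (a - c)\<^sup>2" by simp
    then show "(a + b + c)\<^sup>2 \<le> 3 * (a\<^sup>2 + b\<^sup>2 + c\<^sup>2)" by (simp add: power2_eq_square algebra_simps)
  qed (use h in simp)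
  also have "\<dots> \<le> (3 * (4 * \<beta>\<^sup>2 * (p (fwd h k x) - p x)\<^sup>2 + 4 * \<beta>\<^sup>2 * (p x - p (bwd h k x))\<^sup>2
      + 16 * \<beta>\<^sup>2 * h\<^sup>2 * (p x)\<^sup>2)) / h ^ 4"
    using a b c h by (intro divide_right_mono mult_left_mono add_mono) auto
  also have "\<dots> = 12 * \<tau>\<^sup>2 / h\<^sup>2 * ((p (fwd h k x) - p x)\<^sup>2 + (p x - p (bwd h k x))\<^sup>2) + 48 * \<tau>\<^sup>2 * (p x)\<^sup>2"
    using h by (simp add: \<beta>_def power_mult_distrib field_simps power_numeral_reduce)
  finally show ?thesis unfolding \<beta>_def .
qed

lemma sum_square_le_card:
  fixes f :: "'d::finite \<Rightarrow> real"
  shows "(\<Sum>k\<in>UNIV. f k)\<^sup>2 \<le> real CARD('d) * (\<Sum>k\<in>UNIV. (f k)\<^sup>2)"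
  using sum_squared_le_sum_of_squares[of f UNIV] by (simp add: mult.commute)

text \<open>The negative Dirichlet form in \<open>2 \<tau> A \<langle>S p, p\<rangle>\<close> compensates the square of \<open>K p\<close> from the mixed term
  \<open>2 \<langle>q, K p\<rangle>\<close> when Young's inequality is used with the weight \<open>l\<close>.\<close>

lemma carleman_boundary:
  fixes p q :: "real ^ 'd::finite \<Rightarrow> real" and \<tau> h \<theta> A :: real
  assumes Q: "finite Q" "\<And>x. p x \<noteq> 0 \<Longrightarrow> x \<in> margin h Q"
    and h: "0 < h" "h \<le> 1" and small: "\<And>x k. p x \<noteq> 0 \<Longrightarrow> \<bar>x $ k\<bar> + h / 2 \<le> 1"
    and \<tau>: "1 \<le> \<tau>" "\<tau> * h \<le> 1" and A: "A \<ge> 4 + 48 * real CARD('d)"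
  defines "\<theta> \<equiv> sinh (\<tau> * h * h) / h\<^sup>2"
    and "S \<equiv> conj_sym h (\<tau> * h)" and "K \<equiv> conj_anti h (\<tau> * h)"
  shows "(\<Sum>x\<in>Q. 2 * \<tau> * A * (q x)\<^sup>2 - 2 * \<tau> * A * q x * p x + 2 * q x * K p x + 2 * \<tau> ^ 3 * A ^ 3 * (p x)\<^sup>2
      + 2 * \<tau> * A * p x * S p x - 4 * \<theta> * q x * p x) \<le> 8 * A ^ 3 * \<tau> ^ 3 * (\<Sum>x\<in>Q. (p x)\<^sup>2 + (q x)\<^sup>2)"
proof -
  define d where "d = real CARD('d)"
  have d1: "1 \<le> d" unfolding d_def by (simp add: Suc_leI)
  define N where "N = (\<Sum>x\<in>Q. (p x)\<^sup>2)"
  define M where "M = (\<Sum>x\<in>Q. (q x)\<^sup>2)"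
  define D where "D = (\<Sum>k\<in>UNIV. \<Sum>x\<in>Q. (p (fwd h k x) - p x)\<^sup>2)"
  have nn: "0 \<le> N" "0 \<le> M" "0 \<le> D" unfolding N_def M_def D_def by (auto intro!: sum_nonneg)
  have \<theta>0: "0 \<le> \<theta>" and \<theta>: "\<theta> \<le> 2 * \<tau>"
    unfolding \<theta>_def using sinh_quotient_bounds[OF h, of \<tau>] \<tau> by auto
  have K: "(\<Sum>x\<in>Q. (K p x)\<^sup>2) \<le> 24 * d * \<tau>\<^sup>2 / h\<^sup>2 * D + 48 * d\<^sup>2 * \<tau>\<^sup>2 * N"
  proof -
    have "(\<Sum>x\<in>Q. (K p x)\<^sup>2) \<le> (\<Sum>x\<in>Q. d * (\<Sum>k\<in>UNIV. (conj_anti1 h (\<tau> * h) k p x)\<^sup>2))"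
      unfolding K_def conj_anti_def d_def by (intro sum_mono sum_square_le_card)
    also have "\<dots> = d * (\<Sum>k\<in>UNIV. \<Sum>x\<in>Q. (conj_anti1 h (\<tau> * h) k p x)\<^sup>2)"
      unfolding sum_distrib_left[symmetric] by (subst sum.swap) (rule refl)
    also have "\<dots> \<le> d * (\<Sum>k\<in>UNIV. \<Sum>x\<in>Q. 12 * \<tau>\<^sup>2 / h\<^sup>2 * ((p (fwd h k x) - p x)\<^sup>2
        + (p x - p (bwd h k x))\<^sup>2) + 48 * \<tau>\<^sup>2 * (p x)\<^sup>2)"
      using d1 \<tau> by (intro mult_left_mono sum_mono conj_anti1_square_le h small) auto
    also have "\<dots> = d * (\<Sum>k\<in>UNIV. 24 * \<tau>\<^sup>2 / h\<^sup>2 * (\<Sum>x\<in>Q. (p (fwd h k x) - p x)\<^sup>2) + 48 * \<tau>\<^sup>2 * N)"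
    proof (intro arg_cong[where f = "\<lambda>z. d * z"] sum.cong refl)
      fix k :: 'd
      have "(\<Sum>x\<in>Q. 12 * \<tau>\<^sup>2 / h\<^sup>2 * ((p (fwd h k x) - p x)\<^sup>2
          + (p x - p (bwd h k x))\<^sup>2) + 48 * \<tau>\<^sup>2 * (p x)\<^sup>2)
        = 12 * \<tau>\<^sup>2 / h\<^sup>2 * ((\<Sum>x\<in>Q. (p (fwd h k x) - p x)\<^sup>2)
          + (\<Sum>x\<in>Q. (p x - p (bwd h k x))\<^sup>2)) + 48 * \<tau>\<^sup>2 * N"
        unfolding N_def sum.distrib sum_distrib_left[symmetric] ..
      then show "(\<Sum>x\<in>Q. 12 * \<tau>\<^sup>2 / h\<^sup>2 * ((p (fwd h k x) - p x)\<^sup>2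
          + (p x - p (bwd h k x))\<^sup>2) + 48 * \<tau>\<^sup>2 * (p x)\<^sup>2)
        = 24 * \<tau>\<^sup>2 / h\<^sup>2 * (\<Sum>x\<in>Q. (p (fwd h k x) - p x)\<^sup>2) + 48 * \<tau>\<^sup>2 * N"
        using sum_backward_difference[OF Q, where k = k] by simp
    qed
    also have "\<dots> = 24 * d * \<tau>\<^sup>2 / h\<^sup>2 * D + 48 * d\<^sup>2 * \<tau>\<^sup>2 * N"
      unfolding sum.distrib D_def sum_distrib_left[symmetric]
      by (simp add: d_def power2_eq_square algebra_simps)
    finally show ?thesis .
  qed
  have S: "(\<Sum>x\<in>Q. p x * S p x) \<le> - D / h\<^sup>2 + 2 * d * \<tau>\<^sup>2 * N"
  proof -
    have "(\<Sum>x\<in>Q. p x * S p x) = (\<Sum>k\<in>UNIV. \<Sum>x\<in>Q. p x * conj_sym1 h (\<tau> * h) k p x)"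
      unfolding S_def conj_sym_def sum_distrib_left by (rule sum.swap)
    also have "\<dots> \<le> (\<Sum>k\<in>UNIV. - (\<Sum>x\<in>Q. (p (fwd h k x) - p x)\<^sup>2) / h\<^sup>2 + 2 * \<tau>\<^sup>2 * N)"
      unfolding N_def using \<tau> by (intro sum_mono conj_sym1_le[OF Q h(1) small]) auto
    also have "\<dots> = - D / h\<^sup>2 + 2 * d * \<tau>\<^sup>2 * N"
      unfolding sum.distrib D_def by (simp add: d_def sum_negf sum_divide_distrib)
    finally show ?thesis .
  qed
  define l where "l = A / (12 * d * \<tau>)"
  have A0: "A > 0" "A \<ge> 4" "12 * d \<le> A" "8 * d \<le> A" using A d1 unfolding d_def by auto
  have l0: "l > 0" using A0 d1 \<tau> by (simp add: l_def)
  have l1: "1 / l \<le> \<tau>" using A0 d1 \<tau> by (simp add: l_def field_simps)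
  have "(\<Sum>x\<in>Q. 2 * \<tau> * A * (q x)\<^sup>2 - 2 * \<tau> * A * q x * p x + 2 * q x * K p x + 2 * \<tau> ^ 3 * A ^ 3 * (p x)\<^sup>2
      + 2 * \<tau> * A * p x * S p x - 4 * \<theta> * q x * p x)
    \<le> (\<Sum>x\<in>Q. 2 * \<tau> * A * (q x)\<^sup>2 + \<tau> * A * ((p x)\<^sup>2 + (q x)\<^sup>2) + (\<tau> * (q x)\<^sup>2 + l * (K p x)\<^sup>2)
        + 2 * \<tau> ^ 3 * A ^ 3 * (p x)\<^sup>2 + 2 * \<tau> * A * (p x * S p x) + 4 * \<tau> * ((p x)\<^sup>2 + (q x)\<^sup>2))"
  proof (rule sum_mono)
    fix x
    have ab: "- (2 * (q x * p x)) \<le> (p x)\<^sup>2 + (q x)\<^sup>2"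
      using sum_squares_bound[of "p x" "- q x"] by (simp add: algebra_simps)
    have 1: "- (2 * \<tau> * A * q x * p x) \<le> \<tau> * A * ((p x)\<^sup>2 + (q x)\<^sup>2)"
      using mult_left_mono[OF ab, of "\<tau> * A"] A0 \<tau> by (simp add: algebra_simps)
    have 2: "- (4 * \<theta> * q x * p x) \<le> 4 * \<tau> * ((p x)\<^sup>2 + (q x)\<^sup>2)"
    proof -
      have "- (4 * \<theta> * q x * p x) \<le> 2 * \<theta> * ((p x)\<^sup>2 + (q x)\<^sup>2)"
        using mult_left_mono[OF ab, of "2 * \<theta>"] \<theta>0 by (simp add: algebra_simps)
      also have "\<dots> \<le> 4 * \<tau> * ((p x)\<^sup>2 + (q x)\<^sup>2)" using \<theta> by (intro mult_right_mono) auto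
      finally show ?thesis .
    qed
    have 3: "2 * q x * K p x \<le> \<tau> * (q x)\<^sup>2 + l * (K p x)\<^sup>2"
    proof -
      have "0 \<le> l * (q x / l - K p x)\<^sup>2" using l0 by simp
      also have "\<dots> = 1 / l * (q x)\<^sup>2 - 2 * q x * K p x + l * (K p x)\<^sup>2"
        using l0 by (simp add: power2_eq_square field_simps)
      also have "\<dots> \<le> \<tau> * (q x)\<^sup>2 - 2 * q x * K p x + l * (K p x)\<^sup>2"
        using mult_right_mono[OF l1, of "(q x)\<^sup>2"] by simp
      finally show ?thesis by simp
    qed
    show "2 * \<tau> * A * (q x)\<^sup>2 - 2 * \<tau> * A * q x * p x + 2 * q x * K p x + 2 * \<tau> ^ 3 * A ^ 3 * (p x)\<^sup>2
      + 2 * \<tau> * A * p x * S p x - 4 * \<theta> * q x * p x \<le>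
      2 * \<tau> * A * (q x)\<^sup>2 + \<tau> * A * ((p x)\<^sup>2 + (q x)\<^sup>2) + (\<tau> * (q x)\<^sup>2 + l * (K p x)\<^sup>2)
        + 2 * \<tau> ^ 3 * A ^ 3 * (p x)\<^sup>2 + 2 * \<tau> * A * (p x * S p x) + 4 * \<tau> * ((p x)\<^sup>2 + (q x)\<^sup>2)"
      using 1 2 3 by (simp only: mult.assoc)
  qed
  also have "\<dots> = 2 * \<tau> * A * M + \<tau> * A * (N + M) + (\<tau> * M + l * (\<Sum>x\<in>Q. (K p x)\<^sup>2))
        + 2 * \<tau> ^ 3 * A ^ 3 * N + 2 * \<tau> * A * (\<Sum>x\<in>Q. p x * S p x) + 4 * \<tau> * (N + M)"
    unfolding N_def M_def sum_distrib_left sum.distrib[symmetric] by simp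
  also have "\<dots> \<le> 2 * \<tau> * A * M + \<tau> * A * (N + M) + (\<tau> * M + l * (24 * d * \<tau>\<^sup>2 / h\<^sup>2 * D + 48 * d\<^sup>2 * \<tau>\<^sup>2 * N))
        + 2 * \<tau> ^ 3 * A ^ 3 * N + 2 * \<tau> * A * (- D / h\<^sup>2 + 2 * d * \<tau>\<^sup>2 * N) + 4 * \<tau> * (N + M)"
    using K S l0 A0 \<tau> by (intro add_mono mult_left_mono order_refl) auto
  also have "\<dots> = (3 * \<tau> * A + 5 * \<tau>) * M + (\<tau> * A + 4 * (A * d) * \<tau> + 2 * \<tau> ^ 3 * A ^ 3 + 4 * (A * d) * \<tau> ^ 3 + 4 * \<tau>) * N"
    using h d1 \<tau> by (simp add: l_def field_simps power2_eq_square power3_eq_cube)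
  also have "\<dots> \<le> (8 * A ^ 3 * \<tau> ^ 3) * M + (8 * A ^ 3 * \<tau> ^ 3) * N"
  proof -
    have A2: "1 \<le> A\<^sup>2" using A0 by (intro one_le_power) auto
    have A13: "A \<le> A ^ 3" "1 \<le> A ^ 3" "A\<^sup>2 \<le> A ^ 3"
      using A0 power_increasing[of 1 3 A] power_increasing[of 2 3 A] by (auto intro: one_le_power)
    have \<tau>13: "\<tau> \<le> \<tau> ^ 3" using \<tau> power_increasing[of 1 3 \<tau>] by auto
    have Ad: "8 * (A * d) \<le> A\<^sup>2" using mult_left_mono[OF A0(4), of A] A0 by (simp add: power2_eq_square)
    have A4: "4 \<le> A ^ 3" using A13 A0 by linarith
    have "3 * A + 5 \<le> 8 * A ^ 3" using A13 by linarith
    then have 1: "(3 * A + 5) * \<tau> \<le> 8 * A ^ 3 * \<tau> ^ 3" using \<tau>13 \<tau> A0 by (intro mult_mono) auto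
    have "(A + 4 * (A * d) + 4) * \<tau> + (2 * A ^ 3 + 4 * (A * d)) * \<tau> ^ 3 \<le>
        (A + 4 * (A * d) + 4) * \<tau> ^ 3 + (2 * A ^ 3 + 4 * (A * d)) * \<tau> ^ 3"
      using \<tau>13 A0 d1 by (intro add_right_mono mult_left_mono) auto
    also have "\<dots> = (A + 8 * (A * d) + 4 + 2 * A ^ 3) * \<tau> ^ 3" by (simp add: algebra_simps)
    also have "\<dots> \<le> (8 * A ^ 3) * \<tau> ^ 3" using \<tau> A13 Ad A4 by (intro mult_right_mono) auto
    finally have 2: "(A + 4 * (A * d) + 4) * \<tau> + (2 * A ^ 3 + 4 * (A * d)) * \<tau> ^ 3 \<le> (8 * A ^ 3) * \<tau> ^ 3" .
    show ?thesis using nn 1 2 by (intro add_mono mult_right_mono) (auto simp: algebra_simps)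
  qed
  also have "\<dots> = 8 * A ^ 3 * \<tau> ^ 3 * (\<Sum>x\<in>Q. (p x)\<^sup>2 + (q x)\<^sup>2)"
    by (simp add: N_def M_def sum.distrib algebra_simps)
  finally show ?thesis .
qed

text \<open>Completing the square, \<open>|x + h e\<^sub>k|\<^sup>2 - |x|\<^sup>2 = 2 h (x\<^sub>k + h / 2)\<close>.\<close>

lemma conjugated_laplacian:
  fixes z :: "real ^ 'd::finite \<Rightarrow> real" and c \<tau> h :: real
  defines "w \<equiv> \<lambda>x. exp (\<tau> * (c - (norm x)\<^sup>2) / 2)"
  shows "conj_sym h (\<tau> * h) (\<lambda>x. w x * z x) x + conj_anti h (\<tau> * h) (\<lambda>x. w x * z x) x
    = w x * discrete_laplacian h z x"
proof -
  have nrm: "(norm (x + a *\<^sub>R axis k 1))\<^sup>2 = (norm x)\<^sup>2 + 2 * a * x $ k + a\<^sup>2"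
    for a :: real and k and x :: "real ^ 'd"
    unfolding power2_norm_eq_inner
    by (simp add: inner_add_left inner_add_right inner_axis inner_axis' inner_axis_axis power2_eq_square distrib_left)
  have up: "exp (\<tau> * h * (x $ k + h / 2)) * w (fwd h k x) = w x" for k
    unfolding w_def exp_add[symmetric] nrm by (simp add: field_simps power2_eq_square)
  have down: "exp (- (\<tau> * h * (x $ k - h / 2))) * w (bwd h k x) = w x" for k
  proof -
    have nd: "(norm (bwd h k x))\<^sup>2 = (norm x)\<^sup>2 - 2 * h * x $ k + h\<^sup>2"
      using nrm[of x "- h" k] by simp
    show ?thesis unfolding w_def exp_add[symmetric] nd by (simp add: field_simps power2_eq_square)
  qed
  have "conj_sym1 h (\<tau> * h) k (\<lambda>x. w x * z x) x + conj_anti1 h (\<tau> * h) k (\<lambda>x. w x * z x) x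
     = w x * (z (fwd h k x) - 2 * z x + z (bwd h k x)) / h\<^sup>2" for k
  proof -
    have "conj_sym1 h (\<tau> * h) k (\<lambda>x. w x * z x) x + conj_anti1 h (\<tau> * h) k (\<lambda>x. w x * z x) x
      = ((exp (\<tau> * h * (x $ k + h / 2)) * w (fwd h k x)) * z (fwd h k x)
        + (exp (- (\<tau> * h * (x $ k - h / 2))) * w (bwd h k x)) * z (bwd h k x)
        - 2 * (w x * z x)) / h\<^sup>2"
      unfolding cosh_plus_sinh[symmetric] cosh_minus sinh_minus conj_sym1_def conj_anti1_def
        add_divide_distrib[symmetric]
      by (rule arg_cong[where f = "\<lambda>a. a / h\<^sup>2"]) algebra
    then show ?thesis unfolding up down by (simp add: algebra_simps)
  qed
  then show ?thesis
    unfolding conj_sym_def conj_anti_def sum.distrib[symmetric] discrete_laplacian_def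
    by (simp add: sum_distrib_left sum_divide_distrib)
qed

definition carleman_weight :: "real \<Rightarrow> real \<Rightarrow> real ^ 'd::finite \<Rightarrow> real \<Rightarrow> real" where
  "carleman_weight A \<tau> x t = exp (\<tau> * (A * (1 - t)\<^sup>2 - (norm x)\<^sup>2) / 2)"

text \<open>The differential inequality \<open>carleman_pointwise\<close> integrated over \<open>{0..T}\<close>: the energy vanishes at \<open>T\<close>, and
  \<open>carleman_boundary\<close> bounds it at \<open>0\<close>.\<close>

lemma carleman_estimate:
  fixes z z' z'' :: "real ^ 'd::finite \<Rightarrow> real \<Rightarrow> real" and \<tau> h A T :: real
  assumes Q: "finite Q" and T: "0 \<le> T" "T \<le> 1 / 2"
    and supp: "\<And>x t. x \<notin> margin h Q \<Longrightarrow> z x t = 0" "\<And>x t. x \<notin> margin h Q \<Longrightarrow> z' x t = 0"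
    and h: "0 < h" "h \<le> 1" and small: "\<And>x k. x \<in> margin h Q \<Longrightarrow> \<bar>x $ k\<bar> + h / 2 \<le> 1"
    and \<tau>: "1 \<le> \<tau>" "\<tau> * h \<le> 1" and A: "A \<ge> 4 + 48 * real CARD('d)"
    and z: "\<And>x. lipschitz_primitive T (z x) (z' x)" "\<And>x. lipschitz_primitive T (z' x) (z'' x)"
    and end0: "\<And>x. z x T = 0" "\<And>x. z' x T = 0"
  shows "\<tau> ^ 3 * integral {0..T} (\<lambda>t. \<Sum>x\<in>Q. (carleman_weight A \<tau> x t * z x t)\<^sup>2)
    \<le> integral {0..T} (\<lambda>t. \<Sum>x\<in>Q. (carleman_weight A \<tau> x t *
          (z'' x t + discrete_laplacian h (\<lambda>y. z y t) x))\<^sup>2)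
      + 8 * A ^ 3 * \<tau> ^ 3 * (\<Sum>x\<in>Q. (carleman_weight A \<tau> x 0 * z x 0)\<^sup>2
          + (carleman_weight A \<tau> x 0 * (z' x 0 - \<tau> * A * z x 0))\<^sup>2)"
proof -
  define w where "w = (carleman_weight A \<tau> :: real ^ 'd \<Rightarrow> real \<Rightarrow> real)"
  define p where "p x t = w x t * z x t" for x t
  define q where "q x t = w x t * (z' x t - \<tau> * A * (1 - t) * z x t)" for x t
  define r where "r x t = w x t * (z'' x t - 2 * \<tau> * A * (1 - t) * z' x t
      + (\<tau>\<^sup>2 * A\<^sup>2 * (1 - t)\<^sup>2 + \<tau> * A) * z x t)" for x t
  have s_prim: "lipschitz_primitive T (\<lambda>t. 1 - t) (\<lambda>t. -1)"
    by (rule lipschitz_primitive_C1) (auto intro!: derivative_eq_intros continuous_intros)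
  have w_prim: "lipschitz_primitive T (w x) (\<lambda>t. - (\<tau> * A * (1 - t)) * w x t)" for x
    unfolding w_def carleman_weight_def
    by (rule lipschitz_primitive_C1)
      (auto intro!: derivative_eq_intros continuous_intros simp: field_simps)
  have p_prim: "lipschitz_primitive T (p x) (q x)" for x
    by (rule lipschitz_primitive_cong[OF lipschitz_primitive_mult[OF w_prim[of x] z(1)[of x]]])
      (auto simp: p_def q_def algebra_simps)
  have q_prim: "lipschitz_primitive T (q x) (r x)" for x
    by (rule lipschitz_primitive_cong[OF lipschitz_primitive_mult[OF w_prim[of x]
        lipschitz_primitive_diff[OF z(2)[of x] lipschitz_primitive_mult[OF
            lipschitz_primitive_cmult[OF s_prim, where c = "\<tau> * A"] z(1)[of x]]]]])
      (auto simp: q_def r_def algebra_simps power2_eq_square)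
  define \<theta> where "\<theta> = sinh (\<tau> * h * h) / h\<^sup>2"
  define S where "S = (conj_sym h (\<tau> * h) :: (real ^ 'd \<Rightarrow> real) \<Rightarrow> real ^ 'd \<Rightarrow> real)"
  define K where "K = (conj_anti h (\<tau> * h) :: (real ^ 'd \<Rightarrow> real) \<Rightarrow> real ^ 'd \<Rightarrow> real)"
  have S_prim: "lipschitz_primitive T (\<lambda>t. S (\<lambda>y. p y t) x) (\<lambda>t. S (\<lambda>y. q y t) x)" for x
    unfolding S_def conj_sym_def conj_sym1_def by (intro lipschitz_primitive_intros p_prim)
  have K_prim: "lipschitz_primitive T (\<lambda>t. K (\<lambda>y. p y t) x) (\<lambda>t. K (\<lambda>y. q y t) x)" for x
    unfolding K_def conj_anti_def conj_anti1_def by (intro lipschitz_primitive_intros p_prim)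
  define e where "e x t = 2 * \<tau> * A * (1 - t) * (q x t)\<^sup>2 - 2 * \<tau> * A * q x t * p x t
      + 2 * q x t * K (\<lambda>y. p y t) x + 2 * \<tau> ^ 3 * A ^ 3 * (1 - t) ^ 3 * (p x t)\<^sup>2
      + 2 * \<tau> * A * (1 - t) * p x t * S (\<lambda>y. p y t) x - 4 * \<theta> * q x t * p x t" for x t
  define e' where "e' x t = 2 * \<tau> * A * (2 * (1 - t) * q x t * r x t - (q x t)\<^sup>2)
      - 2 * \<tau> * A * (r x t * p x t + (q x t)\<^sup>2)
      + 2 * (r x t * K (\<lambda>y. p y t) x + q x t * K (\<lambda>y. q y t) x)
      + 2 * \<tau> ^ 3 * A ^ 3 * (2 * (1 - t) ^ 3 * p x t * q x t - 3 * (1 - t)\<^sup>2 * (p x t)\<^sup>2)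
      + 2 * \<tau> * A * ((1 - t) * (q x t * S (\<lambda>y. p y t) x + p x t * S (\<lambda>y. q y t) x) - p x t * S (\<lambda>y. p y t) x)
      - 4 * \<theta> * (r x t * p x t + (q x t)\<^sup>2)" for x t
  have e_prim: "lipschitz_primitive T (e x) (e' x)" for x
  proof -
    note m = lipschitz_primitive_mult and c = lipschitz_primitive_cmult
      and a = lipschitz_primitive_add and d = lipschitz_primitive_diff
    have "lipschitz_primitive T
       (\<lambda>t. (2 * \<tau> * A) * ((1 - t) * (q x t * q x t)) - (2 * \<tau> * A) * (q x t * p x t)
         + 2 * (q x t * K (\<lambda>y. p y t) x)
         + (2 * \<tau> ^ 3 * A ^ 3) * ((1 - t) * ((1 - t) * (1 - t)) * (p x t * p x t))
         + (2 * \<tau> * A) * ((1 - t) * (p x t * S (\<lambda>y. p y t) x)) - (4 * \<theta>) * (q x t * p x t))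
       (\<lambda>t. (2 * \<tau> * A) * (-1 * (q x t * q x t) + (r x t * q x t + r x t * q x t) * (1 - t))
         - (2 * \<tau> * A) * (r x t * p x t + q x t * q x t)
         + 2 * (r x t * K (\<lambda>y. p y t) x + K (\<lambda>y. q y t) x * q x t)
         + (2 * \<tau> ^ 3 * A ^ 3) * ((-1 * ((1 - t) * (1 - t)) + (-1 * (1 - t) + -1 * (1 - t)) * (1 - t)) * (p x t * p x t)
             + (q x t * p x t + q x t * p x t) * ((1 - t) * ((1 - t) * (1 - t))))
         + (2 * \<tau> * A) * (-1 * (p x t * S (\<lambda>y. p y t) x)
             + (q x t * S (\<lambda>y. p y t) x + S (\<lambda>y. q y t) x * p x t) * (1 - t))
         - (4 * \<theta>) * (r x t * p x t + q x t * q x t))"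
      by (intro a d c m s_prim p_prim q_prim S_prim K_prim)
    then show ?thesis
      by (rule lipschitz_primitive_cong)
        (simp_all add: e_def e'_def power2_eq_square power3_eq_cube algebra_simps)
  qed
  have E_prim: "lipschitz_primitive T (\<lambda>t. \<Sum>x\<in>Q. e x t) (\<lambda>t. \<Sum>x\<in>Q. e' x t)"
    by (intro lipschitz_primitive_sum e_prim)
  define G where "G x t = w x t * (z'' x t + discrete_laplacian h (\<lambda>y. z y t) x)" for x t
  have G: "r x t + \<tau>\<^sup>2 * A\<^sup>2 * (1 - t)\<^sup>2 * p x t + S (\<lambda>y. p y t) x
      + 2 * \<tau> * A * (1 - t) * q x t - \<tau> * A * p x t + K (\<lambda>y. p y t) x = G x t" for x t
  proof -
    have "S (\<lambda>y. p y t) x + K (\<lambda>y. p y t) x = w x t * discrete_laplacian h (\<lambda>y. z y t) x"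
      unfolding S_def K_def p_def w_def carleman_weight_def by (rule conjugated_laplacian)
    then show ?thesis
      by (simp add: G_def p_def q_def r_def algebra_simps power2_eq_square)
  qed
  have p0: "p x t = 0" "q x t = 0" if "x \<notin> margin h Q" for x t
    using supp[OF that] by (auto simp: p_def q_def)
  have pointwise: "(\<Sum>x\<in>Q. e' x t) \<le> (\<Sum>x\<in>Q. (G x t)\<^sup>2) - \<tau> ^ 3 * (\<Sum>x\<in>Q. (p x t)\<^sup>2)" if t: "t \<in> {0..T}" for t
  proof -
    have "(\<Sum>x\<in>Q. e' x t) \<le>
        (\<Sum>x\<in>Q. (r x t + \<tau>\<^sup>2 * A\<^sup>2 * (1 - t)\<^sup>2 * p x t + S (\<lambda>y. p y t) x
          + 2 * \<tau> * A * (1 - t) * q x t - \<tau> * A * p x t + K (\<lambda>y. p y t) x)\<^sup>2)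
        - \<tau> ^ 3 * (\<Sum>x\<in>Q. (p x t)\<^sup>2)"
      unfolding e'_def S_def K_def \<theta>_def
    proof (rule carleman_pointwise)
      show "p x t \<noteq> 0 \<Longrightarrow> x \<in> margin h Q" "q x t \<noteq> 0 \<Longrightarrow> x \<in> margin h Q" for x
        using p0 by auto
      show "p x t \<noteq> 0 \<Longrightarrow> \<bar>x $ k\<bar> + h / 2 \<le> 1" for x k
        using p0[of x t] small[of x k] by auto
      show "1 / 2 \<le> 1 - t" using t T by auto
    qed (use Q h \<tau> A in auto)
    then show ?thesis unfolding G .
  qed
  have w_bm: "bounded_measurable T (w x)" for x
    by (rule lipschitz_primitive_bounded_measurable[OF w_prim])
  have z_bm: "bounded_measurable T (z x)" "bounded_measurable T (z'' x)" for x
    using lipschitz_primitive_bounded_measurable[OF z(1)[of x]]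
      lipschitz_primitive_bounded_measurable[OF z(2)[of x]] by auto
  have lap_bm: "bounded_measurable T (\<lambda>t. discrete_laplacian h (\<lambda>y. z y t) x)" for x
    unfolding discrete_laplacian_def divide_inverse by (intro bounded_measurable_intros z_bm)
  have p_bm: "bounded_measurable T (\<lambda>t. \<Sum>x\<in>Q. (p x t)\<^sup>2)"
    unfolding p_def by (intro bounded_measurable_intros z_bm w_bm)
  have G_bm: "bounded_measurable T (\<lambda>t. \<Sum>x\<in>Q. (G x t)\<^sup>2)"
    unfolding G_def by (intro bounded_measurable_intros z_bm w_bm lap_bm)
  have "- (\<Sum>x\<in>Q. e x 0) = integral {0..T} (\<lambda>t. \<Sum>x\<in>Q. e' x t)"
  proof -
    have pT: "p y T = 0" "q y T = 0" for y using end0 by (auto simp: p_def q_def)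
    have "(\<Sum>x\<in>Q. e x T) = 0"
      by (simp add: e_def pT S_def conj_sym_def conj_sym1_def)
    then show ?thesis using lipschitz_primitive_integral[OF E_prim T(1)] by simp
  qed
  also have "\<dots> \<le> integral {0..T} (\<lambda>t. (\<Sum>x\<in>Q. (G x t)\<^sup>2) - \<tau> ^ 3 * (\<Sum>x\<in>Q. (p x t)\<^sup>2))"
    by (intro integral_le pointwise bounded_measurable_integrable bounded_measurable_diff
        bounded_measurable_cmult G_bm p_bm lipschitz_primitive_bounded_measurable[OF E_prim])
  also have "\<dots> = integral {0..T} (\<lambda>t. \<Sum>x\<in>Q. (G x t)\<^sup>2) - \<tau> ^ 3 * integral {0..T} (\<lambda>t. \<Sum>x\<in>Q. (p x t)\<^sup>2)"
    using bounded_measurable_integrable[OF G_bm] bounded_measurable_integrable[OF p_bm]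
      bounded_measurable_integrable[OF bounded_measurable_cmult[OF p_bm], of "\<tau> ^ 3"]
    by (subst integral_diff) auto
  finally have main: "\<tau> ^ 3 * integral {0..T} (\<lambda>t. \<Sum>x\<in>Q. (p x t)\<^sup>2) \<le>
      integral {0..T} (\<lambda>t. \<Sum>x\<in>Q. (G x t)\<^sup>2) + (\<Sum>x\<in>Q. e x 0)" by linarith
  have "(\<Sum>x\<in>Q. e x 0) \<le> 8 * A ^ 3 * \<tau> ^ 3 * (\<Sum>x\<in>Q. (p x 0)\<^sup>2 + (q x 0)\<^sup>2)"
  proof -
    have "(\<Sum>x\<in>Q. 2 * \<tau> * A * (q x 0)\<^sup>2 - 2 * \<tau> * A * q x 0 * p x 0 + 2 * q x 0 * K (\<lambda>y. p y 0) x
      + 2 * \<tau> ^ 3 * A ^ 3 * (p x 0)\<^sup>2 + 2 * \<tau> * A * p x 0 * S (\<lambda>y. p y 0) x - 4 * \<theta> * q x 0 * p x 0)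
      \<le> 8 * A ^ 3 * \<tau> ^ 3 * (\<Sum>x\<in>Q. (p x 0)\<^sup>2 + (q x 0)\<^sup>2)"
      unfolding S_def K_def \<theta>_def
    proof (rule carleman_boundary)
      show "p x 0 \<noteq> 0 \<Longrightarrow> x \<in> margin h Q" for x using p0 by auto
      show "p x 0 \<noteq> 0 \<Longrightarrow> \<bar>x $ k\<bar> + h / 2 \<le> 1" for x k
        using p0[of x 0] small[of x k] by auto
    qed (use Q h \<tau> A in auto)
    then show ?thesis by (simp add: e_def)
  qed
  with main show ?thesis unfolding p_def q_def G_def w_def by simp
qed

section \<open>The Caccioppoli inequality\<close>

lemma sum_by_parts_second_difference:
  fixes f F :: "real ^ 'd::finite \<Rightarrow> real"
  assumes "finite Q" and "\<And>x. f x \<noteq> 0 \<Longrightarrow> x \<in> margin h Q"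
  shows "(\<Sum>x\<in>Q. f x * (F (fwd h k x) - 2 * F x + F (bwd h k x))) =
    - (\<Sum>x\<in>Q. (f (fwd h k x) - f x) * (F (fwd h k x) - F x))"
proof -
  have "(\<Sum>x\<in>Q. 1 * f (fwd h k x) * (F (fwd h k x) - F x)) =
      (\<Sum>x\<in>Q. 1 * f x * (F (fwd h k (bwd h k x)) - F (bwd h k x)))"
    by (rule sum_shift_up[OF assms, where g = "\<lambda>x. F (fwd h k x) - F x"])
  then have 1: "(\<Sum>x\<in>Q. f (fwd h k x) * (F (fwd h k x) - F x)) =
      (\<Sum>x\<in>Q. f x * (F x - F (bwd h k x)))" by simp
  show ?thesis unfolding left_diff_distrib[of "f (_ + _)"] sum_subtractf 1
    unfolding sum_negf[symmetric] sum_subtractf[symmetric]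
    by (simp add: algebra_simps sum.distrib sum_subtractf)
qed

lemma margin_neighbours:
  assumes "x \<in> margin h Q \<or> fwd h k x \<in> margin h Q"
  shows "x \<in> Q" "fwd h k x \<in> Q"
proof -
  have "fwd h k x \<in> margin h Q \<Longrightarrow> bwd h k (fwd h k x) \<in> Q"
    unfolding margin_def by blast
  then show "x \<in> Q" using assms unfolding margin_def by auto
  show "fwd h k x \<in> Q" using assms unfolding margin_def by auto
qed

lemma sum_shift_le:
  fixes F :: "real ^ 'd::finite \<Rightarrow> real"
  assumes "finite Q" "\<And>x. 0 \<le> F x"
  shows "(\<Sum>x\<in>Q. if x + a \<in> Q then F (x + a) else 0) \<le> (\<Sum>x\<in>Q. F x)"
proof -
  have "(\<Sum>x\<in>Q. if x + a \<in> Q then F (x + a) else 0) = (\<Sum>x\<in>{x \<in> Q. x + a \<in> Q}. F (x + a))"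
    using assms(1) by (simp add: sum.inter_filter)
  also have "\<dots> = (\<Sum>x\<in>(\<lambda>x. x + a) ` {x \<in> Q. x + a \<in> Q}. F x)"
    by (subst sum.reindex) (auto simp: inj_on_def)
  also have "\<dots> \<le> (\<Sum>x\<in>Q. F x)" using assms by (intro sum_mono2) auto
  finally show ?thesis .
qed

text \<open>Testing the equation with \<open>\<eta>\<^sup>2 F\<close>.  In both variables no derivative falls on the cutoff except in a square, since
  \<open>(a - b) (p\<^sup>2 a - q\<^sup>2 b) = (p a - q b)\<^sup>2 - (p - q)\<^sup>2 a b\<close> for differences and correspondingly for the time derivative.
  The boundary term at \<open>0\<close> is \<open>- \<langle>\<eta>\<^sup>2 F, F'\<rangle>\<close>.\<close>

lemma caccioppoli:
  fixes F F' F'' \<eta> \<eta>' :: "real ^ 'd::finite \<Rightarrow> real \<Rightarrow> real" and h T L \<Lambda> :: real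
  assumes Q: "finite Q" and T: "0 \<le> T" and h: "0 < h" and L: "0 \<le> \<Lambda>"
    and F: "\<And>x. lipschitz_primitive T (F x) (F' x)" "\<And>x. lipschitz_primitive T (F' x) (F'' x)"
    and \<eta>: "\<And>x. lipschitz_primitive T (\<eta> x) (\<eta>' x)"
    and supp: "\<And>x t. x \<notin> margin h Q \<Longrightarrow> \<eta> x t = 0" "\<And>x. \<eta> x T = 0"
    and bounds: "\<And>x t. \<bar>\<eta> x t\<bar> \<le> 1" "\<And>x t. \<bar>\<eta>' x t\<bar> \<le> L"
      "\<And>x k t. \<bar>\<eta> (fwd h k x) t - \<eta> x t\<bar> \<le> L * h"
    and equation: "\<And>x t. x \<in> Q \<Longrightarrow> t \<in> {0..T} \<Longrightarrow>
      \<bar>F'' x t + discrete_laplacian h (\<lambda>y. F y t) x\<bar> \<le> \<Lambda> * \<bar>F x t\<bar>"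
  shows "integral {0..T} (\<lambda>t. \<Sum>x\<in>Q. (\<eta> x t * F' x t + \<eta>' x t * F x t)\<^sup>2
        + (\<Sum>k\<in>UNIV. (\<eta> (fwd h k x) t * F (fwd h k x) t - \<eta> x t * F x t)\<^sup>2) / h\<^sup>2)
    \<le> (L\<^sup>2 + \<Lambda> + real CARD('d) * L\<^sup>2) * integral {0..T} (\<lambda>t. \<Sum>x\<in>Q. (F x t)\<^sup>2)
      + (\<Sum>x\<in>Q. (F x 0)\<^sup>2 + (F' x 0)\<^sup>2)"
proof -
  define d where "d = real CARD('d)"
  define y where "y x t = \<eta> x t * F x t" for x t
  define y' where "y' x t = \<eta> x t * F' x t + \<eta>' x t * F x t" for x t
  define n where "n x t = (\<eta> x t)\<^sup>2 * F x t * F' x t" for x t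
  define n' where "n' x t = 2 * \<eta> x t * \<eta>' x t * F x t * F' x t + (\<eta> x t)\<^sup>2 * (F' x t)\<^sup>2
      + (\<eta> x t)\<^sup>2 * F x t * F'' x t" for x t
  have n_prim: "lipschitz_primitive T (n x) (n' x)" for x
    by (rule lipschitz_primitive_cong[OF lipschitz_primitive_mult[OF
          lipschitz_primitive_mult[OF \<eta>[of x] \<eta>[of x]] lipschitz_primitive_mult[OF F(1)[of x] F(2)[of x]]]])
      (auto simp: n_def n'_def power2_eq_square algebra_simps)
  have N_prim: "lipschitz_primitive T (\<lambda>t. \<Sum>x\<in>Q. n x t) (\<lambda>t. \<Sum>x\<in>Q. n' x t)"
    by (intro lipschitz_primitive_sum n_prim)
  have Fbm: "bounded_measurable T (F x)" "bounded_measurable T (F' x)" for x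
    using lipschitz_primitive_bounded_measurable[OF F(1)[of x]] by auto
  have \<eta>bm: "bounded_measurable T (\<eta> x)" "bounded_measurable T (\<eta>' x)" for x
    using lipschitz_primitive_bounded_measurable[OF \<eta>[of x]] by auto
  define I where "I t = (\<Sum>x\<in>Q. (y' x t)\<^sup>2 + (\<Sum>k\<in>UNIV. (y (fwd h k x) t - y x t)\<^sup>2) / h\<^sup>2)" for t
  define N where "N t = (\<Sum>x\<in>Q. (F x t)\<^sup>2)" for t
  have I_bm: "bounded_measurable T I"
    unfolding I_def y_def y'_def divide_inverse by (intro bounded_measurable_intros Fbm \<eta>bm)
  have N_bm: "bounded_measurable T N"
    unfolding N_def by (intro bounded_measurable_intros Fbm)
  have pointwise: "I t - (L\<^sup>2 + \<Lambda> + d * L\<^sup>2) * N t \<le> (\<Sum>x\<in>Q. n' x t)" if t: "t \<in> {0..T}" for t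
  proof -
    define D where "D k x = (\<eta> (fwd h k x) t - \<eta> x t)\<^sup>2 * (F x t * F (fwd h k x) t)" for k x
    have parts: "(\<Sum>x\<in>Q. (\<eta> x t)\<^sup>2 * F x t * discrete_laplacian h (\<lambda>y. F y t) x) =
        - (\<Sum>k\<in>UNIV. \<Sum>x\<in>Q. (y (fwd h k x) t - y x t)\<^sup>2 - D k x) / h\<^sup>2"
    proof -
      have "(\<Sum>x\<in>Q. (\<eta> x t)\<^sup>2 * F x t * discrete_laplacian h (\<lambda>y. F y t) x) =
          (\<Sum>x\<in>Q. \<Sum>k\<in>UNIV. (\<eta> x t)\<^sup>2 * F x t * (F (fwd h k x) t - 2 * F x t + F (bwd h k x) t)) / h\<^sup>2"
        unfolding discrete_laplacian_def by (simp add: sum_distrib_left sum_divide_distrib)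
      also have "\<dots> = (\<Sum>k\<in>UNIV. \<Sum>x\<in>Q. (\<eta> x t)\<^sup>2 * F x t * (F (fwd h k x) t - 2 * F x t + F (bwd h k x) t)) / h\<^sup>2"
        by (subst sum.swap) (rule refl)
      also have "\<dots> = (\<Sum>k\<in>UNIV. - (\<Sum>x\<in>Q. (y (fwd h k x) t - y x t)\<^sup>2 - D k x)) / h\<^sup>2"
      proof (intro arg_cong[where f = "\<lambda>a. a / h\<^sup>2"] sum.cong refl)
        fix k
        have "(\<Sum>x\<in>Q. ((\<eta> x t)\<^sup>2 * F x t) * (F (fwd h k x) t - 2 * F x t + F (bwd h k x) t))
          = - (\<Sum>x\<in>Q. ((\<eta> (fwd h k x) t)\<^sup>2 * F (fwd h k x) t - (\<eta> x t)\<^sup>2 * F x t)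
              * (F (fwd h k x) t - F x t))"
          by (rule sum_by_parts_second_difference[OF Q]) (use supp(1) in force)
        also have "\<dots> = - (\<Sum>x\<in>Q. (y (fwd h k x) t - y x t)\<^sup>2 - D k x)"
          unfolding y_def D_def
          by (intro arg_cong[where f = uminus] sum.cong refl) (simp add: power2_eq_square algebra_simps)
        finally show "(\<Sum>x\<in>Q. (\<eta> x t)\<^sup>2 * F x t * (F (fwd h k x) t - 2 * F x t + F (bwd h k x) t))
          = - (\<Sum>x\<in>Q. (y (fwd h k x) t - y x t)\<^sup>2 - D k x)" .
      qed
      finally show ?thesis by (simp add: sum_negf)
    qed
    have D: "(\<Sum>x\<in>Q. D k x) \<le> L\<^sup>2 * h\<^sup>2 * N t" for k
    proof -
      have "(\<Sum>x\<in>Q. D k x) \<le> (\<Sum>x\<in>Q. L\<^sup>2 * h\<^sup>2 / 2 * ((F x t)\<^sup>2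
          + (if fwd h k x \<in> Q then (F (fwd h k x) t)\<^sup>2 else 0)))"
      proof (rule sum_mono)
        fix x
        show "D k x \<le> L\<^sup>2 * h\<^sup>2 / 2 * ((F x t)\<^sup>2
          + (if fwd h k x \<in> Q then (F (fwd h k x) t)\<^sup>2 else 0))"
        proof (cases "\<eta> (fwd h k x) t - \<eta> x t = 0")
          case False
          then have "x \<in> margin h Q \<or> fwd h k x \<in> margin h Q" using supp(1) by force
          then have inQ: "fwd h k x \<in> Q" by (rule margin_neighbours)
          have "(\<eta> (fwd h k x) t - \<eta> x t)\<^sup>2 \<le> (L * h)\<^sup>2"
            using bounds(3)[of x k t] by (metis abs_ge_zero order_trans abs_le_square_iff abs_of_nonneg)
          moreover have "F x t * F (fwd h k x) t \<le> ((F x t)\<^sup>2 + (F (fwd h k x) t)\<^sup>2) / 2"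
            using sum_squares_bound[of "F x t" "F (fwd h k x) t"] by simp
          ultimately have "D k x \<le> (L * h)\<^sup>2 * (((F x t)\<^sup>2 + (F (fwd h k x) t)\<^sup>2) / 2)"
            unfolding D_def
            by (intro order_trans[OF mult_left_mono mult_right_mono]) auto
          then show ?thesis using inQ by (simp add: power_mult_distrib algebra_simps)
        qed (simp add: D_def)
      qed
      also have "\<dots> = L\<^sup>2 * h\<^sup>2 / 2 * (N t + (\<Sum>x\<in>Q. if fwd h k x \<in> Q then (F (fwd h k x) t)\<^sup>2 else 0))"
        unfolding N_def sum_distrib_left[symmetric] sum.distrib ..
      also have "\<dots> \<le> L\<^sup>2 * h\<^sup>2 / 2 * (N t + N t)"
        unfolding N_def by (intro mult_left_mono add_left_mono sum_shift_le[OF Q]) auto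
      finally show ?thesis by simp
    qed
    have "(\<Sum>k\<in>UNIV. \<Sum>x\<in>Q. D k x) / h\<^sup>2 \<le> (\<Sum>k\<in>(UNIV::'d set). L\<^sup>2 * h\<^sup>2 * N t) / h\<^sup>2"
      using h by (intro divide_right_mono sum_mono D) auto
    also have "\<dots> = d * L\<^sup>2 * N t" using h by (simp add: d_def)
    finally have D': "(\<Sum>k\<in>UNIV. \<Sum>x\<in>Q. D k x) / h\<^sup>2 \<le> d * L\<^sup>2 * N t" .
    have eq: "(\<Sum>x\<in>Q. (\<eta> x t)\<^sup>2 * F x t * (F'' x t + discrete_laplacian h (\<lambda>y. F y t) x)) \<ge> - \<Lambda> * N t"
      unfolding N_def sum_distrib_left
    proof (rule sum_mono)
      fix x assume x: "x \<in> Q"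
      have e1: "(\<eta> x t)\<^sup>2 \<le> 1" using bounds(1)[of x t] by (simp add: abs_square_le_1)
      have "\<bar>F x t * (F'' x t + discrete_laplacian h (\<lambda>y. F y t) x)\<bar> \<le> \<bar>F x t\<bar> * (\<Lambda> * \<bar>F x t\<bar>)"
        unfolding abs_mult by (intro mult_left_mono equation x t) auto
      then have "\<bar>F x t * (F'' x t + discrete_laplacian h (\<lambda>y. F y t) x)\<bar> \<le> \<Lambda> * (F x t)\<^sup>2"
        by (simp add: power2_eq_square algebra_simps)
      then have "(\<eta> x t)\<^sup>2 * \<bar>F x t * (F'' x t + discrete_laplacian h (\<lambda>y. F y t) x)\<bar> \<le> 1 * (\<Lambda> * (F x t)\<^sup>2)"
        using e1 by (intro mult_mono) auto
      moreover have "- ((\<eta> x t)\<^sup>2 * \<bar>F x t * (F'' x t + discrete_laplacian h (\<lambda>y. F y t) x)\<bar>)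
          \<le> (\<eta> x t)\<^sup>2 * (F x t * (F'' x t + discrete_laplacian h (\<lambda>y. F y t) x))"
        unfolding mult_minus_right[symmetric] by (intro mult_left_mono) auto
      ultimately show "- \<Lambda> * (F x t)\<^sup>2 \<le> (\<eta> x t)\<^sup>2 * F x t * (F'' x t + discrete_laplacian h (\<lambda>y. F y t) x)"
        by (simp add: mult.assoc)
    qed
    have e2: "(\<Sum>x\<in>Q. (\<eta>' x t)\<^sup>2 * (F x t)\<^sup>2) \<le> L\<^sup>2 * N t"
      unfolding N_def sum_distrib_left
      using bounds(2) by (intro sum_mono mult_right_mono) (auto simp: abs_le_square_iff[symmetric] intro: order_trans[OF _ abs_ge_self])
    have "(\<Sum>x\<in>Q. n' x t) = (\<Sum>x\<in>Q. (y' x t)\<^sup>2) - (\<Sum>x\<in>Q. (\<eta>' x t)\<^sup>2 * (F x t)\<^sup>2)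
        + (\<Sum>x\<in>Q. (\<eta> x t)\<^sup>2 * F x t * (F'' x t + discrete_laplacian h (\<lambda>y. F y t) x))
        - (\<Sum>x\<in>Q. (\<eta> x t)\<^sup>2 * F x t * discrete_laplacian h (\<lambda>y. F y t) x)"
      unfolding sum_subtractf[symmetric] sum.distrib[symmetric]
      by (intro sum.cong refl) (simp add: n'_def y'_def power2_eq_square algebra_simps)
    also have "\<dots> = I t - (\<Sum>x\<in>Q. (\<eta>' x t)\<^sup>2 * (F x t)\<^sup>2)
        + (\<Sum>x\<in>Q. (\<eta> x t)\<^sup>2 * F x t * (F'' x t + discrete_laplacian h (\<lambda>y. F y t) x))
        - (\<Sum>k\<in>UNIV. \<Sum>x\<in>Q. D k x) / h\<^sup>2"
    proof -
      have "I t = (\<Sum>x\<in>Q. (y' x t)\<^sup>2) + (\<Sum>k\<in>UNIV. \<Sum>x\<in>Q. (y (fwd h k x) t - y x t)\<^sup>2) / h\<^sup>2"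
        unfolding I_def sum.distrib sum_divide_distrib[symmetric] by (subst sum.swap) (rule refl)
      then show ?thesis unfolding parts by (simp add: sum_subtractf diff_divide_distrib)
    qed
    finally show ?thesis using D' eq e2 by (simp add: algebra_simps)
  qed
  have "integral {0..T} I - (L\<^sup>2 + \<Lambda> + d * L\<^sup>2) * integral {0..T} N
      = integral {0..T} (\<lambda>t. I t - (L\<^sup>2 + \<Lambda> + d * L\<^sup>2) * N t)"
    using bounded_measurable_integrable[OF I_bm] bounded_measurable_integrable[OF N_bm]
      bounded_measurable_integrable[OF bounded_measurable_cmult[OF N_bm], of "L\<^sup>2 + \<Lambda> + d * L\<^sup>2"]
    by (subst integral_diff) auto
  also have "\<dots> \<le> integral {0..T} (\<lambda>t. \<Sum>x\<in>Q. n' x t)"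
    by (intro integral_le pointwise bounded_measurable_integrable bounded_measurable_diff
        bounded_measurable_cmult I_bm N_bm lipschitz_primitive_bounded_measurable[OF N_prim])
  also have "\<dots> = - (\<Sum>x\<in>Q. n x 0)"
    using lipschitz_primitive_integral[OF N_prim T] supp(2) by (simp add: n_def)
  also have "\<dots> \<le> (\<Sum>x\<in>Q. (F x 0)\<^sup>2 + (F' x 0)\<^sup>2)"
    unfolding sum_negf[symmetric]
  proof (rule sum_mono)
    fix x
    have "(\<eta> x 0)\<^sup>2 \<le> 1" using bounds(1)[of x 0] by (simp add: abs_square_le_1)
    then have "(\<eta> x 0)\<^sup>2 * \<bar>F x 0 * F' x 0\<bar> \<le> 1 * \<bar>F x 0 * F' x 0\<bar>" by (intro mult_right_mono) auto
    moreover have "- n x 0 \<le> (\<eta> x 0)\<^sup>2 * \<bar>F x 0 * F' x 0\<bar>"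
      unfolding n_def mult.assoc mult_minus_right[symmetric] by (intro mult_left_mono) auto
    moreover have "\<bar>F x 0 * F' x 0\<bar> \<le> (F x 0)\<^sup>2 + (F' x 0)\<^sup>2"
    proof -
      have "2 * \<bar>F x 0\<bar> * \<bar>F' x 0\<bar> \<le> (F x 0)\<^sup>2 + (F' x 0)\<^sup>2"
        using sum_squares_bound[of "\<bar>F x 0\<bar>" "\<bar>F' x 0\<bar>"] by simp
      moreover have "0 \<le> \<bar>F x 0\<bar> * \<bar>F' x 0\<bar>" by simp
      ultimately show ?thesis unfolding abs_mult by linarith
    qed
    ultimately show "- n x 0 \<le> (F x 0)\<^sup>2 + (F' x 0)\<^sup>2" by linarith
  qed
  finally show ?thesis unfolding I_def y_def y'_def N_def d_def by simp
qed

section \<open>Cutoff functions and their commutators\<close>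

lemma positive_part_power_deriv:
  "((\<lambda>y. (max 0 y) ^ Suc (Suc n)) has_real_derivative real (Suc (Suc n)) * (max 0 y) ^ Suc n) (at y)"
proof -
  consider "y < 0" | "y = 0" | "y > 0" by linarith
  then show ?thesis
  proof cases
    case 1
    have "\<forall>\<^sub>F s in nhds y. s < 0" using 1 by (intro order_tendstoD[OF filterlim_ident])
    then have "\<forall>\<^sub>F s in nhds y. (max 0 s) ^ Suc (Suc n) = (0::real)" by eventually_elim simp
    moreover have "((\<lambda>_. 0) has_real_derivative 0) (at y)" by simp
    ultimately show ?thesis using 1 DERIV_cong_ev[of y y "\<lambda>s. (max 0 s) ^ Suc (Suc n)" "\<lambda>_. 0" 0 0] by simp
  next
    case 2
    have "((\<lambda>s. ((max 0 s) ^ Suc (Suc n) - 0) / (s - 0)) \<longlongrightarrow> (0::real)) (at 0)"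
    proof (rule Lim_null_comparison)
      show "\<forall>\<^sub>F s in at 0. norm (((max 0 s) ^ Suc (Suc n) - 0) / (s - 0)) \<le> \<bar>s::real\<bar> ^ Suc n"
      proof (intro always_eventually allI)
        fix s :: real
        show "norm (((max 0 s) ^ Suc (Suc n) - 0) / (s - 0)) \<le> \<bar>s\<bar> ^ Suc n"
        proof (cases "0 < s")
          case False
          then have "max 0 s = 0" by simp
          then show ?thesis using zero_le_power[OF abs_ge_zero, of s "Suc n"] by simp
        qed (simp add: abs_mult)
      qed
      have "((\<lambda>s::real. \<bar>s\<bar> ^ Suc n) \<longlongrightarrow> \<bar>0\<bar> ^ Suc n) (at 0)" by (intro tendsto_intros)
      then show "((\<lambda>s::real. \<bar>s\<bar> ^ Suc n) \<longlongrightarrow> 0) (at 0)" by simp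
    qed
    then show ?thesis using 2 by (simp add: has_field_derivative_iff)
  next
    case 3
    have "\<forall>\<^sub>F s in nhds y. s > 0" using 3 by (intro order_tendstoD[OF filterlim_ident])
    then have "\<forall>\<^sub>F s in nhds y. (max 0 s) ^ Suc (Suc n) = s ^ Suc (Suc n)" by eventually_elim simp
    moreover have "((\<lambda>s. s ^ Suc (Suc n)) has_real_derivative real (Suc (Suc n)) * y ^ Suc n) (at y)"
      using DERIV_pow[of "Suc (Suc n)" y UNIV] by simp
    ultimately show ?thesis
      using 3 DERIV_cong_ev[of y y "\<lambda>s. (max 0 s) ^ Suc (Suc n)" "\<lambda>s. s ^ Suc (Suc n)"] by simp
  qed
qed

text \<open>A twice differentiable profile from which all cutoffs are made by rescaling.  Two derivatives are needed because the
  Carleman inequality contains second derivatives and second differences of the cutoff.\<close>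

locale cutoff_profile =
  fixes a a' a'' :: "real \<Rightarrow> real" and L :: real
  assumes deriv: "(a has_real_derivative a' y) (at y)"
    and deriv2: "(a' has_real_derivative a'' y) (at y)"
    and cont2: "continuous_on UNIV a''"
    and range: "0 \<le> a y" "a y \<le> 1"
    and inner: "\<bar>y\<bar> \<le> 1 \<Longrightarrow> a y = 1" "\<bar>y\<bar> \<le> 1 \<Longrightarrow> a' y = 0" "\<bar>y\<bar> \<le> 1 \<Longrightarrow> a'' y = 0"
    and outer: "2 \<le> \<bar>y\<bar> \<Longrightarrow> a y = 0" "2 \<le> \<bar>y\<bar> \<Longrightarrow> a' y = 0" "2 \<le> \<bar>y\<bar> \<Longrightarrow> a'' y = 0"
    and bound: "\<bar>a' y\<bar> \<le> L" "\<bar>a'' y\<bar> \<le> L" "1 \<le> L"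

text \<open>The function \<open>q (1 - q (y\<^sup>2 - 1) / 27)\<close> with \<open>q (z) = max 0 z ^ 3\<close>; the number \<open>27\<close> is \<open>q (3)\<close>, the value of the inner function
  at \<open>|y| = 2\<close>.\<close>

lemma exists_cutoff_profile: "\<exists>a a' a'' L. cutoff_profile a a' a'' L"
proof -
  define q :: "real \<Rightarrow> real" where "q z = (max 0 z) ^ 3" for z
  define q' :: "real \<Rightarrow> real" where "q' z = 3 * (max 0 z)\<^sup>2" for z
  define q'' :: "real \<Rightarrow> real" where "q'' z = 6 * max 0 z" for z
  have dq: "(q has_real_derivative q' z) (at z)" for z
    using positive_part_power_deriv[of 1 z] unfolding q_def q'_def by (simp add: eval_nat_numeral)
  have dq': "(q' has_real_derivative q'' z) (at z)" for z
    using DERIV_cmult[OF positive_part_power_deriv[of 0 z], of 3] unfolding q'_def q''_def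
    by (simp add: eval_nat_numeral)
  define r where "r y = 1 - q (y\<^sup>2 - 1) / 27" for y
  define r' where "r' y = - (q' (y\<^sup>2 - 1) * (2 * y)) / 27" for y
  define r'' where "r'' y = - (q'' (y\<^sup>2 - 1) * (2 * y) * (2 * y) + q' (y\<^sup>2 - 1) * 2) / 27" for y
  have dr: "(r has_real_derivative r' y) (at y)" for y
    unfolding r_def r'_def
    by (auto intro!: derivative_eq_intros DERIV_chain2[OF dq])
  have dr': "(r' has_real_derivative r'' y) (at y)" for y
    unfolding r'_def r''_def
    by (auto intro!: derivative_eq_intros DERIV_chain2[OF dq'] simp: field_simps)
  define a where "a y = q (r y)" for y
  define a' where "a' y = q' (r y) * r' y" for y
  define a'' where "a'' y = q'' (r y) * r' y * r' y + q' (r y) * r'' y" for y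
  have da: "(a has_real_derivative a' y) (at y)" for y
    unfolding a_def a'_def by (rule DERIV_chain2[OF dq dr])
  have da': "(a' has_real_derivative a'' y) (at y)" for y
    unfolding a'_def a''_def
    by (rule derivative_eq_intros DERIV_chain2[OF dq' dr] dr' refl)+ simp
  have ca'': "continuous_on UNIV a''"
    unfolding a''_def q''_def r''_def r'_def q'_def r_def q_def by (intro continuous_intros) auto
  have ca': "continuous_on UNIV a'"
    using da' by (intro continuous_at_imp_continuous_on ballI DERIV_isCont)
  have in1: "q (y\<^sup>2 - 1) = 0" "q' (y\<^sup>2 - 1) = 0" "q'' (y\<^sup>2 - 1) = 0" if "\<bar>y\<bar> \<le> 1" for y
    using that abs_square_le_1[of y] by (auto simp: q_def q'_def q''_def)
  have out: "r y \<le> 0" if "2 \<le> \<bar>y\<bar>" for y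
  proof -
    have "2\<^sup>2 \<le> \<bar>y\<bar>\<^sup>2" using that by (intro power_mono) auto
    then have "3 \<le> y\<^sup>2 - 1" by simp
    then have "3 ^ 3 \<le> (max 0 (y\<^sup>2 - 1)) ^ 3" by (intro power_mono) auto
    then show ?thesis by (simp add: r_def q_def)
  qed
  have "r y \<le> 1" for y by (simp add: r_def q_def)
  then have a1: "a y \<le> 1" for y
    unfolding a_def q_def by (intro power_le_one) auto
  have zero: "a' y = 0" "a'' y = 0" "a y = 0" if "2 \<le> \<bar>y\<bar>" for y
    using out[OF that] by (auto simp: a_def a'_def a''_def q_def q'_def q''_def)
  have "bounded (a' ` {-2..2})" "bounded (a'' ` {-2..2})"
    by (intro compact_imp_bounded compact_continuous_image continuous_on_subset[OF ca']
        continuous_on_subset[OF ca''], auto)+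
  then obtain B1 B2 where B: "\<And>y. y \<in> {-2..2} \<Longrightarrow> \<bar>a' y\<bar> \<le> B1" "\<And>y. y \<in> {-2..2} \<Longrightarrow> \<bar>a'' y\<bar> \<le> B2"
    unfolding bounded_iff by (metis image_eqI real_norm_def)
  define L where "L = max 1 (max B1 B2)"
  have "\<bar>a' y\<bar> \<le> L" "\<bar>a'' y\<bar> \<le> L" for y
    using zero[of y] B[of y] by (cases "2 \<le> \<bar>y\<bar>"; force simp: L_def)+
  moreover have "a y = 1" if "\<bar>y\<bar> \<le> 1" for y
    using in1[OF that] by (simp add: a_def r_def q_def)
  moreover have "a' y = 0" "a'' y = 0" if "\<bar>y\<bar> \<le> 1" for y
    using in1[OF that] by (auto simp: a'_def a''_def r'_def r''_def)
  moreover have "0 \<le> a y" for y by (simp add: a_def q_def)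
  moreover have "1 \<le> L" by (simp add: L_def)
  ultimately have "cutoff_profile a a' a'' L"
    unfolding cutoff_profile_def using da da' ca'' a1 zero by blast
  then show ?thesis by blast
qed

lemma DERIV_bound_lipschitz:
  fixes a a' :: "real \<Rightarrow> real"
  assumes "\<And>y. (a has_real_derivative a' y) (at y)" "\<And>y. \<bar>a' y\<bar> \<le> L"
  shows "\<bar>a y - a z\<bar> \<le> L * \<bar>y - z\<bar>"
  using field_differentiable_bound[of UNIV a a' L y z] assms
  by (auto intro: has_field_derivative_at_within)

lemma second_difference_bound:
  fixes a a' a'' :: "real \<Rightarrow> real"
  assumes a: "\<And>y. (a has_real_derivative a' y) (at y)" "\<And>y. (a' has_real_derivative a'' y) (at y)"
    and L: "\<And>y. \<bar>a'' y\<bar> \<le> L" and e: "0 \<le> e"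
  shows "\<bar>a (y + e) + a (y - e) - 2 * a y\<bar> \<le> 2 * L * e\<^sup>2"
proof -
  have "\<bar>(a (y + e) + a (y - e)) - (a (y + 0) + a (y - 0))\<bar> \<le> (L * (2 * e)) * \<bar>e - 0\<bar>"
  proof -
    have "norm ((a (y + e) + a (y - e)) - (a (y + 0) + a (y - 0))) \<le> (L * (2 * e)) * norm (e - 0)"
    proof (rule field_differentiable_bound[where S = "{0..e}" and f = "\<lambda>s. a (y + s) + a (y - s)"
          and f' = "\<lambda>s. a' (y + s) - a' (y - s)"])
      show "((\<lambda>s. a (y + s) + a (y - s)) has_field_derivative a' (y + s) - a' (y - s)) (at s within {0..e})" for s
        by (rule has_field_derivative_at_within)
          (auto intro!: derivative_eq_intros DERIV_chain2[OF a(1)])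
      show "norm (a' (y + s) - a' (y - s)) \<le> L * (2 * e)" if "s \<in> {0..e}" for s
      proof -
        have "\<bar>a' (y + s) - a' (y - s)\<bar> \<le> L * \<bar>(y + s) - (y - s)\<bar>"
          by (rule DERIV_bound_lipschitz[OF a(2) L])
        also have "\<dots> \<le> L * (2 * e)"
          using that L[of 0] by (intro mult_left_mono) auto
        finally show ?thesis by simp
      qed
    qed (use e in auto)
    then show ?thesis by simp
  qed
  then show ?thesis using e by (simp add: power2_eq_square algebra_simps)
qed


context cutoff_profile
begin

definition box_cutoff :: "real \<Rightarrow> real ^ 'd::finite \<Rightarrow> real" where
  "box_cutoff \<sigma> x = (\<Prod>k\<in>UNIV. a (x $ k / \<sigma>))"

lemma box_cutoff_range: "0 \<le> box_cutoff \<sigma> x" "box_cutoff \<sigma> x \<le> 1"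
  unfolding box_cutoff_def by (auto intro!: prod_nonneg prod_le_1 simp: range)

lemma box_cutoff_inner:
  assumes "0 < \<sigma>" "\<And>k. \<bar>x $ k\<bar> \<le> \<sigma>" shows "box_cutoff \<sigma> x = 1"
  unfolding box_cutoff_def using assms by (intro prod.neutral) (auto intro!: inner)

lemma box_cutoff_nonzeroD:
  assumes "0 < \<sigma>" "box_cutoff \<sigma> x \<noteq> 0" shows "\<bar>x $ k\<bar> < 2 * \<sigma>"
proof (rule ccontr)
  assume "\<not> \<bar>x $ k\<bar> < 2 * \<sigma>"
  then have "a (x $ k / \<sigma>) = 0" using assms(1) by (intro outer) (auto simp: field_simps)
  then have "box_cutoff \<sigma> x = 0" unfolding box_cutoff_def by (intro prod_zero) auto
  with assms(2) show False by simp
qed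

lemma box_cutoff_split:
  obtains R where "0 \<le> R" "R \<le> 1" "box_cutoff \<sigma> x = a (x $ k / \<sigma>) * R"
    "box_cutoff \<sigma> (fwd h k x) = a ((x $ k + h) / \<sigma>) * R"
    "box_cutoff \<sigma> (bwd h k x) = a ((x $ k - h) / \<sigma>) * R"
proof
  let ?R = "\<Prod>j\<in>UNIV - {k}. a (x $ j / \<sigma>)"
  show "0 \<le> ?R" "?R \<le> 1" by (auto intro!: prod_nonneg prod_le_1 simp: range)
  show "box_cutoff \<sigma> x = a (x $ k / \<sigma>) * ?R"
    unfolding box_cutoff_def by (rule prod.remove) auto
  show "box_cutoff \<sigma> (fwd h k x) = a ((x $ k + h) / \<sigma>) * ?R"
  proof -
    have "(\<Prod>j\<in>UNIV - {k}. a ((fwd h k x) $ j / \<sigma>)) = ?R"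
      by (intro prod.cong refl) (simp add: axis_def)
    moreover have "(fwd h k x) $ k = x $ k + h" by simp
    ultimately show ?thesis
      unfolding box_cutoff_def by (metis (no_types, lifting) UNIV_I finite prod.remove)
  qed
  show "box_cutoff \<sigma> (bwd h k x) = a ((x $ k - h) / \<sigma>) * ?R"
  proof -
    have "(\<Prod>j\<in>UNIV - {k}. a ((bwd h k x) $ j / \<sigma>)) = ?R"
      by (intro prod.cong refl) (simp add: axis_def)
    moreover have "(bwd h k x) $ k = x $ k - h" by simp
    ultimately show ?thesis
      unfolding box_cutoff_def by (metis (no_types, lifting) UNIV_I finite prod.remove)
  qed
qed

lemma box_cutoff_difference:
  assumes "0 < \<sigma>" "0 < h"
  shows "\<bar>box_cutoff \<sigma> (fwd h k x) - box_cutoff \<sigma> x\<bar> \<le> L / \<sigma> * h"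
    "\<bar>box_cutoff \<sigma> (bwd h k x) - box_cutoff \<sigma> x\<bar> \<le> L / \<sigma> * h"
    "\<bar>box_cutoff \<sigma> (fwd h k x) + box_cutoff \<sigma> (bwd h k x) - 2 * box_cutoff \<sigma> x\<bar>
      \<le> 2 * L / \<sigma>\<^sup>2 * h\<^sup>2"
proof -
  obtain R where R: "0 \<le> R" "R \<le> 1" "box_cutoff \<sigma> x = a (x $ k / \<sigma>) * R"
    "box_cutoff \<sigma> (fwd h k x) = a ((x $ k + h) / \<sigma>) * R"
    "box_cutoff \<sigma> (bwd h k x) = a ((x $ k - h) / \<sigma>) * R"
    by (rule box_cutoff_split)
  have R1: "\<bar>b * R\<bar> \<le> c" if "\<bar>b\<bar> \<le> c" for b c
    using mult_mono[of "\<bar>b\<bar>" c "\<bar>R\<bar>" 1] R(1,2) that by (auto simp: abs_mult)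
  have "\<bar>a ((x $ k + h) / \<sigma>) - a (x $ k / \<sigma>)\<bar> \<le> L / \<sigma> * h"
    using DERIV_bound_lipschitz[OF deriv bound(1), of "(x $ k + h) / \<sigma>" "x $ k / \<sigma>"] assms
    by (simp add: diff_divide_distrib[symmetric])
  from R1[OF this] show "\<bar>box_cutoff \<sigma> (fwd h k x) - box_cutoff \<sigma> x\<bar> \<le> L / \<sigma> * h"
    unfolding R by (simp add: algebra_simps)
  have "\<bar>a ((x $ k - h) / \<sigma>) - a (x $ k / \<sigma>)\<bar> \<le> L / \<sigma> * h"
    using DERIV_bound_lipschitz[OF deriv bound(1), of "(x $ k - h) / \<sigma>" "x $ k / \<sigma>"] assms
    by (simp add: diff_divide_distrib[symmetric])
  from R1[OF this] show "\<bar>box_cutoff \<sigma> (bwd h k x) - box_cutoff \<sigma> x\<bar> \<le> L / \<sigma> * h"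
    unfolding R by (simp add: algebra_simps)
  have "\<bar>a ((x $ k + h) / \<sigma>) + a ((x $ k - h) / \<sigma>) - 2 * a (x $ k / \<sigma>)\<bar> \<le> 2 * L / \<sigma>\<^sup>2 * h\<^sup>2"
    using second_difference_bound[OF deriv deriv2 bound(2), of "h / \<sigma>" "x $ k / \<sigma>"] assms
    by (simp add: add_divide_distrib diff_divide_distrib power_divide)
  from R1[OF this] show "\<bar>box_cutoff \<sigma> (fwd h k x) + box_cutoff \<sigma> (bwd h k x) - 2 * box_cutoff \<sigma> x\<bar>
      \<le> 2 * L / \<sigma>\<^sup>2 * h\<^sup>2"
    unfolding R by (simp add: algebra_simps)
qed

lemma box_cutoff_flat:
  assumes "0 < \<sigma>" "0 < h" "\<bar>x $ k\<bar> \<le> \<sigma> - h"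
  shows "box_cutoff \<sigma> (fwd h k x) = box_cutoff \<sigma> x"
    "box_cutoff \<sigma> (bwd h k x) = box_cutoff \<sigma> x"
proof -
  obtain R where R: "box_cutoff \<sigma> x = a (x $ k / \<sigma>) * R"
    "box_cutoff \<sigma> (fwd h k x) = a ((x $ k + h) / \<sigma>) * R"
    "box_cutoff \<sigma> (bwd h k x) = a ((x $ k - h) / \<sigma>) * R"
    by (rule box_cutoff_split)
  have "a (x $ k / \<sigma>) = 1" "a ((x $ k + h) / \<sigma>) = 1" "a ((x $ k - h) / \<sigma>) = 1"
    using assms by (auto intro!: inner)
  then show "box_cutoff \<sigma> (fwd h k x) = box_cutoff \<sigma> x"
    "box_cutoff \<sigma> (bwd h k x) = box_cutoff \<sigma> x"
    unfolding R by auto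
qed

definition cutoff :: "real \<Rightarrow> real ^ 'd::finite \<Rightarrow> real \<Rightarrow> real" where
  "cutoff \<sigma> x t = a (t / \<sigma>) * box_cutoff \<sigma> x"

definition cutoff' :: "real \<Rightarrow> real ^ 'd::finite \<Rightarrow> real \<Rightarrow> real" where
  "cutoff' \<sigma> x t = a' (t / \<sigma>) / \<sigma> * box_cutoff \<sigma> x"

definition cutoff'' :: "real \<Rightarrow> real ^ 'd::finite \<Rightarrow> real \<Rightarrow> real" where
  "cutoff'' \<sigma> x t = a'' (t / \<sigma>) / \<sigma>\<^sup>2 * box_cutoff \<sigma> x"

lemma cutoff_primitive:
  assumes "0 < \<sigma>"
  shows "lipschitz_primitive T (cutoff \<sigma> x) (cutoff' \<sigma> x)"
    "lipschitz_primitive T (cutoff' \<sigma> x) (cutoff'' \<sigma> x)"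
proof -
  have c: "continuous_on UNIV (\<lambda>t. f (t / \<sigma>))" if "continuous_on UNIV f" for f :: "real \<Rightarrow> real"
  proof -
    have "continuous_on UNIV (\<lambda>t. t / \<sigma>)" using assms by (intro continuous_intros) auto
    then show ?thesis using continuous_on_compose2[OF that] by blast
  qed
  have c': "continuous_on UNIV a'"
    using deriv2 by (intro continuous_at_imp_continuous_on ballI DERIV_isCont)
  show "lipschitz_primitive T (cutoff \<sigma> x) (cutoff' \<sigma> x)"
    unfolding cutoff_def cutoff'_def
    by (rule lipschitz_primitive_C1)
      (use assms in \<open>auto intro!: derivative_eq_intros DERIV_chain2[OF deriv] continuous_intros c[OF c']\<close>)
  show "lipschitz_primitive T (cutoff' \<sigma> x) (cutoff'' \<sigma> x)"
    unfolding cutoff'_def cutoff''_def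
    by (rule lipschitz_primitive_C1)
      (use assms in \<open>auto intro!: derivative_eq_intros DERIV_chain2[OF deriv2] continuous_intros c[OF cont2]
        simp: power2_eq_square\<close>)
qed

lemma cutoff_abs_le: "\<bar>cutoff \<sigma> x t\<bar> \<le> 1"
  unfolding cutoff_def using range[of "t / \<sigma>"] box_cutoff_range[of \<sigma> x]
  by (simp add: abs_mult mult_le_one)

lemma cutoff'_abs_le: "0 < \<sigma> \<Longrightarrow> \<bar>cutoff' \<sigma> x t\<bar> \<le> L / \<sigma>"
  unfolding cutoff'_def using bound(1)[of "t / \<sigma>"] box_cutoff_range[of \<sigma> x]
    mult_mono[of "\<bar>a' (t / \<sigma>)\<bar> / \<sigma>" "L / \<sigma>" "\<bar>box_cutoff \<sigma> x\<bar>" 1] bound(3)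
  by (auto simp: abs_mult divide_right_mono)

lemma cutoff''_abs_le: "0 < \<sigma> \<Longrightarrow> \<bar>cutoff'' \<sigma> x t\<bar> \<le> L / \<sigma>\<^sup>2"
  unfolding cutoff''_def using bound(2)[of "t / \<sigma>"] box_cutoff_range[of \<sigma> x]
    mult_mono[of "\<bar>a'' (t / \<sigma>)\<bar> / \<sigma>\<^sup>2" "L / \<sigma>\<^sup>2" "\<bar>box_cutoff \<sigma> x\<bar>" 1] bound(3)
  by (auto simp: abs_mult divide_right_mono)

lemma cutoff_difference:
  assumes "0 < \<sigma>" "0 < h"
  shows "\<bar>cutoff \<sigma> (fwd h k x) t - cutoff \<sigma> x t\<bar> \<le> L / \<sigma> * h"
    "\<bar>cutoff \<sigma> (bwd h k x) t - cutoff \<sigma> x t\<bar> \<le> L / \<sigma> * h"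
    "\<bar>cutoff \<sigma> (fwd h k x) t + cutoff \<sigma> (bwd h k x) t - 2 * cutoff \<sigma> x t\<bar>
      \<le> 2 * L / \<sigma>\<^sup>2 * h\<^sup>2"
proof -
  have R1: "\<bar>a (t / \<sigma>) * b\<bar> \<le> c" if "\<bar>b\<bar> \<le> c" for b c
    using mult_mono[of "\<bar>a (t / \<sigma>)\<bar>" 1 "\<bar>b\<bar>" c] range[of "t / \<sigma>"] that by (auto simp: abs_mult)
  show "\<bar>cutoff \<sigma> (fwd h k x) t - cutoff \<sigma> x t\<bar> \<le> L / \<sigma> * h"
    using R1[OF box_cutoff_difference(1)[OF assms, of x k]] by (simp add: cutoff_def algebra_simps)
  show "\<bar>cutoff \<sigma> (bwd h k x) t - cutoff \<sigma> x t\<bar> \<le> L / \<sigma> * h"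
    using R1[OF box_cutoff_difference(2)[OF assms, of x k]] by (simp add: cutoff_def algebra_simps)
  show "\<bar>cutoff \<sigma> (fwd h k x) t + cutoff \<sigma> (bwd h k x) t - 2 * cutoff \<sigma> x t\<bar>
      \<le> 2 * L / \<sigma>\<^sup>2 * h\<^sup>2"
    using R1[OF box_cutoff_difference(3)[OF assms, of x k]] by (simp add: cutoff_def algebra_simps)
qed

end

lemma laplacian_product:
  "discrete_laplacian h (\<lambda>y. \<psi> y * F y) x = \<psi> x * discrete_laplacian h F x
    + (\<Sum>k\<in>UNIV. (\<psi> (fwd h k x) - \<psi> x) * (F (fwd h k x) - F x)
        + (\<psi> (bwd h k x) - \<psi> x) * (F (bwd h k x) - F x)
        + (\<psi> (fwd h k x) + \<psi> (bwd h k x) - 2 * \<psi> x) * F x) / h\<^sup>2"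
  unfolding discrete_laplacian_def times_divide_eq_right add_divide_distrib[symmetric]
    sum_distrib_left sum.distrib[symmetric]
  by (intro arg_cong[where f = "\<lambda>a. a / h\<^sup>2"] sum.cong refl) (simp add: algebra_simps)

lemma commutator_square_le:
  fixes u v b :: real and p m cp cm cc :: "'d::finite \<Rightarrow> real"
  assumes "0 \<le> M" "0 < h" and c: "\<bar>c1\<bar> \<le> M" "\<bar>c2\<bar> \<le> M"
    "\<And>k. \<bar>cp k\<bar> \<le> M * h" "\<And>k. \<bar>cm k\<bar> \<le> M * h" "\<And>k. \<bar>cc k\<bar> \<le> M * h\<^sup>2"
  shows "(c1 * v + c2 * u + (\<Sum>k\<in>UNIV. cp k * p k + cm k * m k + cc k * u) / h\<^sup>2)\<^sup>2 \<le>
    6 * M\<^sup>2 * (1 + real CARD('d))\<^sup>2 * (v\<^sup>2 + u\<^sup>2 + (\<Sum>k\<in>UNIV. (p k)\<^sup>2 + (m k)\<^sup>2) / h\<^sup>2)"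
proof -
  define d where "d = real CARD('d)"
  define s where "s = (\<Sum>k\<in>UNIV. (p k)\<^sup>2 + (m k)\<^sup>2) / h\<^sup>2"
  have d1: "1 \<le> d" unfolding d_def by (simp add: Suc_leI)
  have s0: "0 \<le> s" unfolding s_def by (intro divide_nonneg_nonneg sum_nonneg) auto
  define e where "e = (\<Sum>k\<in>UNIV. (\<bar>p k\<bar> + \<bar>m k\<bar>) / h)"
  have "\<bar>\<Sum>k\<in>UNIV. cp k * p k + cm k * m k + cc k * u\<bar> \<le>
      (\<Sum>k\<in>UNIV. M * h * \<bar>p k\<bar> + M * h * \<bar>m k\<bar> + M * h\<^sup>2 * \<bar>u\<bar>)"
  proof (rule order_trans[OF sum_abs], rule sum_mono)
    fix k
    have "\<bar>cp k * p k\<bar> \<le> M * h * \<bar>p k\<bar>" "\<bar>cm k * m k\<bar> \<le> M * h * \<bar>m k\<bar>" "\<bar>cc k * u\<bar> \<le> M * h\<^sup>2 * \<bar>u\<bar>"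
      unfolding abs_mult using c by (auto intro!: mult_right_mono)
    then show "\<bar>cp k * p k + cm k * m k + cc k * u\<bar> \<le> M * h * \<bar>p k\<bar> + M * h * \<bar>m k\<bar> + M * h\<^sup>2 * \<bar>u\<bar>"
      by linarith
  qed
  then have "\<bar>(\<Sum>k\<in>UNIV. cp k * p k + cm k * m k + cc k * u) / h\<^sup>2\<bar> \<le>
      (\<Sum>k\<in>UNIV. M * h * \<bar>p k\<bar> + M * h * \<bar>m k\<bar> + M * h\<^sup>2 * \<bar>u\<bar>) / h\<^sup>2"
    using assms(2) by (simp add: divide_right_mono)
  also have "\<dots> = (\<Sum>k\<in>UNIV. M * ((\<bar>p k\<bar> + \<bar>m k\<bar>) / h) + M * \<bar>u\<bar>)"
    unfolding sum_divide_distrib using assms(2)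
    by (intro sum.cong refl) (simp add: field_simps power2_eq_square)
  also have "\<dots> = M * e + d * (M * \<bar>u\<bar>)"
    unfolding e_def sum.distrib sum_distrib_left[symmetric] by (simp add: d_def)
  finally have 1: "\<bar>(\<Sum>k\<in>UNIV. cp k * p k + cm k * m k + cc k * u) / h\<^sup>2\<bar> \<le> M * e + d * (M * \<bar>u\<bar>)" .
  have "\<bar>c1 * v\<bar> \<le> M * \<bar>v\<bar>" "\<bar>c2 * u\<bar> \<le> M * \<bar>u\<bar>"
    unfolding abs_mult using c by (auto intro!: mult_right_mono)
  with 1 have "\<bar>c1 * v + c2 * u + (\<Sum>k\<in>UNIV. cp k * p k + cm k * m k + cc k * u) / h\<^sup>2\<bar>
      \<le> M * \<bar>v\<bar> + M * \<bar>u\<bar> + (M * e + d * (M * \<bar>u\<bar>))" by linarith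
  also have "\<dots> = M * (\<bar>v\<bar> + (1 + d) * \<bar>u\<bar> + e)" by (simp add: algebra_simps)
  finally have "\<bar>c1 * v + c2 * u + (\<Sum>k\<in>UNIV. cp k * p k + cm k * m k + cc k * u) / h\<^sup>2\<bar>
      \<le> M * (\<bar>v\<bar> + (1 + d) * \<bar>u\<bar> + e)" .
  then have "(c1 * v + c2 * u + (\<Sum>k\<in>UNIV. cp k * p k + cm k * m k + cc k * u) / h\<^sup>2)\<^sup>2
      \<le> (M * (\<bar>v\<bar> + (1 + d) * \<bar>u\<bar> + e))\<^sup>2"
    by (rule square_le_if_abs_le)
  also have "\<dots> \<le> M\<^sup>2 * (3 * (v\<^sup>2 + ((1 + d) * \<bar>u\<bar>)\<^sup>2 + e\<^sup>2))"
    unfolding power_mult_distrib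
  proof (intro mult_left_mono)
    define f g where "f = \<bar>v\<bar>" and "g = (1 + d) * \<bar>u\<bar>"
    have "0 \<le> (f - g)\<^sup>2 + (g - e)\<^sup>2 + (f - e)\<^sup>2" by simp
    then have "(f + g + e)\<^sup>2 \<le> 3 * (f\<^sup>2 + g\<^sup>2 + e\<^sup>2)" by (simp add: power2_eq_square algebra_simps)
    then show "(\<bar>v\<bar> + (1 + d) * \<bar>u\<bar> + e)\<^sup>2 \<le> 3 * (v\<^sup>2 + (1 + d)\<^sup>2 * \<bar>u\<bar>\<^sup>2 + e\<^sup>2)"
      unfolding f_def g_def by (simp add: power_mult_distrib)
  qed auto
  also have "\<dots> \<le> M\<^sup>2 * (3 * ((1 + d)\<^sup>2 * v\<^sup>2 + (1 + d)\<^sup>2 * u\<^sup>2 + 2 * (1 + d)\<^sup>2 * s))"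
  proof (intro mult_left_mono add_mono)
    show "v\<^sup>2 \<le> (1 + d)\<^sup>2 * v\<^sup>2" using d1 mult_right_mono[of 1 "(1 + d)\<^sup>2" "v\<^sup>2"] by (simp add: one_le_power)
    show "((1 + d) * \<bar>u\<bar>)\<^sup>2 \<le> (1 + d)\<^sup>2 * u\<^sup>2" by (simp add: power_mult_distrib)
    have "e\<^sup>2 \<le> d * (\<Sum>k\<in>UNIV. ((\<bar>p k\<bar> + \<bar>m k\<bar>) / h)\<^sup>2)"
      unfolding e_def d_def by (rule sum_square_le_card)
    also have "\<dots> \<le> d * (\<Sum>k\<in>UNIV. 2 * (((p k)\<^sup>2 + (m k)\<^sup>2) / h\<^sup>2))"
    proof (intro mult_left_mono sum_mono)
      fix k
      show "((\<bar>p k\<bar> + \<bar>m k\<bar>) / h)\<^sup>2 \<le> 2 * (((p k)\<^sup>2 + (m k)\<^sup>2) / h\<^sup>2)"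
        using power2_sum_le[of "\<bar>p k\<bar>" "\<bar>m k\<bar>"] by (simp add: power_divide divide_right_mono)
    qed (use d1 in auto)
    also have "\<dots> = 2 * d * s" unfolding s_def by (simp add: sum_distrib_left sum_divide_distrib mult_ac)
    also have "\<dots> \<le> 2 * (1 + d)\<^sup>2 * s"
      using d1 s0 by (intro mult_right_mono) (auto simp: power2_eq_square algebra_simps)
    finally show "e\<^sup>2 \<le> 2 * (1 + d)\<^sup>2 * s" .
  qed auto
  also have "\<dots> \<le> 6 * M\<^sup>2 * (1 + d)\<^sup>2 * (v\<^sup>2 + u\<^sup>2 + s)"
  proof -
    have "0 \<le> M\<^sup>2 * ((1 + d)\<^sup>2 * v\<^sup>2)" "0 \<le> M\<^sup>2 * ((1 + d)\<^sup>2 * u\<^sup>2)" by auto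
    then show ?thesis by (simp add: algebra_simps)
  qed
  finally show ?thesis unfolding d_def s_def .
qed

context cutoff_profile
begin

text \<open>Functions on the lattice are total functions, so the cutoff has to vanish off the lattice for its support to be
  finite.\<close>

definition mesh_cutoff :: "real \<Rightarrow> real \<Rightarrow> real ^ 'd::finite \<Rightarrow> real \<Rightarrow> real" where
  "mesh_cutoff h \<sigma> x t = (if x \<in> mesh h then cutoff \<sigma> x t else 0)"

definition mesh_cutoff' :: "real \<Rightarrow> real \<Rightarrow> real ^ 'd::finite \<Rightarrow> real \<Rightarrow> real" where
  "mesh_cutoff' h \<sigma> x t = (if x \<in> mesh h then cutoff' \<sigma> x t else 0)"

definition mesh_cutoff'' :: "real \<Rightarrow> real \<Rightarrow> real ^ 'd::finite \<Rightarrow> real \<Rightarrow> real" where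
  "mesh_cutoff'' h \<sigma> x t = (if x \<in> mesh h then cutoff'' \<sigma> x t else 0)"

lemma mesh_cutoff_primitive:
  assumes "0 < \<sigma>"
  shows "lipschitz_primitive T (mesh_cutoff h \<sigma> x) (mesh_cutoff' h \<sigma> x)"
    "lipschitz_primitive T (mesh_cutoff' h \<sigma> x) (mesh_cutoff'' h \<sigma> x)"
proof -
  have e: "mesh_cutoff h \<sigma> x = (if x \<in> mesh h then cutoff \<sigma> x else (\<lambda>_. 0))"
    "mesh_cutoff' h \<sigma> x = (if x \<in> mesh h then cutoff' \<sigma> x else (\<lambda>_. 0))"
    "mesh_cutoff'' h \<sigma> x = (if x \<in> mesh h then cutoff'' \<sigma> x else (\<lambda>_. 0))"
    by (auto simp: mesh_cutoff_def mesh_cutoff'_def mesh_cutoff''_def)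
  show "lipschitz_primitive T (mesh_cutoff h \<sigma> x) (mesh_cutoff' h \<sigma> x)"
    "lipschitz_primitive T (mesh_cutoff' h \<sigma> x) (mesh_cutoff'' h \<sigma> x)"
    unfolding e using cutoff_primitive[OF assms] lipschitz_primitive_const[of T 0] by auto
qed

lemma mesh_cutoff_outside:
  assumes "0 < \<sigma>" "0 < h" "2 * \<sigma> + h \<le> R" "x \<notin> margin h (mesh_box h R)"
  shows "mesh_cutoff h \<sigma> x t = 0" "mesh_cutoff' h \<sigma> x t = 0" "mesh_cutoff'' h \<sigma> x t = 0"
proof -
  have "box_cutoff \<sigma> x = 0" if "x \<in> mesh h"
  proof (rule ccontr)
    assume "box_cutoff \<sigma> x \<noteq> 0"
    then have "x \<in> mesh_box h (2 * \<sigma>)"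
      using that box_cutoff_nonzeroD[OF assms(1)] by (force simp: mesh_box_def intro: less_imp_le)
    then show False using mesh_box_margin[of x h "2 * \<sigma>" R] assms by blast
  qed
  then show "mesh_cutoff h \<sigma> x t = 0" "mesh_cutoff' h \<sigma> x t = 0" "mesh_cutoff'' h \<sigma> x t = 0"
    by (auto simp: mesh_cutoff_def mesh_cutoff'_def mesh_cutoff''_def cutoff_def cutoff'_def cutoff''_def)
qed

lemma mesh_cutoff_bounds:
  assumes "0 < \<sigma>" "0 < h"
  shows "\<bar>mesh_cutoff h \<sigma> x t\<bar> \<le> 1" "\<bar>mesh_cutoff' h \<sigma> x t\<bar> \<le> L / \<sigma>"
    "\<bar>mesh_cutoff'' h \<sigma> x t\<bar> \<le> L / \<sigma>\<^sup>2"
    "\<bar>mesh_cutoff h \<sigma> (fwd h k x) t - mesh_cutoff h \<sigma> x t\<bar> \<le> L / \<sigma> * h"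
    "\<bar>mesh_cutoff h \<sigma> (bwd h k x) t - mesh_cutoff h \<sigma> x t\<bar> \<le> L / \<sigma> * h"
    "\<bar>mesh_cutoff h \<sigma> (fwd h k x) t + mesh_cutoff h \<sigma> (bwd h k x) t
      - 2 * mesh_cutoff h \<sigma> x t\<bar> \<le> 2 * L / \<sigma>\<^sup>2 * h\<^sup>2"
proof -
  have nn: "0 \<le> L / \<sigma>" "0 \<le> L / \<sigma>\<^sup>2" "0 \<le> L / \<sigma> * h" "0 \<le> 2 * L / \<sigma>\<^sup>2 * h\<^sup>2" using assms bound(3) by auto
  show "\<bar>mesh_cutoff h \<sigma> x t\<bar> \<le> 1"
    unfolding mesh_cutoff_def mesh_cutoff'_def mesh_cutoff''_def mesh_shift_iff
    using cutoff_abs_le nn by (cases "x \<in> mesh h") (simp_all only: if_True if_False simp_thms, simp_all)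
  show "\<bar>mesh_cutoff' h \<sigma> x t\<bar> \<le> L / \<sigma>"
    unfolding mesh_cutoff_def mesh_cutoff'_def mesh_cutoff''_def mesh_shift_iff
    using cutoff'_abs_le[OF assms(1)] nn by (cases "x \<in> mesh h") (simp_all only: if_True if_False simp_thms, simp_all)
  show "\<bar>mesh_cutoff'' h \<sigma> x t\<bar> \<le> L / \<sigma>\<^sup>2"
    unfolding mesh_cutoff_def mesh_cutoff'_def mesh_cutoff''_def mesh_shift_iff
    using cutoff''_abs_le[OF assms(1)] nn by (cases "x \<in> mesh h") (simp_all only: if_True if_False simp_thms, simp_all)
  show "\<bar>mesh_cutoff h \<sigma> (fwd h k x) t - mesh_cutoff h \<sigma> x t\<bar> \<le> L / \<sigma> * h"
    unfolding mesh_cutoff_def mesh_cutoff'_def mesh_cutoff''_def mesh_shift_iff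
    using cutoff_difference(1)[OF assms] nn by (cases "x \<in> mesh h") (simp_all only: if_True if_False simp_thms, simp_all)
  show "\<bar>mesh_cutoff h \<sigma> (bwd h k x) t - mesh_cutoff h \<sigma> x t\<bar> \<le> L / \<sigma> * h"
    unfolding mesh_cutoff_def mesh_cutoff'_def mesh_cutoff''_def mesh_shift_iff
    using cutoff_difference(2)[OF assms] nn by (cases "x \<in> mesh h") (simp_all only: if_True if_False simp_thms, simp_all)
  show "\<bar>mesh_cutoff h \<sigma> (fwd h k x) t + mesh_cutoff h \<sigma> (bwd h k x) t
      - 2 * mesh_cutoff h \<sigma> x t\<bar> \<le> 2 * L / \<sigma>\<^sup>2 * h\<^sup>2"
    unfolding mesh_cutoff_def mesh_cutoff'_def mesh_cutoff''_def mesh_shift_iff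
    using cutoff_difference(3)[OF assms] nn by (cases "x \<in> mesh h") (simp_all only: if_True if_False simp_thms, simp_all)
qed

lemma mesh_cutoff_inner:
  assumes "0 < \<sigma>" "x \<in> mesh_box h \<sigma>" "0 \<le> t" "t \<le> \<sigma>"
  shows "mesh_cutoff h \<sigma> x t = 1" "mesh_cutoff' h \<sigma> x t = 0"
proof -
  have "\<bar>t / \<sigma>\<bar> \<le> 1" using assms by simp
  moreover have "box_cutoff \<sigma> x = 1" using assms by (intro box_cutoff_inner) (auto simp: mesh_box_def)
  ultimately show "mesh_cutoff h \<sigma> x t = 1" "mesh_cutoff' h \<sigma> x t = 0"
    using assms(2) inner(1,2)[of "t / \<sigma>"]
    by (auto simp: mesh_cutoff_def mesh_cutoff'_def cutoff_def cutoff'_def mesh_box_def)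
qed

lemma mesh_cutoff_late:
  assumes "0 < \<sigma>" "2 * \<sigma> \<le> t"
  shows "mesh_cutoff h \<sigma> x t = 0" "mesh_cutoff' h \<sigma> x t = 0" "mesh_cutoff'' h \<sigma> x t = 0"
proof -
  have "2 \<le> \<bar>t / \<sigma>\<bar>" using assms by (simp add: field_simps)
  from outer[OF this] show "mesh_cutoff h \<sigma> x t = 0" "mesh_cutoff' h \<sigma> x t = 0" "mesh_cutoff'' h \<sigma> x t = 0"
    by (auto simp: mesh_cutoff_def mesh_cutoff'_def mesh_cutoff''_def cutoff_def cutoff'_def cutoff''_def)
qed

lemma mesh_cutoff'_early:
  assumes "0 < \<sigma>" "0 \<le> t" "t \<le> \<sigma>"
  shows "mesh_cutoff' h \<sigma> x t = 0" "mesh_cutoff'' h \<sigma> x t = 0"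
proof -
  have "\<bar>t / \<sigma>\<bar> \<le> 1" using assms by simp
  from inner[OF this] show "mesh_cutoff' h \<sigma> x t = 0" "mesh_cutoff'' h \<sigma> x t = 0"
    by (auto simp: mesh_cutoff'_def mesh_cutoff''_def cutoff'_def cutoff''_def)
qed

lemma mesh_cutoff_flat:
  assumes "0 < \<sigma>" "0 < h" "\<bar>x $ k\<bar> \<le> \<sigma> - h"
  shows "mesh_cutoff h \<sigma> (fwd h k x) t = mesh_cutoff h \<sigma> x t"
    "mesh_cutoff h \<sigma> (bwd h k x) t = mesh_cutoff h \<sigma> x t"
  using box_cutoff_flat[OF assms] by (auto simp: mesh_cutoff_def cutoff_def mesh_shift_iff)


text \<open>What remains of \<open>\<partial>\<^sub>t\<^sup>2 + \<Delta>\<^sub>d\<close> applied to cutoff times \<open>F\<close> after the cutoff has been moved in front.  The discrete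
  Leibniz rule is arranged so that first differences of the cutoff meet first differences of \<open>F\<close>, and \<open>F\<close> itself
  only meets second differences; the coefficients of \<open>F\<close> and of its difference quotients are then bounded uniformly in \<open>h\<close>.\<close>

definition commutator :: "real \<Rightarrow> real \<Rightarrow> (real ^ 'd::finite \<Rightarrow> real \<Rightarrow> real) \<Rightarrow>
    (real ^ 'd \<Rightarrow> real \<Rightarrow> real) \<Rightarrow> real ^ 'd \<Rightarrow> real \<Rightarrow> real" where
  "commutator h \<sigma> F F' x t =
     2 * mesh_cutoff' h \<sigma> x t * F' x t + mesh_cutoff'' h \<sigma> x t * F x t
     + (\<Sum>k\<in>UNIV. (mesh_cutoff h \<sigma> (fwd h k x) t - mesh_cutoff h \<sigma> x t) * (F (fwd h k x) t - F x t)
        + (mesh_cutoff h \<sigma> (bwd h k x) t - mesh_cutoff h \<sigma> x t) * (F (bwd h k x) t - F x t)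
        + (mesh_cutoff h \<sigma> (fwd h k x) t + mesh_cutoff h \<sigma> (bwd h k x) t
            - 2 * mesh_cutoff h \<sigma> x t) * F x t) / h\<^sup>2"

definition commutator_constant :: "real \<Rightarrow> real \<Rightarrow> real" where
  "commutator_constant d \<sigma> = 6 * (2 * L / \<sigma>\<^sup>2)\<^sup>2 * (1 + d)\<^sup>2"

lemma commutator_zero:
  assumes "0 < \<sigma>" "0 < h" "0 \<le> t" "t \<le> \<sigma>" "\<And>k. \<bar>x $ k\<bar> \<le> \<sigma> - h"
  shows "commutator h \<sigma> F F' x t = 0"
  unfolding commutator_def mesh_cutoff_flat[OF assms(1,2,5)] mesh_cutoff'_early[OF assms(1,3,4)] by simp

lemma commutator_zero_outside:
  fixes x :: "real ^ 'd::finite"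
  assumes "0 < \<sigma>" "0 < h" "2 * \<sigma> \<le> t \<or> x \<notin> mesh_box h (2 * \<sigma> + h)"
  shows "commutator h \<sigma> F F' x t = 0"
proof (cases "2 * \<sigma> \<le> t")
  case True
  show ?thesis unfolding commutator_def mesh_cutoff_late[OF assms(1) True] by simp
next
  case False
  then have x: "x \<notin> mesh_box h (2 * \<sigma> + h)" using assms(3) by blast
  then have m: "x \<notin> margin h (mesh_box h (2 * \<sigma> + h))" by (auto simp: margin_def)
  have p: "fwd h k x \<notin> margin h (mesh_box h (2 * \<sigma> + h))" for k
    using x margin_neighbours(1)[of x h "mesh_box h (2 * \<sigma> + h)" k] by blast
  have n: "bwd h k x \<notin> margin h (mesh_box h (2 * \<sigma> + h))" for k
    using x margin_neighbours(2)[of "bwd h k x" h "mesh_box h (2 * \<sigma> + h)" k] by auto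
  note z = mesh_cutoff_outside[OF assms(1,2) order_refl]
  show ?thesis unfolding commutator_def z[OF m] z(1)[OF p] z(1)[OF n] by simp
qed

text \<open>Wherever the commutator does not vanish, the cutoff on the scale \<open>4 \<sigma>\<close> equals \<open>1\<close> at the point and at its neighbours, so
  \<open>F\<close> may be replaced by the function to which \<open>caccioppoli\<close> applies.\<close>

lemma commutator_le:
  fixes F F' :: "real ^ 'd::finite \<Rightarrow> real \<Rightarrow> real"
  assumes \<sigma>: "0 < \<sigma>" "\<sigma> \<le> 1" and h: "0 < h" "h \<le> \<sigma> / 2" and t: "0 \<le> t"
  defines "y \<equiv> \<lambda>x. mesh_cutoff h (4 * \<sigma>) x t * F x t"
  shows "(commutator h \<sigma> F F' x t)\<^sup>2 \<le> commutator_constant (real CARD('d)) \<sigma> *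
    ((mesh_cutoff h (4 * \<sigma>) x t * F' x t + mesh_cutoff' h (4 * \<sigma>) x t * F x t)\<^sup>2 + (y x)\<^sup>2
      + (\<Sum>k\<in>UNIV. (y (fwd h k x) - y x)\<^sup>2 + (y x - y (bwd h k x))\<^sup>2) / h\<^sup>2)"
proof (cases "2 * \<sigma> \<le> t \<or> x \<notin> mesh_box h (2 * \<sigma> + h)")
  case True
  have "0 \<le> commutator_constant (real CARD('d)) \<sigma>" by (simp add: commutator_constant_def)
  then show ?thesis unfolding commutator_zero_outside[OF \<sigma>(1) h(1) True]
    by (auto intro!: mult_nonneg_nonneg add_nonneg_nonneg sum_nonneg divide_nonneg_nonneg)
next
  case False
  then have x: "x \<in> mesh_box h (2 * \<sigma> + h)" and t': "t \<le> 4 * \<sigma>" using \<sigma> by auto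
  have "x \<in> margin h (mesh_box h (4 * \<sigma>))"
    using mesh_box_margin[OF x, of "4 * \<sigma>"] h \<sigma> by simp
  then have nb: "x \<in> mesh_box h (4 * \<sigma>)" "fwd h k x \<in> mesh_box h (4 * \<sigma>)"
    "bwd h k x \<in> mesh_box h (4 * \<sigma>)" for k
    by (auto simp: margin_def)
  have \<sigma>4: "0 < 4 * \<sigma>" using \<sigma> by simp
  note one = mesh_cutoff_inner[OF \<sigma>4 _ t t']
  have y: "y x = F x t" "y (fwd h k x) = F (fwd h k x) t"
    "y (bwd h k x) = F (bwd h k x) t" for k
    unfolding y_def one(1)[OF nb(1)] one(1)[OF nb(2)] one(1)[OF nb(3)] by simp_all
  have y': "mesh_cutoff h (4 * \<sigma>) x t * F' x t + mesh_cutoff' h (4 * \<sigma>) x t * F x t = F' x t"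
    unfolding one[OF nb(1)] by simp
  have L0: "0 \<le> L" using bound(3) by simp
  have \<sigma>1: "\<sigma>\<^sup>2 \<le> \<sigma>" using \<sigma> by (simp add: power2_eq_square mult_left_le)
  then have Lle: "L / \<sigma> \<le> L / \<sigma>\<^sup>2" using \<sigma> L0 by (intro divide_left_mono) auto
  have L2: "L / \<sigma>\<^sup>2 \<le> 2 * L / \<sigma>\<^sup>2" using L0 \<sigma> by (simp add: divide_right_mono)
  note mb = mesh_cutoff_bounds[OF \<sigma>(1) h(1)]
  have "(2 * mesh_cutoff' h \<sigma> x t * F' x t + mesh_cutoff'' h \<sigma> x t * F x t
     + (\<Sum>k\<in>UNIV. (mesh_cutoff h \<sigma> (fwd h k x) t - mesh_cutoff h \<sigma> x t) * (F (fwd h k x) t - F x t)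
        + (mesh_cutoff h \<sigma> (bwd h k x) t - mesh_cutoff h \<sigma> x t) * (F (bwd h k x) t - F x t)
        + (mesh_cutoff h \<sigma> (fwd h k x) t + mesh_cutoff h \<sigma> (bwd h k x) t
            - 2 * mesh_cutoff h \<sigma> x t) * F x t) / h\<^sup>2)\<^sup>2
    \<le> 6 * (2 * L / \<sigma>\<^sup>2)\<^sup>2 * (1 + real CARD('d))\<^sup>2 * ((F' x t)\<^sup>2 + (F x t)\<^sup>2
      + (\<Sum>k\<in>UNIV. (F (fwd h k x) t - F x t)\<^sup>2 + (F (bwd h k x) t - F x t)\<^sup>2) / h\<^sup>2)"
  proof (rule commutator_square_le)
    show "0 \<le> 2 * L / \<sigma>\<^sup>2" using L0 by simp
    show "\<bar>2 * mesh_cutoff' h \<sigma> x t\<bar> \<le> 2 * L / \<sigma>\<^sup>2" using mb(2)[of x t] Lle by simp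
    show "\<bar>mesh_cutoff'' h \<sigma> x t\<bar> \<le> 2 * L / \<sigma>\<^sup>2" using mb(3)[of x t] L2 by linarith
    have Lh: "L / \<sigma> * h \<le> 2 * L / \<sigma>\<^sup>2 * h" using Lle L2 h by (intro mult_right_mono) auto
    show "\<bar>mesh_cutoff h \<sigma> (fwd h k x) t - mesh_cutoff h \<sigma> x t\<bar> \<le> 2 * L / \<sigma>\<^sup>2 * h" for k
      using mb(4)[of x k t] Lh by linarith
    show "\<bar>mesh_cutoff h \<sigma> (bwd h k x) t - mesh_cutoff h \<sigma> x t\<bar> \<le> 2 * L / \<sigma>\<^sup>2 * h" for k
      using mb(5)[of x k t] Lh by linarith
  qed (use h mb(6) in auto)
  then show ?thesis unfolding commutator_def commutator_constant_def y y'
    by (simp only: power2_commute[of "F x t"])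
qed

lemma cutoff_wave_operator:
  "mesh_cutoff h \<sigma> x t * F'' x t + 2 * mesh_cutoff' h \<sigma> x t * F' x t + mesh_cutoff'' h \<sigma> x t * F x t
    + discrete_laplacian h (\<lambda>y. mesh_cutoff h \<sigma> y t * F y t) x
   = mesh_cutoff h \<sigma> x t * (F'' x t + discrete_laplacian h (\<lambda>y. F y t) x) + commutator h \<sigma> F F' x t"
  unfolding laplacian_product commutator_def by (simp add: algebra_simps)

lemma commutator_bounded_measurable:
  assumes "0 < \<sigma>" "\<And>x. bounded_measurable T (F x)" "\<And>x. bounded_measurable T (F' x)"
  shows "bounded_measurable T (commutator h \<sigma> F F' x)"
proof -
  have m: "bounded_measurable T (mesh_cutoff h \<sigma> x)" "bounded_measurable T (mesh_cutoff' h \<sigma> x)"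
    "bounded_measurable T (mesh_cutoff'' h \<sigma> x)" for x
    using lipschitz_primitive_bounded_measurable[OF mesh_cutoff_primitive(1)[OF assms(1)]]
      lipschitz_primitive_bounded_measurable[OF mesh_cutoff_primitive(2)[OF assms(1)]] by auto
  show ?thesis unfolding commutator_def[abs_def] divide_inverse
    by (intro bounded_measurable_intros assms m)
qed

text \<open>The Caccioppoli inequality with the cutoff on the scale \<open>4 \<sigma>\<close>, whose support has a margin of one step inside the box
  of half width \<open>9 \<sigma>\<close>.\<close>

lemma integral_commutator_le:
  fixes F F' F'' :: "real ^ 'd::finite \<Rightarrow> real \<Rightarrow> real"
  assumes \<sigma>: "0 < \<sigma>" "\<sigma> \<le> 1" and h: "0 < h" "h \<le> \<sigma> / 2" and \<Lambda>: "0 \<le> \<Lambda>"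
    and F: "\<And>x. lipschitz_primitive (8 * \<sigma>) (F x) (F' x)" "\<And>x. lipschitz_primitive (8 * \<sigma>) (F' x) (F'' x)"
    and equation: "\<And>x t. x \<in> mesh h \<Longrightarrow> t \<in> {0..8 * \<sigma>} \<Longrightarrow>
      \<bar>F'' x t + discrete_laplacian h (\<lambda>y. F y t) x\<bar> \<le> \<Lambda> * \<bar>F x t\<bar>"
  defines "Q \<equiv> mesh_box h (9 * \<sigma>)"
  shows "integral {0..8 * \<sigma>} (\<lambda>t. \<Sum>x\<in>Q. (commutator h \<sigma> F F' x t)\<^sup>2) \<le>
    commutator_constant (real CARD('d)) \<sigma> *
      ((2 * ((L / \<sigma>)\<^sup>2 + \<Lambda> + real CARD('d) * (L / \<sigma>)\<^sup>2) + 1) * integral {0..8 * \<sigma>} (\<lambda>t. \<Sum>x\<in>Q. (F x t)\<^sup>2)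
        + 2 * (\<Sum>x\<in>Q. (F x 0)\<^sup>2 + (F' x 0)\<^sup>2))"
proof -
  define T where "T = 8 * \<sigma>"
  define Cc where "Cc = commutator_constant (real CARD('d)) \<sigma>"
  have Cc0: "0 \<le> Cc" by (simp add: Cc_def commutator_constant_def)
  have Q: "finite Q" unfolding Q_def by (rule finite_mesh_box[OF h(1)])
  define \<eta> where "\<eta> = (mesh_cutoff h (4 * \<sigma>) :: real ^ 'd \<Rightarrow> real \<Rightarrow> real)"
  define \<eta>' where "\<eta>' = (mesh_cutoff' h (4 * \<sigma>) :: real ^ 'd \<Rightarrow> real \<Rightarrow> real)"
  have \<sigma>4: "0 < 4 * \<sigma>" using \<sigma> by simp
  have \<eta>prim: "lipschitz_primitive T (\<eta> x) (\<eta>' x)" for x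
    unfolding \<eta>_def \<eta>'_def by (rule mesh_cutoff_primitive(1)[OF \<sigma>4])
  have out: "\<eta> x t = 0" if "x \<notin> margin h Q" for x t
    unfolding \<eta>_def by (rule mesh_cutoff_outside[OF \<sigma>4 h(1)]) (use that h \<sigma> in \<open>auto simp: Q_def\<close>)
  define D where "D t = (\<Sum>x\<in>Q. (\<eta> x t * F' x t + \<eta>' x t * F x t)\<^sup>2
        + (\<Sum>k\<in>UNIV. (\<eta> (fwd h k x) t * F (fwd h k x) t - \<eta> x t * F x t)\<^sup>2) / h\<^sup>2)" for t
  define N where "N t = (\<Sum>x\<in>Q. (F x t)\<^sup>2)" for t
  have L0: "0 \<le> L" using bound(3) by simp
  have L4: "L / (4 * \<sigma>) \<le> L / \<sigma>" using L0 \<sigma> by (simp add: field_simps)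
  have cac: "integral {0..T} D \<le> ((L / \<sigma>)\<^sup>2 + \<Lambda> + real CARD('d) * (L / \<sigma>)\<^sup>2) * integral {0..T} N
      + (\<Sum>x\<in>Q. (F x 0)\<^sup>2 + (F' x 0)\<^sup>2)"
    unfolding D_def N_def
  proof (rule caccioppoli[OF Q _ h(1) \<Lambda> _ _ \<eta>prim])
    show "0 \<le> T" using \<sigma> by (simp add: T_def)
    show "lipschitz_primitive T (F x) (F' x)" "lipschitz_primitive T (F' x) (F'' x)" for x
      unfolding T_def by (rule F)+
    show "\<eta> x T = 0" for x unfolding \<eta>_def by (rule mesh_cutoff_late[OF \<sigma>4]) (simp add: T_def)
    note mb = mesh_cutoff_bounds[OF \<sigma>4 h(1)]
    show "\<bar>\<eta> x t\<bar> \<le> 1" for x t unfolding \<eta>_def by (rule mb)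
    show "\<bar>\<eta>' x t\<bar> \<le> L / \<sigma>" for x t unfolding \<eta>'_def using mb(2)[of x t] L4 by linarith
    show "\<bar>\<eta> (fwd h k x) t - \<eta> x t\<bar> \<le> L / \<sigma> * h" for x k t
      unfolding \<eta>_def using mb(4)[of x k t] mult_right_mono[OF L4, of h] h by linarith
  qed (use equation out in \<open>auto simp: T_def Q_def mesh_box_def\<close>)
  have pointwise: "(\<Sum>x\<in>Q. (commutator h \<sigma> F F' x t)\<^sup>2) \<le> Cc * (2 * D t + N t)" if t: "t \<in> {0..T}" for t
  proof -
    define y where "y x = \<eta> x t * F x t" for x
    define y' where "y' x = \<eta> x t * F' x t + \<eta>' x t * F x t" for x
    have "(\<Sum>x\<in>Q. (commutator h \<sigma> F F' x t)\<^sup>2) \<le> (\<Sum>x\<in>Q. Cc * ((y' x)\<^sup>2 + (y x)\<^sup>2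
      + (\<Sum>k\<in>UNIV. (y (fwd h k x) - y x)\<^sup>2 + (y x - y (bwd h k x))\<^sup>2) / h\<^sup>2))"
      unfolding y_def y'_def \<eta>_def \<eta>'_def Cc_def
      using t by (intro sum_mono commutator_le \<sigma> h) auto
    also have "\<dots> = Cc * ((\<Sum>x\<in>Q. (y' x)\<^sup>2) + (\<Sum>x\<in>Q. (y x)\<^sup>2)
      + (\<Sum>k\<in>UNIV. (\<Sum>x\<in>Q. (y (fwd h k x) - y x)\<^sup>2) + (\<Sum>x\<in>Q. (y x - y (bwd h k x))\<^sup>2)) / h\<^sup>2)"
      unfolding sum_distrib_left[symmetric] sum.distrib[of _ _ Q] sum_divide_distrib[of _ Q, symmetric]
        sum.swap[of _ _ Q]
      by (simp add: sum.distrib)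
    also have "\<dots> = Cc * ((\<Sum>x\<in>Q. (y' x)\<^sup>2) + (\<Sum>x\<in>Q. (y x)\<^sup>2)
      + 2 * ((\<Sum>k\<in>UNIV. \<Sum>x\<in>Q. (y (fwd h k x) - y x)\<^sup>2) / h\<^sup>2))"
    proof -
      have "y x \<noteq> 0 \<Longrightarrow> x \<in> margin h Q" for x using out[of x t] by (auto simp: y_def)
      from sum_backward_difference[OF Q this] show ?thesis by (simp add: sum.distrib sum_distrib_left[symmetric])
    qed
    also have "\<dots> \<le> Cc * (2 * D t + N t)"
    proof (rule mult_left_mono[OF _ Cc0])
      have "D t = (\<Sum>x\<in>Q. (y' x)\<^sup>2) + (\<Sum>k\<in>UNIV. \<Sum>x\<in>Q. (y (fwd h k x) - y x)\<^sup>2) / h\<^sup>2"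
        unfolding D_def y_def y'_def sum.distrib sum_divide_distrib[symmetric] by (subst sum.swap) (rule refl)
      moreover have "(\<Sum>x\<in>Q. (y x)\<^sup>2) \<le> N t" unfolding N_def
      proof (rule sum_mono)
        fix x
        have "\<bar>y x\<bar> \<le> \<bar>F x t\<bar>"
          using mesh_cutoff_bounds(1)[OF \<sigma>4 h(1), of x t] unfolding y_def \<eta>_def abs_mult
          by (simp add: mult_left_le_one_le)
        then show "(y x)\<^sup>2 \<le> (F x t)\<^sup>2" by (simp add: abs_le_square_iff)
      qed
      moreover have "0 \<le> (\<Sum>x\<in>Q. (y' x)\<^sup>2)" by (intro sum_nonneg) auto
      ultimately show "(\<Sum>x\<in>Q. (y' x)\<^sup>2) + (\<Sum>x\<in>Q. (y x)\<^sup>2)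
        + 2 * ((\<Sum>k\<in>UNIV. \<Sum>x\<in>Q. (y (fwd h k x) - y x)\<^sup>2) / h\<^sup>2) \<le> 2 * D t + N t" by linarith
    qed
    finally show ?thesis .
  qed
  have Fbm: "bounded_measurable T (F x)" "bounded_measurable T (F' x)" for x
    using lipschitz_primitive_bounded_measurable[OF F(1)[of x]] by (auto simp: T_def)
  have \<eta>bm: "bounded_measurable T (\<eta> x)" "bounded_measurable T (\<eta>' x)" for x
    using lipschitz_primitive_bounded_measurable[OF \<eta>prim[of x]] by auto
  have D_bm: "bounded_measurable T D"
    unfolding D_def[abs_def] divide_inverse by (intro bounded_measurable_intros Fbm \<eta>bm)
  have N_bm: "bounded_measurable T N" unfolding N_def[abs_def] by (intro bounded_measurable_intros Fbm)
  have "integral {0..T} (\<lambda>t. \<Sum>x\<in>Q. (commutator h \<sigma> F F' x t)\<^sup>2) \<le> integral {0..T} (\<lambda>t. Cc * (2 * D t + N t))"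
    by (intro integral_le pointwise bounded_measurable_integrable bounded_measurable_intros D_bm N_bm
        commutator_bounded_measurable \<sigma> Fbm)
  also have "\<dots> = Cc * (2 * integral {0..T} D + integral {0..T} N)"
  proof -
    have "integral {0..T} (\<lambda>t. 2 * D t + N t) = 2 * integral {0..T} D + integral {0..T} N"
      using bounded_measurable_integrable[OF D_bm] bounded_measurable_integrable[OF N_bm]
        bounded_measurable_integrable[OF bounded_measurable_cmult[OF D_bm], of 2]
      by (subst integral_add) auto
    then show ?thesis by simp
  qed
  also have "\<dots> \<le> Cc * ((2 * ((L / \<sigma>)\<^sup>2 + \<Lambda> + real CARD('d) * (L / \<sigma>)\<^sup>2) + 1) * integral {0..T} N
        + 2 * (\<Sum>x\<in>Q. (F x 0)\<^sup>2 + (F' x 0)\<^sup>2))"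
    using cac by (intro mult_left_mono[OF _ Cc0]) (simp add: algebra_simps)
  finally show ?thesis unfolding T_def N_def Cc_def .
qed

end

section \<open>The estimate with a free large parameter\<close>

context cutoff_profile
begin

text \<open>On the support of the commutator either \<open>t > \<rho>\<close> or some \<open>|x\<^sub>k| > \<rho> / 2\<close>; in both cases
  \<open>2 \<phi> \<le> A - 2 \<kappa>\<close> with \<open>\<kappa> = \<rho>\<^sup>2 / 8\<close>.  On the half ball of radius \<open>r\<^sub>0\<close>, which is chosen so that \<open>3 A r\<^sub>0 = \<kappa>\<close>, one has
  \<open>2 \<phi> \<ge> A - \<kappa>\<close>, while \<open>2 \<phi> \<le> A\<close> on \<open>t = 0\<close>.  The lower bound for \<open>\<tau>\<close> absorbs the potential.\<close>

lemma local_estimate: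
  fixes F F' F'' :: "real ^ 'd::finite \<Rightarrow> real \<Rightarrow> real" and \<rho> A r\<^sub>0 h \<tau> \<Lambda> :: real
  assumes \<rho>: "\<rho> = 1 / (20 * (1 + real CARD('d)))" and A: "A = 4 + 48 * real CARD('d)"
    and r0: "r\<^sub>0 = \<rho>\<^sup>2 / (24 * A)" and h: "0 < h" "h \<le> \<rho> / 2" and \<Lambda>: "0 \<le> \<Lambda>"
    and \<tau>: "1 + 4 * \<Lambda>\<^sup>2 \<le> \<tau>" "\<tau> * h \<le> 1"
    and F: "\<And>x. lipschitz_primitive (8 * \<rho>) (F x) (F' x)" "\<And>x. lipschitz_primitive (8 * \<rho>) (F' x) (F'' x)"
    and equation: "\<And>x t. x \<in> mesh h \<Longrightarrow> t \<in> {0..8 * \<rho>} \<Longrightarrow>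
      \<bar>F'' x t + discrete_laplacian h (\<lambda>y. F y t) x\<bar> \<le> \<Lambda> * \<bar>F x t\<bar>"
  defines "Q \<equiv> mesh_box h (9 * \<rho>)"
  shows "integral {0..r\<^sub>0} (\<lambda>t. \<Sum>x\<in>{x \<in> Q. norm x < r\<^sub>0}. (F x t)\<^sup>2) \<le>
    (4 * commutator_constant (real CARD('d)) \<rho> * (2 * ((L / \<rho>)\<^sup>2 + \<Lambda> + real CARD('d) * (L / \<rho>)\<^sup>2) + 3)
      + 128 * A ^ 5) *
    (exp (- (\<rho>\<^sup>2 / 8 * \<tau>)) * integral {0..8 * \<rho>} (\<lambda>t. \<Sum>x\<in>Q. (F x t)\<^sup>2)
      + exp ((\<rho>\<^sup>2 / 8 + 1) * \<tau>) * (\<Sum>x\<in>Q. (F x 0)\<^sup>2 + (F' x 0)\<^sup>2))"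
proof -
  define d where "d = real CARD('d)"
  define T where "T = 8 * \<rho>"
  define \<kappa> where "\<kappa> = \<rho>\<^sup>2 / 8"
  define Cc where "Cc = commutator_constant d \<rho>"
  define Cac where "Cac = (L / \<rho>)\<^sup>2 + \<Lambda> + d * (L / \<rho>)\<^sup>2"
  define N where "N t = (\<Sum>x\<in>Q. (F x t)\<^sup>2)" for t
  define B where "B = (\<Sum>x\<in>Q. (F x 0)\<^sup>2 + (F' x 0)\<^sup>2)"
  define Com where "Com t = (\<Sum>x\<in>Q. (commutator h \<rho> F F' x t)\<^sup>2)" for t
  have d1: "1 \<le> d" unfolding d_def by (simp add: Suc_leI)
  have \<rho>0: "0 < \<rho>" "\<rho> \<le> 1 / 40" unfolding \<rho> using d1 by (auto simp: d_def[symmetric] field_simps)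
  have A4: "4 \<le> A" unfolding A by simp
  have \<tau>1: "1 \<le> \<tau>" using \<tau>(1) zero_le_power2[of \<Lambda>] by linarith
  have r00: "0 < r\<^sub>0" "r\<^sub>0 \<le> \<rho>" "3 * A * r\<^sub>0 = \<kappa>"
  proof -
    have "\<rho>\<^sup>2 \<le> \<rho> * 1" using \<rho>0 unfolding power2_eq_square by (intro mult_left_mono) auto
    moreover have "\<rho> * 1 \<le> \<rho> * (24 * A)" using \<rho>0 A4 by (intro mult_left_mono) auto
    ultimately show "r\<^sub>0 \<le> \<rho>" unfolding r0 using A4 by (simp add: field_simps)
  qed (use \<rho>0 A4 in \<open>auto simp: r0 \<kappa>_def field_simps\<close>)
  have Q: "finite Q" unfolding Q_def by (rule finite_mesh_box[OF h(1)])
  have Cc0: "0 \<le> Cc" by (simp add: Cc_def commutator_constant_def)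
  have Cac0: "0 \<le> Cac" using \<Lambda> d1 by (simp add: Cac_def)
  have T: "0 \<le> T" "T \<le> 1 / 2" using \<rho>0 by (auto simp: T_def)
  have F: "lipschitz_primitive T (F x) (F' x)" "lipschitz_primitive T (F' x) (F'' x)" for x
    unfolding T_def by (rule F)+
  define \<psi> where "\<psi> = (mesh_cutoff h \<rho> :: real ^ 'd \<Rightarrow> real \<Rightarrow> real)"
  define \<psi>' where "\<psi>' = (mesh_cutoff' h \<rho> :: real ^ 'd \<Rightarrow> real \<Rightarrow> real)"
  define \<psi>'' where "\<psi>'' = (mesh_cutoff'' h \<rho> :: real ^ 'd \<Rightarrow> real \<Rightarrow> real)"
  have \<psi>prim: "lipschitz_primitive T (\<psi> x) (\<psi>' x)" "lipschitz_primitive T (\<psi>' x) (\<psi>'' x)" for x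
    unfolding \<psi>_def \<psi>'_def \<psi>''_def by (rule mesh_cutoff_primitive[OF \<rho>0(1)])+
  have \<psi>1: "\<bar>\<psi> x t\<bar> \<le> 1" for x t unfolding \<psi>_def by (rule mesh_cutoff_bounds(1)[OF \<rho>0(1) h(1)])
  have \<psi>_out: "\<psi> x t = 0" "\<psi>' x t = 0" if "x \<notin> margin h Q" for x t
    unfolding \<psi>_def \<psi>'_def
    by (rule mesh_cutoff_outside[OF \<rho>0(1) h(1)], use that h \<rho>0 in \<open>auto simp: Q_def\<close>)+
  define z where "z x t = \<psi> x t * F x t" for x t
  define z' where "z' x t = \<psi> x t * F' x t + \<psi>' x t * F x t" for x t
  define z'' where "z'' x t = \<psi> x t * F'' x t + 2 * \<psi>' x t * F' x t + \<psi>'' x t * F x t" for x t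
  have z_prim: "lipschitz_primitive T (z x) (z' x)" for x
    by (rule lipschitz_primitive_cong[OF lipschitz_primitive_mult[OF \<psi>prim(1)[of x] F(1)[of x]]])
      (auto simp: z_def z'_def)
  have z'_prim: "lipschitz_primitive T (z' x) (z'' x)" for x
    by (rule lipschitz_primitive_cong[OF lipschitz_primitive_add[OF
          lipschitz_primitive_mult[OF \<psi>prim(1)[of x] F(2)[of x]]
          lipschitz_primitive_mult[OF \<psi>prim(2)[of x] F(1)[of x]]]])
      (auto simp: z'_def z''_def algebra_simps)
  define w where "w = (carleman_weight A \<tau> :: real ^ 'd \<Rightarrow> real \<Rightarrow> real)"
  define W where "W t = (\<Sum>x\<in>Q. (w x t * z x t)\<^sup>2)" for t
  define G where "G x t = z'' x t + discrete_laplacian h (\<lambda>y. z y t) x" for x t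
  have w2: "(w x t)\<^sup>2 = exp (\<tau> * (A * (1 - t)\<^sup>2 - (norm x)\<^sup>2))" for x t
    unfolding w_def carleman_weight_def by (simp add: power2_eq_square flip: exp_add)
  have carleman: "\<tau> ^ 3 * integral {0..T} W \<le> integral {0..T} (\<lambda>t. \<Sum>x\<in>Q. (w x t * G x t)\<^sup>2)
      + 8 * A ^ 3 * \<tau> ^ 3 * (\<Sum>x\<in>Q. (w x 0 * z x 0)\<^sup>2 + (w x 0 * (z' x 0 - \<tau> * A * z x 0))\<^sup>2)"
    unfolding W_def G_def w_def
  proof (rule carleman_estimate[OF Q T])
    show "z x t = 0" "z' x t = 0" if "x \<notin> margin h Q" for x t
      using \<psi>_out[OF that] by (auto simp: z_def z'_def)
    show "\<bar>x $ k\<bar> + h / 2 \<le> 1" if "x \<in> margin h Q" for x k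
    proof -
      have "\<bar>x $ k\<bar> \<le> 9 * \<rho>" using that by (auto simp: margin_def Q_def mesh_box_def)
      then show ?thesis using h \<rho>0 by linarith
    qed
    show "z x T = 0" "z' x T = 0" for x
      unfolding z_def z'_def \<psi>_def \<psi>'_def T_def using \<rho>0 by (auto simp: mesh_cutoff_late)
  qed (use h \<rho>0 \<tau> \<tau>1 A z_prim z'_prim in auto)
  have pointwise: "(\<Sum>x\<in>Q. (w x t * G x t)\<^sup>2) \<le> 2 * \<Lambda>\<^sup>2 * W t + 2 * exp (\<tau> * (A - 2 * \<kappa>)) * Com t"
    if t: "t \<in> {0..T}" for t
    unfolding W_def Com_def sum_distrib_left sum.distrib[symmetric]
  proof (rule sum_mono)
    fix x assume x: "x \<in> Q"
    define c where "c = commutator h \<rho> F F' x t"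
    define e where "e = \<psi> x t * (F'' x t + discrete_laplacian h (\<lambda>y. F y t) x)"
    have G: "G x t = e + c"
      unfolding G_def z''_def z_def e_def c_def \<psi>_def \<psi>'_def \<psi>''_def by (rule cutoff_wave_operator)
    have e: "e\<^sup>2 \<le> \<Lambda>\<^sup>2 * (z x t)\<^sup>2"
    proof -
      have "\<bar>e\<bar> \<le> \<bar>\<psi> x t\<bar> * (\<Lambda> * \<bar>F x t\<bar>)"
        unfolding e_def abs_mult using x t
        by (intro mult_left_mono equation) (auto simp: Q_def mesh_box_def T_def)
      also have "\<dots> = \<Lambda> * \<bar>z x t\<bar>" by (simp add: z_def abs_mult)
      finally have "e\<^sup>2 \<le> (\<Lambda> * \<bar>z x t\<bar>)\<^sup>2" by (rule square_le_if_abs_le)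
      then show ?thesis by (simp add: power_mult_distrib)
    qed
    have c: "(w x t)\<^sup>2 * c\<^sup>2 \<le> exp (\<tau> * (A - 2 * \<kappa>)) * c\<^sup>2"
    proof (cases "c = 0")
      case False
      then have "\<not> (t \<le> \<rho> \<and> (\<forall>k. \<bar>x $ k\<bar> \<le> \<rho> - h))"
        using commutator_zero[OF \<rho>0(1) h(1), of t x F F'] t unfolding c_def by auto
      then consider "\<rho> < t" | k where "\<rho> - h < \<bar>x $ k\<bar>" by (meson not_le)
      then have "A * (1 - t)\<^sup>2 - (norm x)\<^sup>2 \<le> A - 2 * \<kappa>"
      proof cases
        case 1
        have t1: "t \<le> 1" using t T by auto
        have "(1 - t)\<^sup>2 \<le> 1 - t" using t t1 unfolding power2_eq_square by (intro mult_left_le) auto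
        then have "A * (1 - t)\<^sup>2 \<le> A * (1 - \<rho>)" using 1 A4 by (intro mult_left_mono) auto
        moreover have "2 * \<kappa> \<le> A * \<rho>"
        proof -
          have "\<rho>\<^sup>2 \<le> \<rho>" using \<rho>0 unfolding power2_eq_square by (intro mult_left_le) auto
          moreover have "4 * \<rho> \<le> A * \<rho>" using A4 \<rho>0 by (intro mult_right_mono) auto
          ultimately show ?thesis using \<rho>0 unfolding \<kappa>_def by linarith
        qed
        moreover have "0 \<le> (norm x)\<^sup>2" by simp
        ultimately show ?thesis unfolding right_diff_distrib mult_1_right by linarith
      next
        case 2
        then have "\<rho> / 2 \<le> \<bar>x $ k\<bar>" using h by linarith
        also have "\<bar>x $ k\<bar> \<le> norm x" by (rule component_le_norm_cart)
        finally have "(\<rho> / 2)\<^sup>2 \<le> (norm x)\<^sup>2" using \<rho>0 by (intro power_mono) auto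
        moreover have "A * (1 - t)\<^sup>2 \<le> A * 1" using t T A4 by (intro mult_left_mono power_le_one) auto
        ultimately show ?thesis by (simp add: \<kappa>_def power_divide)
      qed
      then have "(w x t)\<^sup>2 \<le> exp (\<tau> * (A - 2 * \<kappa>))" unfolding w2 using \<tau>1 by simp
      then show ?thesis by (intro mult_right_mono) auto
    qed simp
    have "(w x t * G x t)\<^sup>2 \<le> (w x t)\<^sup>2 * (2 * e\<^sup>2 + 2 * c\<^sup>2)"
      unfolding G power_mult_distrib by (intro mult_left_mono power2_sum_le) auto
    also have "\<dots> = 2 * ((w x t)\<^sup>2 * e\<^sup>2) + 2 * ((w x t)\<^sup>2 * c\<^sup>2)" by (simp add: algebra_simps)
    also have "\<dots> \<le> 2 * ((w x t)\<^sup>2 * (\<Lambda>\<^sup>2 * (z x t)\<^sup>2)) + 2 * (exp (\<tau> * (A - 2 * \<kappa>)) * c\<^sup>2)"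
      using e c by (intro add_mono mult_left_mono) auto
    finally show "(w x t * G x t)\<^sup>2 \<le> 2 * \<Lambda>\<^sup>2 * (w x t * z x t)\<^sup>2
        + 2 * exp (\<tau> * (A - 2 * \<kappa>)) * (commutator h \<rho> F F' x t)\<^sup>2"
      by (simp add: c_def power_mult_distrib algebra_simps)
  qed
  have Fbm: "bounded_measurable T (F x)" "bounded_measurable T (F' x)" "bounded_measurable T (F'' x)" for x
    using lipschitz_primitive_bounded_measurable[OF F(1)[of x]]
      lipschitz_primitive_bounded_measurable[OF F(2)[of x]] by auto
  have zbm: "bounded_measurable T (z x)" "bounded_measurable T (z'' x)" for x
    using lipschitz_primitive_bounded_measurable[OF z_prim[of x]]
      lipschitz_primitive_bounded_measurable[OF z'_prim[of x]] by auto
  have wbm: "bounded_measurable T (w x)" for x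
    unfolding w_def carleman_weight_def by (intro bounded_measurable_continuous continuous_intros) auto
  have Wbm: "bounded_measurable T W"
    unfolding W_def[abs_def] by (intro bounded_measurable_intros wbm zbm)
  have Gbm: "bounded_measurable T (\<lambda>t. \<Sum>x\<in>Q. (w x t * G x t)\<^sup>2)"
    unfolding G_def discrete_laplacian_def divide_inverse by (intro bounded_measurable_intros wbm zbm)
  have Cbm: "bounded_measurable T Com"
    unfolding Com_def[abs_def]
    by (intro bounded_measurable_intros commutator_bounded_measurable \<rho>0 Fbm)
  have Nbm: "bounded_measurable T N"
    unfolding N_def[abs_def] by (intro bounded_measurable_intros Fbm)
  have "integral {0..T} (\<lambda>t. \<Sum>x\<in>Q. (w x t * G x t)\<^sup>2) \<le>
      integral {0..T} (\<lambda>t. 2 * \<Lambda>\<^sup>2 * W t + 2 * exp (\<tau> * (A - 2 * \<kappa>)) * Com t)"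
    by (intro integral_le pointwise bounded_measurable_integrable Gbm bounded_measurable_intros Wbm Cbm)
  also have "\<dots> = 2 * \<Lambda>\<^sup>2 * integral {0..T} W + 2 * exp (\<tau> * (A - 2 * \<kappa>)) * integral {0..T} Com"
    using bounded_measurable_integrable[OF bounded_measurable_cmult[OF Wbm], of "2 * \<Lambda>\<^sup>2"]
      bounded_measurable_integrable[OF bounded_measurable_cmult[OF Cbm], of "2 * exp (\<tau> * (A - 2 * \<kappa>))"]
    by (subst integral_add) auto
  finally have source: "integral {0..T} (\<lambda>t. \<Sum>x\<in>Q. (w x t * G x t)\<^sup>2) \<le>
      2 * \<Lambda>\<^sup>2 * integral {0..T} W + 2 * exp (\<tau> * (A - 2 * \<kappa>)) * integral {0..T} Com" .
  have boundary: "(\<Sum>x\<in>Q. (w x 0 * z x 0)\<^sup>2 + (w x 0 * (z' x 0 - \<tau> * A * z x 0))\<^sup>2)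
      \<le> exp (\<tau> * A) * (4 * (\<tau> * A)\<^sup>2) * B"
    unfolding B_def sum_distrib_left
  proof (rule sum_mono)
    fix x
    have z'0: "z' x 0 = \<psi> x 0 * F' x 0"
      unfolding z'_def \<psi>'_def using mesh_cutoff'_early(1)[OF \<rho>0(1), where t = 0 and x = x and h = h] \<rho>0 by simp
    have psi2: "(\<psi> x 0)\<^sup>2 \<le> 1" using \<psi>1[of x 0] by (simp add: abs_square_le_1)
    have w2': "(w x 0)\<^sup>2 \<le> exp (\<tau> * A)" unfolding w2 using \<tau>1 by simp
    have tA: "1 \<le> (\<tau> * A)\<^sup>2"
      using \<tau>1 A4 mult_mono[of 1 \<tau> 1 A] by (intro one_le_power) auto
    have "(F x 0)\<^sup>2 + (F' x 0 - \<tau> * A * F x 0)\<^sup>2 \<le> (F x 0)\<^sup>2 + (2 * (F' x 0)\<^sup>2 + 2 * (\<tau> * A * F x 0)\<^sup>2)"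
      using power2_sum_le[of "F' x 0" "- (\<tau> * A * F x 0)"] by simp
    also have "\<dots> = (1 + 2 * (\<tau> * A)\<^sup>2) * (F x 0)\<^sup>2 + 2 * (F' x 0)\<^sup>2"
      by (simp add: power_mult_distrib algebra_simps)
    also have "\<dots> \<le> (4 * (\<tau> * A)\<^sup>2) * (F x 0)\<^sup>2 + (4 * (\<tau> * A)\<^sup>2) * (F' x 0)\<^sup>2"
      using tA by (intro add_mono mult_right_mono) auto
    finally have f: "(F x 0)\<^sup>2 + (F' x 0 - \<tau> * A * F x 0)\<^sup>2 \<le> (4 * (\<tau> * A)\<^sup>2) * ((F x 0)\<^sup>2 + (F' x 0)\<^sup>2)"
      by (simp add: algebra_simps)
    have "(w x 0 * z x 0)\<^sup>2 + (w x 0 * (z' x 0 - \<tau> * A * z x 0))\<^sup>2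
        = ((w x 0)\<^sup>2 * (\<psi> x 0)\<^sup>2) * ((F x 0)\<^sup>2 + (F' x 0 - \<tau> * A * F x 0)\<^sup>2)"
      unfolding z'0 z_def by (simp add: power2_eq_square algebra_simps)
    also have "\<dots> \<le> (exp (\<tau> * A) * 1) * ((4 * (\<tau> * A)\<^sup>2) * ((F x 0)\<^sup>2 + (F' x 0)\<^sup>2))"
      using w2' psi2 f by (intro mult_mono) auto
    finally show "(w x 0 * z x 0)\<^sup>2 + (w x 0 * (z' x 0 - \<tau> * A * z x 0))\<^sup>2
        \<le> exp (\<tau> * A) * (4 * (\<tau> * A)\<^sup>2) * ((F x 0)\<^sup>2 + (F' x 0)\<^sup>2)" by (simp add: mult.assoc)
  qed
  have B0: "0 \<le> B" unfolding B_def by (intro sum_nonneg) auto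
  have W0: "0 \<le> integral {0..T} W" unfolding W_def[abs_def]
    by (intro Henstock_Kurzweil_Integration.integral_nonneg bounded_measurable_integrable Wbm[unfolded W_def[abs_def]] sum_nonneg) auto
  have C0: "0 \<le> integral {0..T} Com" unfolding Com_def[abs_def]
    by (intro Henstock_Kurzweil_Integration.integral_nonneg bounded_measurable_integrable Cbm[unfolded Com_def[abs_def]] sum_nonneg) auto
  have N0: "0 \<le> integral {0..T} N" unfolding N_def[abs_def]
    by (intro Henstock_Kurzweil_Integration.integral_nonneg bounded_measurable_integrable Nbm[unfolded N_def[abs_def]] sum_nonneg) auto
  have \<tau>3: "1 \<le> \<tau> ^ 3" "\<tau> \<le> \<tau> ^ 3" using \<tau>1 power_increasing[of 1 3 \<tau>] by (auto intro: one_le_power)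
  have mainW: "integral {0..T} W \<le> 4 * exp (\<tau> * (A - 2 * \<kappa>)) * integral {0..T} Com
      + 64 * A ^ 5 * \<tau>\<^sup>2 * exp (\<tau> * A) * B"
  proof -
    have b': "8 * A ^ 3 * \<tau> ^ 3 * (\<Sum>x\<in>Q. (w x 0 * z x 0)\<^sup>2 + (w x 0 * (z' x 0 - \<tau> * A * z x 0))\<^sup>2)
        \<le> 8 * A ^ 3 * \<tau> ^ 3 * (exp (\<tau> * A) * (4 * (\<tau> * A)\<^sup>2) * B)"
      using boundary A4 \<tau>1 by (intro mult_left_mono) auto
    \<comment> \<open>The potential takes at most half of the left side, since \<open>4 \<Lambda>\<^sup>2 \<le> \<tau> \<le> \<tau>\<^sup>3\<close>.\<close>
    have "\<tau> ^ 3 / 2 * integral {0..T} W \<le> (\<tau> ^ 3 - 2 * \<Lambda>\<^sup>2) * integral {0..T} W"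
      using \<tau>(1) \<tau>3 W0 by (intro mult_right_mono) auto
    also have "\<dots> \<le> 2 * exp (\<tau> * (A - 2 * \<kappa>)) * integral {0..T} Com
        + 8 * A ^ 3 * \<tau> ^ 3 * (exp (\<tau> * A) * (4 * (\<tau> * A)\<^sup>2) * B)"
      using carleman source b' unfolding left_diff_distrib by linarith
    also have "\<dots> \<le> \<tau> ^ 3 * (2 * exp (\<tau> * (A - 2 * \<kappa>)) * integral {0..T} Com)
        + 8 * A ^ 3 * \<tau> ^ 3 * (exp (\<tau> * A) * (4 * (\<tau> * A)\<^sup>2) * B)"
      using mult_right_mono[OF \<tau>3(1), of "2 * exp (\<tau> * (A - 2 * \<kappa>)) * integral {0..T} Com"] C0 by simp
    also have "\<dots> = \<tau> ^ 3 / 2 * (4 * exp (\<tau> * (A - 2 * \<kappa>)) * integral {0..T} Com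
        + 64 * A ^ 5 * \<tau>\<^sup>2 * exp (\<tau> * A) * B)"
      by (simp add: algebra_simps power_numeral_reduce)
    finally show ?thesis using \<tau>1 by (simp only: mult_le_cancel_left_pos zero_less_power half_gt_zero)
  qed
  define m where "m = integral {0..r\<^sub>0} (\<lambda>t. \<Sum>x\<in>{x \<in> Q. norm x < r\<^sub>0}. (F x t)\<^sup>2)"
  have lower: "exp (\<tau> * (A - \<kappa>)) * m \<le> integral {0..T} W"
  proof -
    have sub: "{0..r\<^sub>0} \<subseteq> {0..T}" using r00 \<rho>0 by (auto simp: T_def)
    have i1: "(\<lambda>t. exp (\<tau> * (A - \<kappa>)) * (\<Sum>x\<in>{x \<in> Q. norm x < r\<^sub>0}. (F x t)\<^sup>2)) integrable_on {0..r\<^sub>0}"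
      by (rule integrable_on_subinterval[OF bounded_measurable_integrable sub])
        (intro bounded_measurable_intros Fbm)
    have i2: "W integrable_on {0..r\<^sub>0}"
      by (rule integrable_on_subinterval[OF bounded_measurable_integrable[OF Wbm] sub])
    have "exp (\<tau> * (A - \<kappa>)) * m = integral {0..r\<^sub>0} (\<lambda>t. exp (\<tau> * (A - \<kappa>)) * (\<Sum>x\<in>{x \<in> Q. norm x < r\<^sub>0}. (F x t)\<^sup>2))"
      unfolding m_def by simp
    also have "\<dots> \<le> integral {0..r\<^sub>0} W"
    proof (rule integral_le[OF i1 i2])
      fix t assume t: "t \<in> {0..r\<^sub>0}"
      have "exp (\<tau> * (A - \<kappa>)) * (\<Sum>x\<in>{x \<in> Q. norm x < r\<^sub>0}. (F x t)\<^sup>2) \<le> (\<Sum>x\<in>{x \<in> Q. norm x < r\<^sub>0}. (w x t * z x t)\<^sup>2)"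
        unfolding sum_distrib_left
      proof (rule sum_mono)
        fix x assume x: "x \<in> {x \<in> Q. norm x < r\<^sub>0}"
        have "\<bar>x $ k\<bar> \<le> \<rho>" for k using component_le_norm_cart[of x k] x r00 by auto
        then have "x \<in> mesh_box h \<rho>" using x by (auto simp: mesh_box_def Q_def)
        then have "\<psi> x t = 1" unfolding \<psi>_def using t r00 by (intro mesh_cutoff_inner \<rho>0) auto
        then have z: "z x t = F x t" by (simp add: z_def)
        have "A - \<kappa> \<le> A * (1 - t)\<^sup>2 - (norm x)\<^sup>2"
        proof -
          have "(norm x)\<^sup>2 \<le> r\<^sub>0\<^sup>2" using x by (intro power_mono) auto
          also have "\<dots> \<le> r\<^sub>0" using r00 \<rho>0 unfolding power2_eq_square by (intro mult_left_le) auto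
          also have "r\<^sub>0 \<le> A * r\<^sub>0" using A4 r00 by simp
          finally have 1: "(norm x)\<^sup>2 \<le> A * r\<^sub>0" .
          have "(1 - t)\<^sup>2 = 1 - 2 * t + t\<^sup>2" by (simp add: power2_diff)
          moreover have "0 \<le> t\<^sup>2" "t \<le> r\<^sub>0" using t by auto
          ultimately have "1 - 2 * r\<^sub>0 \<le> (1 - t)\<^sup>2" by linarith
          then have "A * (1 - 2 * r\<^sub>0) \<le> A * (1 - t)\<^sup>2" using A4 by (intro mult_left_mono) auto
          then have "A - 2 * (A * r\<^sub>0) \<le> A * (1 - t)\<^sup>2" by (simp add: algebra_simps)
          with 1 r00(3) show ?thesis by simp
        qed
        then have "exp (\<tau> * (A - \<kappa>)) \<le> (w x t)\<^sup>2" unfolding w2 using \<tau>1 by simp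
        then show "exp (\<tau> * (A - \<kappa>)) * (F x t)\<^sup>2 \<le> (w x t * z x t)\<^sup>2"
          unfolding z power_mult_distrib by (intro mult_right_mono) auto
      qed
      also have "\<dots> \<le> W t" unfolding W_def by (intro sum_mono2 Q) auto
      finally show "exp (\<tau> * (A - \<kappa>)) * (\<Sum>x\<in>{x \<in> Q. norm x < r\<^sub>0}. (F x t)\<^sup>2) \<le> W t" .
    qed
    also have "\<dots> \<le> integral {0..T} W"
      by (rule integral_subset_le[OF sub i2 bounded_measurable_integrable[OF Wbm]])
        (auto simp: W_def intro: sum_nonneg)
    finally show ?thesis .
  qed
  have com: "integral {0..T} Com \<le> Cc * ((2 * Cac + 1) * integral {0..T} N + 2 * B)"
    unfolding T_def Com_def N_def B_def Cc_def Cac_def d_def Q_def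
    by (rule integral_commutator_le[OF \<rho>0(1) _ h \<Lambda> assms(9,10) equation]) (use \<rho>0 in auto)
  have \<tau>2: "\<tau>\<^sup>2 \<le> 2 * exp \<tau>" using exp_lower_Taylor_quadratic[of \<tau>] \<tau>1 by simp
  define eN where "eN = exp (- (\<kappa> * \<tau>))"
  define eP where "eP = exp ((\<kappa> + 1) * \<tau>)"
  have e01: "0 < eN" "0 < eP" "eN \<le> eP"
    unfolding eN_def eP_def using \<tau>1 \<rho>0 by (auto simp: \<kappa>_def algebra_simps intro: order_trans[of _ 0])
  define P where "P = Cc * ((2 * Cac + 1) * integral {0..T} N + 2 * B)"
  have "exp (\<tau> * (A - \<kappa>)) * m \<le> exp (\<tau> * (A - \<kappa>)) * (4 * eN * P + 128 * A ^ 5 * eP * B)"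
  proof -
    have e1: "exp (\<tau> * (A - 2 * \<kappa>)) = exp (\<tau> * (A - \<kappa>)) * eN"
      unfolding eN_def exp_add[symmetric] by (simp add: algebra_simps)
    have e2: "exp \<tau> * exp (\<tau> * A) = exp (\<tau> * (A - \<kappa>)) * eP"
      unfolding eP_def exp_add[symmetric] by (simp add: algebra_simps)
    have "exp (\<tau> * (A - \<kappa>)) * m \<le> 4 * exp (\<tau> * (A - 2 * \<kappa>)) * P
      + 64 * A ^ 5 * (2 * exp \<tau>) * exp (\<tau> * A) * B"
    proof (rule order_trans[OF order_trans[OF lower mainW]], rule add_mono)
      show "4 * exp (\<tau> * (A - 2 * \<kappa>)) * integral {0..T} Com \<le> 4 * exp (\<tau> * (A - 2 * \<kappa>)) * P"
        using com unfolding P_def by (intro mult_left_mono) auto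
      show "64 * A ^ 5 * \<tau>\<^sup>2 * exp (\<tau> * A) * B \<le> 64 * A ^ 5 * (2 * exp \<tau>) * exp (\<tau> * A) * B"
        using \<tau>2 A4 B0 by (intro mult_right_mono mult_left_mono) auto
    qed
    also have "\<dots> = 4 * exp (\<tau> * (A - 2 * \<kappa>)) * P + 128 * A ^ 5 * (exp \<tau> * exp (\<tau> * A)) * B"
      by simp
    also have "\<dots> = exp (\<tau> * (A - \<kappa>)) * (4 * eN * P + 128 * A ^ 5 * eP * B)"
      unfolding e1 e2 by (simp add: distrib_left mult_ac)
    finally show ?thesis .
  qed
  then have "m \<le> 4 * eN * (Cc * ((2 * Cac + 1) * integral {0..T} N + 2 * B)) + 128 * A ^ 5 * eP * B"
    unfolding P_def by (simp only: mult_le_cancel_left_pos exp_gt_zero)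
  also have "\<dots> \<le> (4 * Cc * (2 * Cac + 3) + 128 * A ^ 5) * (eN * integral {0..T} N + eP * B)"
  proof -
    have "eN * B \<le> eP * B" using e01 B0 by (intro mult_right_mono) auto
    then have "Cc * (eN * B) \<le> Cc * (eP * B)" using Cc0 by (rule mult_left_mono)
    moreover have "0 \<le> Cc * (eN * integral {0..T} N)" "0 \<le> A ^ 5 * (eN * integral {0..T} N)"
      "0 \<le> Cc * Cac * (eP * B)" "0 \<le> Cc * (eP * B)"
      using Cc0 e01 N0 A4 Cac0 B0 by auto
    ultimately show ?thesis by (simp add: algebra_simps)
  qed
  finally show ?thesis
    unfolding m_def Cc_def Cac_def d_def eN_def eP_def N_def B_def T_def \<kappa>_def .
qed

end

section \<open>Norms and solutions in terms of time slices\<close>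

lemma countable_mesh: "countable (mesh h :: (real ^ 'd::finite) set)"
proof -
  have "countable (UNIV :: (int ^ 'd) set)"
  proof -
    have "inj (vec_nth :: int ^ 'd \<Rightarrow> 'd \<Rightarrow> int)" by (simp add: inj_on_def vec_eq_iff)
    moreover have "countable (range (vec_nth :: int ^ 'd \<Rightarrow> 'd \<Rightarrow> int))"
    proof -
      have "countable (UNIV \<rightarrow>\<^sub>E (UNIV :: int set) :: ('d \<Rightarrow> int) set)" by (intro countable_PiE) auto
      then show ?thesis by (rule countable_subset[rotated]) auto
    qed
    ultimately show ?thesis using countable_image_inj_on by blast
  qed
  then show ?thesis unfolding mesh_def by (rule countable_image)
qed

lemma space_mesh_measure [simp]: "space (mesh_measure h) = mesh h"
  unfolding mesh_measure_def by simp

lemma sets_mesh_measure: "sets (mesh_measure h) = sets (count_space (mesh h))"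
  unfolding mesh_measure_def by simp

lemma sigma_finite_mesh_measure:
  assumes "0 < h" shows "sigma_finite_measure (mesh_measure h :: (real ^ 'd::finite) measure)"
proof
  let ?M = "mesh_measure h :: (real ^ 'd) measure"
  show "\<exists>A. countable A \<and> A \<subseteq> sets ?M \<and> \<Union> A = space ?M \<and> (\<forall>a\<in>A. emeasure ?M a \<noteq> \<infinity>)"
  proof (intro exI[of _ "(\<lambda>x. {x}) ` mesh h"] conjI ballI)
    fix a :: "(real ^ 'd) set" assume "a \<in> (\<lambda>x. {x}) ` mesh h"
    then obtain x where x: "x \<in> mesh h" "a = {x}" by blast
    then have "emeasure ?M a = (\<integral>\<^sup>+y. ennreal (h ^ CARD('d)) * indicator {x} y \<partial>count_space (mesh h))"
      unfolding mesh_measure_def by (subst emeasure_density) auto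
    also have "\<dots> = ennreal (h ^ CARD('d))"
      using x by (subst nn_integral_cmult_indicator) auto
    finally show "emeasure ?M a \<noteq> \<infinity>" by simp
  qed (auto simp: sets_mesh_measure intro: countable_mesh)
qed

lemma sigma_finite_half_line: "sigma_finite_measure (lebesgue_on {0::real<..})"
proof
  show "\<exists>A. countable A \<and> A \<subseteq> sets (lebesgue_on {0::real<..}) \<and> \<Union> A = space (lebesgue_on {0::real<..}) \<and>
      (\<forall>a\<in>A. emeasure (lebesgue_on {0::real<..}) a \<noteq> \<infinity>)"
  proof (intro exI[of _ "range (\<lambda>n::nat. {0<..real n})"] conjI ballI)
    show "range (\<lambda>n::nat. {0<..real n}) \<subseteq> sets (lebesgue_on {0::real<..})"
      by (auto simp: sets_restrict_space_iff)
    show "\<Union> (range (\<lambda>n::nat. {0<..real n})) = space (lebesgue_on {0::real<..})"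
      using real_arch_simple by fastforce
    fix a assume "a \<in> range (\<lambda>n::nat. {0<..real n})"
    then obtain n :: nat where "a = {0<..real n}" by blast
    then show "emeasure (lebesgue_on {0::real<..}) a \<noteq> \<infinity>"
      by (subst emeasure_restrict_space) auto
  qed auto
qed

lemma pair_sigma_finite_half_space:
  assumes "0 < h"
  shows "pair_sigma_finite (mesh_measure h :: (real ^ 'd::finite) measure) (lebesgue_on {0::real<..})"
  unfolding pair_sigma_finite_def using sigma_finite_mesh_measure[OF assms] sigma_finite_half_line by auto

lemma borel_measurable_half_space:
  fixes f :: "(real ^ 'd::finite) \<times> real \<Rightarrow> real"
  assumes "\<And>x. x \<in> mesh h \<Longrightarrow> (\<lambda>t. f (x, t)) \<in> borel_measurable (lebesgue_on {0<..})"
  shows "f \<in> borel_measurable (half_space_measure h)"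
proof -
  have "f \<in> borel_measurable (count_space (mesh h) \<Otimes>\<^sub>M lebesgue_on {0<..})"
    using countable_mesh assms by (rule measurable_pair_measure_countable1)
  moreover have "sets (half_space_measure h) = sets (count_space (mesh h) \<Otimes>\<^sub>M lebesgue_on {0<..})"
    unfolding half_space_measure_def by (intro sets_pair_measure_cong sets_mesh_measure refl)
  ultimately show ?thesis using measurable_cong_sets by blast
qed

lemma mesh_integral_finite_support:
  fixes f :: "real ^ 'd::finite \<Rightarrow> real"
  assumes "0 < h" "finite X" "X \<subseteq> mesh h" "\<And>x. x \<in> mesh h \<Longrightarrow> x \<notin> X \<Longrightarrow> f x = 0"
  shows "integrable (mesh_measure h) f" "integral\<^sup>L (mesh_measure h) f = h ^ CARD('d) * (\<Sum>x\<in>X. f x)"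
proof -
  have hb: "has_bochner_integral (count_space (mesh h)) (\<lambda>x. h ^ CARD('d) *\<^sub>R f x) (\<Sum>x\<in>X. h ^ CARD('d) * f x)"
  proof -
    have 1: "has_bochner_integral (count_space (mesh h)) (\<lambda>x. \<Sum>y\<in>X. indicator {y} x *\<^sub>R (h ^ CARD('d) * f y))
        (\<Sum>y\<in>X. measure (count_space (mesh h)) {y} *\<^sub>R (h ^ CARD('d) * f y))"
      using assms(3)
      by (intro has_bochner_integral_sum has_bochner_integral_scaleR_left has_bochner_integral_real_indicator)
        (auto simp: emeasure_count_space)
    have 2: "(\<Sum>y\<in>X. measure (count_space (mesh h)) {y} *\<^sub>R (h ^ CARD('d) * f y)) = (\<Sum>x\<in>X. h ^ CARD('d) * f x)"
      using assms(3) by (intro sum.cong refl) (auto simp: measure_def)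
    have 3: "(\<Sum>y\<in>X. indicator {y} x *\<^sub>R (h ^ CARD('d) * f y)) = h ^ CARD('d) *\<^sub>R f x"
      if x: "x \<in> space (count_space (mesh h))" for x
    proof -
      have "(\<Sum>y\<in>X. indicator {y} x *\<^sub>R (h ^ CARD('d) * f y)) = (\<Sum>y\<in>X. if y = x then h ^ CARD('d) * f x else 0)"
        by (intro sum.cong refl) (auto simp: indicator_def)
      also have "\<dots> = (if x \<in> X then h ^ CARD('d) * f x else 0)"
        using assms(2) by simp
      finally show ?thesis using assms(4)[of x] x by auto
    qed
    show ?thesis by (rule has_bochner_integral_cong[THEN iffD1, OF refl 3 2 1])
  qed
  have nn: "AE x in count_space (mesh h). 0 \<le> h ^ CARD('d)" using assms(1) by simp
  show "integrable (mesh_measure h) f"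
    unfolding mesh_measure_def using hb[unfolded has_bochner_integral_iff] nn
    by (subst integrable_density) (auto simp del: integrable_scaleR_right)
  show "integral\<^sup>L (mesh_measure h) f = h ^ CARD('d) * (\<Sum>x\<in>X. f x)"
    unfolding mesh_measure_def using hb[unfolded has_bochner_integral_iff] nn
    by (subst integral_density) (auto simp: sum_distrib_left)
qed

lemma finite_mesh_ball:
  assumes "0 < h" shows "finite {x \<in> mesh h :: (real ^ 'd::finite) set. norm x < r}"
proof (rule finite_subset[OF _ finite_mesh_box[OF assms]])
  show "{x \<in> mesh h :: (real ^ 'd) set. norm x < r} \<subseteq> mesh_box h r"
  proof
    fix x :: "real ^ 'd" assume x: "x \<in> {x \<in> mesh h. norm x < r}"
    have "\<bar>x $ k\<bar> \<le> r" for k using component_le_norm_cart[of x k] x by simp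
    with x show "x \<in> mesh_box h r" by (simp add: mesh_box_def)
  qed
qed

lemma L2_norm_boundary_ball:
  fixes f :: "real ^ 'd::finite \<Rightarrow> real"
  assumes "0 < h"
  shows "L2_norm (mesh_measure h) (boundary_ball h r) f =
    sqrt (h ^ CARD('d) * (\<Sum>x\<in>{x \<in> mesh h. norm x < r}. (f x)\<^sup>2))"
proof -
  have "(LINT x:boundary_ball h r|mesh_measure h. (norm (f x))\<^sup>2) =
      h ^ CARD('d) * (\<Sum>x\<in>{x \<in> mesh h. norm x < r}. indicator (boundary_ball h r) x *\<^sub>R (norm (f x))\<^sup>2)"
    unfolding set_lebesgue_integral_def
    by (rule mesh_integral_finite_support(2)[OF assms finite_mesh_ball[OF assms]])
      (auto simp: boundary_ball_def)
  then show ?thesis unfolding L2_norm_def by (simp add: boundary_ball_def)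
qed

text \<open>Fubini's theorem on finitely many slices.  The integrability is part of the claim: without it the set integral would be
  \<open>0\<close> by convention.\<close>

lemma half_ball_integral:
  fixes U :: "(real ^ 'd::finite) \<times> real \<Rightarrow> real" and F :: "real ^ 'd \<Rightarrow> real \<Rightarrow> real"
  assumes h: "0 < h" and r: "0 < r"
    and U: "\<And>x. x \<in> mesh h \<Longrightarrow> negligible (Z x)"
      "\<And>x t. x \<in> mesh h \<Longrightarrow> 0 < t \<Longrightarrow> t \<notin> Z x \<Longrightarrow> U (x, t) = F x t"
    and F: "\<And>x. continuous_on {0..} (F x)"
    and meas: "\<And>x. x \<in> mesh h \<Longrightarrow> (\<lambda>t. U (x, t)) \<in> borel_measurable (lebesgue_on {0<..})"
  shows "set_integrable (half_space_measure h) (half_ball h r) (\<lambda>z. (norm (U z))\<^sup>2)"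
    "(LINT z:half_ball h r|half_space_measure h. (norm (U z))\<^sup>2) =
      h ^ CARD('d) * (\<Sum>x\<in>{x \<in> mesh h. norm x < r}. integral {0..sqrt (r\<^sup>2 - (norm x)\<^sup>2)} (\<lambda>t. (F x t)\<^sup>2))"
proof -
  let ?M1 = "mesh_measure h :: (real ^ 'd) measure" and ?M2 = "lebesgue_on {0::real<..}"
  interpret pair_sigma_finite ?M1 ?M2 by (rule pair_sigma_finite_half_space[OF h])
  define X where "X = {x \<in> mesh h :: (real ^ 'd) set. norm x < r}"
  define f where "f z = indicator (half_ball h r) z *\<^sub>R (norm (U z))\<^sup>2" for z
  define s where "s x = sqrt (r\<^sup>2 - (norm x)\<^sup>2)" for x :: "real ^ 'd"
  have slice: "indicator (half_ball h r) (x, t) = (indicator {0<..<s x} t :: real)" if "x \<in> X" for x t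
  proof -
    have "(norm x)\<^sup>2 < r\<^sup>2" using that by (auto simp: X_def intro: power_strict_mono)
    then have "0 < t \<and> (norm x)\<^sup>2 + t\<^sup>2 < r\<^sup>2 \<longleftrightarrow> 0 < t \<and> t < s x"
      unfolding s_def using real_less_rsqrt[of t "r\<^sup>2 - (norm x)\<^sup>2"] real_sqrt_less_iff[of "t\<^sup>2" "r\<^sup>2 - (norm x)\<^sup>2"]
      by (auto simp: real_sqrt_abs)
    then show ?thesis using that by (auto simp: half_ball_def indicator_def X_def)
  qed
  have off: "f (x, t) = 0" if "x \<in> mesh h" "x \<notin> X" for x t
  proof -
    have "r\<^sup>2 \<le> (norm x)\<^sup>2" using that r by (intro power_mono) (auto simp: X_def)
    moreover have "0 \<le> t\<^sup>2" by simp
    ultimately have "\<not> (norm x)\<^sup>2 + t\<^sup>2 < r\<^sup>2" by linarith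
    then have "(x, t) \<notin> half_ball h r" by (auto simp: half_ball_def)
    then show ?thesis by (simp add: f_def)
  qed
  have fslice: "has_bochner_integral ?M2 (\<lambda>t. f (x, t)) (integral {0..s x} (\<lambda>t. (F x t)\<^sup>2))" if x: "x \<in> X" for x
  proof -
    have xm: "x \<in> mesh h" using x by (simp add: X_def)
    have "continuous_on {0..s x} (\<lambda>t. (F x t)\<^sup>2)"
      by (intro continuous_intros continuous_on_subset[OF F]) auto
    then have ai: "(\<lambda>t. (F x t)\<^sup>2) absolutely_integrable_on {0..s x}"
      by (rule absolutely_integrable_continuous_real)
    then have ao: "(\<lambda>t. (F x t)\<^sup>2) absolutely_integrable_on {0<..<s x}"
      by (simp add: absolutely_integrable_on_Icc_iff_Ioo)
    have "integrable ?M2 (\<lambda>t. indicator {0<..<s x} t *\<^sub>R (F x t)\<^sup>2)"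
    proof (subst integrable_restrict_space)
      show "{0::real<..} \<inter> space lebesgue \<in> sets lebesgue" by simp
      have eq: "indicat_real {0<..} t *\<^sub>R indicat_real {0<..<s x} t *\<^sub>R (F x t)\<^sup>2 = indicat_real {0<..<s x} t *\<^sub>R (F x t)\<^sup>2" for t
        by (auto simp: indicator_def)
      show "integrable lebesgue (\<lambda>t. indicat_real {0<..} t *\<^sub>R indicat_real {0<..<s x} t *\<^sub>R (F x t)\<^sup>2)"
        using ao unfolding set_integrable_def eq .
    qed
    moreover have "integral\<^sup>L ?M2 (\<lambda>t. indicator {0<..<s x} t *\<^sub>R (F x t)\<^sup>2) = integral {0..s x} (\<lambda>t. (F x t)\<^sup>2)"
    proof -
      have "integral\<^sup>L ?M2 (\<lambda>t. indicator {0<..<s x} t *\<^sub>R (F x t)\<^sup>2)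
          = (LINT t|lebesgue. indicator {0<..} t *\<^sub>R indicator {0<..<s x} t *\<^sub>R (F x t)\<^sup>2)"
        by (subst integral_restrict_space) auto
      also have "\<dots> = (LINT t:{0<..<s x}|lebesgue. (F x t)\<^sup>2)"
        unfolding set_lebesgue_integral_def
        by (intro Bochner_Integration.integral_cong) (auto simp: indicator_def)
      also have "\<dots> = integral {0<..<s x} (\<lambda>t. (F x t)\<^sup>2)" using ao by (rule set_lebesgue_integral_eq_integral)
      finally show ?thesis by (simp add: integral_open_interval_real)
    qed
    ultimately have hb: "has_bochner_integral ?M2 (\<lambda>t. indicator {0<..<s x} t *\<^sub>R (F x t)\<^sup>2) (integral {0..s x} (\<lambda>t. (F x t)\<^sup>2))"
      by (simp add: has_bochner_integral_iff)
    have ae: "AE t in ?M2. indicator {0<..<s x} t *\<^sub>R (F x t)\<^sup>2 = f (x, t)"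
      using U(1)[OF xm] U(2)[OF xm]
      by (subst AE_lebesgue_on_iff_negligible) (auto intro!: exI[of _ "Z x"] simp: f_def slice[OF x])
    have m: "(\<lambda>t. f (x, t)) \<in> borel_measurable ?M2"
      unfolding f_def slice[OF x] using meas[OF xm]
      by (auto intro!: borel_measurable_times borel_measurable_power borel_measurable_indicator simp: sets_restrict_space_iff)
    show ?thesis
    proof (rule has_bochner_integral_cong_AE[THEN iffD1, OF _ m ae hb])
      show "(\<lambda>t. indicat_real {0<..<s x} t *\<^sub>R (F x t)\<^sup>2) \<in> borel_measurable ?M2"
        using hb unfolding has_bochner_integral_iff by (auto dest: borel_measurable_integrable)
    qed
  qed
  have fm: "f \<in> borel_measurable (?M1 \<Otimes>\<^sub>M ?M2)"
    unfolding half_space_measure_def[symmetric]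
  proof (rule borel_measurable_half_space)
    fix x :: "real ^ 'd" assume x: "x \<in> mesh h"
    show "(\<lambda>t. f (x, t)) \<in> borel_measurable ?M2"
    proof (cases "x \<in> X")
      case True
      from fslice[OF this] show ?thesis by (auto simp: has_bochner_integral_iff)
    next
      case False
      then show ?thesis using off[OF x] by simp
    qed
  qed
  have XX: "finite X" "X \<subseteq> mesh h" unfolding X_def by (auto intro: finite_mesh_ball[OF h])
  have nf: "norm (f z) = f z" for z by (simp add: f_def)
  have g0: "integral\<^sup>L ?M2 (\<lambda>t. f (x, t)) = 0" if "x \<in> mesh h" "x \<notin> X" for x using off[OF that] by simp
  have int: "integrable (?M1 \<Otimes>\<^sub>M ?M2) f"
  proof (rule Fubini_integrable[OF fm])
    show "integrable ?M1 (\<lambda>x. LINT t|?M2. norm (f (x, t)))"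
      unfolding nf by (rule mesh_integral_finite_support(1)[OF h XX g0])
    have "integrable ?M2 (\<lambda>t. f (x, t))" if "x \<in> space ?M1" for x
      using fslice[of x] off[of x] that by (cases "x \<in> X") (auto simp: has_bochner_integral_iff)
    then show "AE x in ?M1. integrable ?M2 (\<lambda>t. f (x, t))" by (rule AE_I2)
  qed
  then show "set_integrable (half_space_measure h) (half_ball h r) (\<lambda>z. (norm (U z))\<^sup>2)"
    unfolding set_integrable_def f_def half_space_measure_def .
  have "(LINT z:half_ball h r|half_space_measure h. (norm (U z))\<^sup>2) = integral\<^sup>L (?M1 \<Otimes>\<^sub>M ?M2) f"
    unfolding set_lebesgue_integral_def f_def half_space_measure_def ..
  also have "\<dots> = (LINT x|?M1. LINT t|?M2. f (x, t))" by (rule integral_fst'[OF int, symmetric])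
  also have "\<dots> = h ^ CARD('d) * (\<Sum>x\<in>X. LINT t|?M2. f (x, t))"
    by (rule mesh_integral_finite_support(2)[OF h XX g0])
  also have "(\<Sum>x\<in>X. LINT t|?M2. f (x, t)) = (\<Sum>x\<in>X. integral {0..s x} (\<lambda>t. (F x t)\<^sup>2))"
    using fslice by (intro sum.cong refl) (auto dest: has_bochner_integral_integral_eq)
  finally show "(LINT z:half_ball h r|half_space_measure h. (norm (U z))\<^sup>2) =
      h ^ CARD('d) * (\<Sum>x\<in>{x \<in> mesh h. norm x < r}. integral {0..sqrt (r\<^sup>2 - (norm x)\<^sup>2)} (\<lambda>t. (F x t)\<^sup>2))"
    unfolding X_def s_def .
qed


text \<open>Every lattice point has positive mass, so a property that holds almost everywhere in the product holds on every slice.\<close>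

lemma potential_bound:
  fixes V :: "(real ^ 'd::finite) \<times> real \<Rightarrow> real"
  assumes h: "0 < h" and ess: "esssup (half_space_measure h) (\<lambda>z. ereal \<bar>V z\<bar>) = ereal \<Lambda>"
    and x: "x \<in> mesh h"
  shows "AE t in lebesgue_on {0<..}. \<bar>V (x, t)\<bar> \<le> \<Lambda>"
proof -
  interpret pair_sigma_finite "mesh_measure h :: (real ^ 'd) measure" "lebesgue_on {0::real<..}"
    by (rule pair_sigma_finite_half_space[OF h])
  have "AE z in half_space_measure h. \<bar>V z\<bar> \<le> \<Lambda>"
    using esssup_AE[where M = "half_space_measure h" and f = "\<lambda>z. ereal \<bar>V z\<bar>"] unfolding ess by simp
  then have "AE y in mesh_measure h. AE t in lebesgue_on {0<..}. \<bar>V (y, t)\<bar> \<le> \<Lambda>"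
    unfolding half_space_measure_def by (rule AE_pair)
  then show ?thesis
    using x h unfolding mesh_measure_def by (subst (asm) AE_density) (auto simp: AE_count_space)
qed

text \<open>The second derivative is redefined as \<open>v F - \<Delta>\<^sub>d F\<close> with the potential truncated to \<open>[-\<Lambda>, \<Lambda>]\<close>.  This changes it on a null
  set only, and the differential inequality then holds at every time.  Off the lattice all functions are \<open>0\<close>.\<close>

lemma solution_representative:
  fixes U V :: "(real ^ 'd::finite) \<times> real \<Rightarrow> real" and u :: "real ^ 'd \<Rightarrow> real"
  assumes h: "0 < h" and \<Lambda>: "0 \<le> \<Lambda>" and V: "V \<in> borel_measurable (half_space_measure h)"
    and ess: "esssup (half_space_measure h) (\<lambda>z. ereal \<bar>V z\<bar>) = ereal \<Lambda>"
    and sol: "is_solution h V u U"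
  obtains F F' F'' :: "real ^ 'd \<Rightarrow> real \<Rightarrow> real" and Z :: "real ^ 'd \<Rightarrow> real set" where
    "\<And>x T. lipschitz_primitive T (F x) (F' x)" "\<And>x T. lipschitz_primitive T (F' x) (F'' x)"
    "\<And>x t. x \<in> mesh h \<Longrightarrow> \<bar>F'' x t + discrete_laplacian h (\<lambda>y. F y t) x\<bar> \<le> \<Lambda> * \<bar>F x t\<bar>"
    "\<And>x. x \<in> mesh h \<Longrightarrow> negligible (Z x)"
    "\<And>x t. x \<in> mesh h \<Longrightarrow> 0 < t \<Longrightarrow> t \<notin> Z x \<Longrightarrow> U (x, t) = F x t"
    "\<And>x. x \<in> mesh h \<Longrightarrow> F x 0 = u x" "\<And>x. x \<in> mesh h \<Longrightarrow> F' x 0 = normal_derivative U x"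
    "\<And>x. continuous_on {0..} (F x)"
proof -
  define g where "g x = weak_deriv (weak_deriv (\<lambda>t. U (x, t)))" for x
  define good where "good x w \<longleftrightarrow> (\<forall>T. primitive T (fst w) (fst (snd w))) \<and> (\<forall>T. primitive T (fst (snd w)) (g x)) \<and>
      negligible (snd (snd w)) \<and> (\<forall>t>0. t \<notin> snd (snd w) \<longrightarrow> U (x, t) = fst w t) \<and>
      fst w 0 = u x \<and> fst (snd w) 0 = normal_derivative U x" for x and w :: "(real \<Rightarrow> real) \<times> (real \<Rightarrow> real) \<times> real set"
  have "\<exists>w. good x w" if x: "x \<in> mesh h" for x
  proof -
    have H2: "H2_loc (\<lambda>t. U (x, t))" and tr: "trace_at_0 (\<lambda>t. U (x, t)) = u x"
      using sol x unfolding is_solution_def by auto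
    show ?thesis
    proof (rule H2_loc_representative[OF H2])
      fix F P N assume *: "\<And>T. primitive T F P"
        "\<And>T. primitive T P (weak_deriv (weak_deriv (\<lambda>t. U (x, t))))" "negligible N"
        "\<And>t. 0 < t \<Longrightarrow> t \<notin> N \<Longrightarrow> U (x, t) = F t" "trace_at_0 (\<lambda>t. U (x, t)) = F 0"
        "trace_at_0 (weak_deriv (\<lambda>t. U (x, t))) = P 0"
      then have "good x (F, P, N)" using tr by (simp add: good_def g_def normal_derivative_def)
      then show ?thesis by blast
    qed
  qed
  then obtain w where w: "\<And>x. x \<in> mesh h \<Longrightarrow> good x (w x)" by metis
  define F where "F x = (if x \<in> mesh h then fst (w x) else (\<lambda>_. 0))" for x
  define F' where "F' x = (if x \<in> mesh h then fst (snd (w x)) else (\<lambda>_. 0))" for x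
  define Z where "Z x = snd (snd (w x))" for x
  have FF: "primitive T (F x) (F' x)" for x T
    using w[of x] primitive_const[of T 0] unfolding F_def F'_def good_def by auto
  have Fg: "primitive T (F' x) (g x)" "negligible (Z x)" "F x 0 = u x" "F' x 0 = normal_derivative U x"
    if "x \<in> mesh h" for x T
    using w[OF that] that unfolding F_def F'_def Z_def good_def by auto
  have UF: "U (x, t) = F x t" if "x \<in> mesh h" "0 < t" "t \<notin> Z x" for x t
    using w[OF that(1)] that unfolding F_def Z_def good_def by auto
  define v where "v x t = (if t \<in> {0<..} then max (- \<Lambda>) (min \<Lambda> (V (x, t))) else 0)" for x t
  have v: "\<bar>v x t\<bar> \<le> \<Lambda>" for x t using \<Lambda> by (auto simp: v_def)
  have v_bm: "bounded_measurable T (v x)" if "x \<in> mesh h" for x T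
  proof -
    have "(\<lambda>t. V (x, t)) \<in> borel_measurable (lebesgue_on {0<..})"
      using measurable_Pair2[OF V[unfolded half_space_measure_def], of x] that by simp
    then have "(\<lambda>t. max (- \<Lambda>) (min \<Lambda> (V (x, t)))) \<in> borel_measurable (lebesgue_on {0<..})"
      by (intro borel_measurable_max borel_measurable_min) auto
    then have "v x \<in> borel_measurable lebesgue"
      unfolding v_def[abs_def] by (intro borel_measurable_if_I) auto
    then have "v x \<in> borel_measurable (lebesgue_on {0..T})" by (rule measurable_restrict_space1)
    with v show ?thesis unfolding bounded_measurable_def by blast
  qed
  define F'' where "F'' x = (if x \<in> mesh h
      then (\<lambda>t. v x t * F x t - discrete_laplacian h (\<lambda>y. F y t) x) else (\<lambda>_. 0))" for x
  have F_bm: "bounded_measurable T (F x)" for x T by (rule primitive_bounded_measurable[OF FF])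
  have F''_bm: "bounded_measurable T (F'' x)" for x T
  proof (cases "x \<in> mesh h")
    case True
    then show ?thesis unfolding F''_def discrete_laplacian_def divide_inverse
      by (simp only: if_True) (intro bounded_measurable_intros v_bm F_bm)
  qed (simp add: F''_def bounded_measurable_const)
  have F'F'': "primitive T (F' x) (F'' x)" for x T
  proof (cases "x \<in> mesh h")
    case x: True
    have "AE t in lebesgue_on {0<..}. g x t + discrete_laplacian h (\<lambda>y. U (y, t)) x = V (x, t) * U (x, t)"
      using sol x unfolding is_solution_def g_def by blast
    then obtain N1 where N1: "negligible N1" "\<And>t. 0 < t \<Longrightarrow> t \<notin> N1 \<Longrightarrow>
        g x t + discrete_laplacian h (\<lambda>y. U (y, t)) x = V (x, t) * U (x, t)"
      by (subst (asm) AE_lebesgue_on_iff_negligible) auto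
    obtain N2 where N2: "negligible N2" "\<And>t. 0 < t \<Longrightarrow> t \<notin> N2 \<Longrightarrow> \<bar>V (x, t)\<bar> \<le> \<Lambda>"
      using potential_bound[OF h ess x] by (subst (asm) AE_lebesgue_on_iff_negligible) auto
    define S where "S = (N1 \<union> N2 \<union> Z x) \<union> (\<Union>k. Z (fwd h k x) \<union> Z (bwd h k x)) \<union> {0}"
    have S: "negligible S"
      unfolding S_def using N1 N2 Fg(2) x mesh_shift[OF x]
      by (intro negligible_Un negligible_Union) auto
    have eq: "F'' x t = g x t" if t: "0 \<le> t" "t \<notin> S" for t
    proof -
      have t0: "0 < t" using t by (cases "t = 0") (auto simp: S_def)
      have U: "U (x, t) = F x t" "U (fwd h k x, t) = F (fwd h k x) t"
        "U (bwd h k x, t) = F (bwd h k x) t" for k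
        using t t0 x mesh_shift[OF x] by (auto intro!: UF simp: S_def)
      have lap: "discrete_laplacian h (\<lambda>y. U (y, t)) x = discrete_laplacian h (\<lambda>y. F y t) x"
        unfolding discrete_laplacian_def U ..
      have "\<bar>V (x, t)\<bar> \<le> \<Lambda>" using N2(2) t t0 by (auto simp: S_def)
      then have "v x t = V (x, t)" using t0 by (auto simp: v_def)
      moreover have "g x t + discrete_laplacian h (\<lambda>y. U (y, t)) x = V (x, t) * U (x, t)"
        using N1(2) t t0 by (auto simp: S_def)
      ultimately show ?thesis using x unfolding F''_def lap U by simp
    qed
    show ?thesis unfolding primitive_def
    proof (intro conjI ballI)
      show "F'' x absolutely_integrable_on {0..T}"
        by (rule bounded_measurable_absolutely_integrable[OF F''_bm])
      fix t assume "t \<in> {0..T}"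
      then have "(g x has_integral F' x t - F' x 0) {0..t}" using Fg(1)[OF x, of T] unfolding primitive_def by blast
      then show "(F'' x has_integral F' x t - F' x 0) {0..t}"
        by (rule has_integral_spike[OF S, rotated]) (auto intro: eq)
    qed
  next
    case False
    then show ?thesis using primitive_const[of T 0] by (simp add: F''_def F'_def)
  qed
  show thesis
  proof (rule that[of F F' F'' Z])
    show "lipschitz_primitive T (F' x) (F'' x)" "lipschitz_primitive T (F x) (F' x)" for x T
      unfolding lipschitz_primitive_def using F'F'' FF F''_bm primitive_bounded_measurable[OF F'F''] by auto
    show "\<bar>F'' x t + discrete_laplacian h (\<lambda>y. F y t) x\<bar> \<le> \<Lambda> * \<bar>F x t\<bar>" if "x \<in> mesh h" for x t
      using that v[of x t] by (auto simp: F''_def abs_mult intro: mult_right_mono)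
    show "continuous_on {0..} (F x)" for x by (rule primitive_continuous_half_line[OF FF])
  qed (use Fg UF in auto)
qed

section \<open>Choice of the large parameter\<close>

text \<open>The two terms of the estimate balance at \<open>s = ln (M / B) / (\<delta> + \<mu>)\<close> and then both equal
  \<open>M powr (1 - \<alpha>) * B powr \<alpha>\<close>.  If \<open>s\<close> is below the admissible range, then \<open>M\<close> and \<open>B\<close> are comparable and the trivial bound
  by \<open>M\<close> suffices; if it is above, the choice \<open>\<tau> = 1 / h\<close> leaves the exponentially small term.\<close>

lemma optimise_exponential_weights:
  fixes M\<^sub>0 M B C \<delta> \<mu> \<tau>\<^sub>0 h :: real
  assumes pos: "0 < \<delta>" "0 < \<mu>" "0 < h" "0 \<le> C" and nn: "0 \<le> B" "M\<^sub>0 \<le> M" and \<tau>\<^sub>0: "0 \<le> \<tau>\<^sub>0" "\<tau>\<^sub>0 * h \<le> 1"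
    and M: "0 \<le> M"
    and est: "\<And>\<tau>. \<tau>\<^sub>0 \<le> \<tau> \<Longrightarrow> \<tau> * h \<le> 1 \<Longrightarrow> M\<^sub>0 \<le> C * (exp (- \<delta> * \<tau>) * M + exp (\<mu> * \<tau>) * B)"
  defines "\<alpha> \<equiv> \<delta> / (\<delta> + \<mu>)" and "D \<equiv> 2 * C + exp (\<delta> * \<tau>\<^sub>0) + 1"
  shows "M\<^sub>0 \<le> D * max M B powr (1 - \<alpha>) * B powr \<alpha> + D * exp (- \<delta> / h) * M"
proof -
  have D: "1 \<le> D" "2 * C \<le> D" "exp (\<delta> * \<tau>\<^sub>0) \<le> D" using pos by (auto simp: D_def)
  have \<tau>h: "\<tau>\<^sub>0 \<le> 1 / h" "1 / h * h \<le> 1" using \<tau>\<^sub>0 pos by (auto simp: field_simps)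
  have first: "0 \<le> D * max M B powr (1 - \<alpha>) * B powr \<alpha>" and second: "0 \<le> D * exp (- \<delta> / h) * M"
    using D M by auto
  consider "B = 0" | "0 < B" "M \<le> B" | "0 < B" "B < M" using nn by linarith
  then show ?thesis
  proof cases
    case 1
    have "M\<^sub>0 \<le> C * exp (- \<delta> / h) * M" using est[OF \<tau>h] 1 by simp
    also have "\<dots> \<le> D * exp (- \<delta> / h) * M" using D pos M by (intro mult_right_mono) auto
    finally show ?thesis using first by linarith
  next
    case 2
    have "M\<^sub>0 \<le> B powr (1 - \<alpha>) * B powr \<alpha>" using 2 nn by (simp flip: powr_add)
    also have "\<dots> \<le> D * (B powr (1 - \<alpha>) * B powr \<alpha>)" using mult_right_mono[OF D(1), of "B powr (1 - \<alpha>) * B powr \<alpha>"] by simp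
    finally show ?thesis using second 2 by (simp add: max_def mult.assoc)
  next
    case 3
    define s where "s = ln (M / B) / (\<delta> + \<mu>)"
    have M0: "0 < M" using 3 by simp
    have es: "exp ((\<delta> + \<mu>) * s) = M / B" using pos 3 M0 by (simp add: s_def)
    have s0: "0 < s" unfolding s_def using pos 3 by simp
    have geo: "M powr (1 - \<alpha>) * B powr \<alpha> = exp (- \<delta> * s) * M"
    proof -
      have "M powr (1 - \<alpha>) * B powr \<alpha> = exp ((1 - \<alpha>) * ln M + \<alpha> * ln B)"
        using 3 M0 by (simp add: powr_def exp_add)
      also have "(1 - \<alpha>) * ln M + \<alpha> * ln B = ln M - \<alpha> * (ln M - ln B)" by (simp add: algebra_simps)
      also have "\<alpha> * (ln M - ln B) = \<delta> * s" using 3 M0 by (simp add: \<alpha>_def s_def ln_div)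
      also have "exp (ln M - \<delta> * s) = exp (- \<delta> * s) * M" using M0 by (simp add: exp_diff exp_minus field_simps)
      finally show ?thesis .
    qed
    have balance: "exp (\<mu> * s) * B = exp (- \<delta> * s) * M"
    proof -
      have "exp (\<mu> * s) = exp (- \<delta> * s) * exp ((\<delta> + \<mu>) * s)" unfolding exp_add[symmetric] by (simp add: algebra_simps)
      then show ?thesis unfolding es using 3 by simp
    qed
    have mx: "max M B = M" using 3 by simp
    consider "s \<le> \<tau>\<^sub>0" | "\<tau>\<^sub>0 < s" "s * h \<le> 1" | "1 < s * h" by linarith
    then show ?thesis
    proof cases
      case 1
      have "1 \<le> exp (\<delta> * \<tau>\<^sub>0) * exp (- \<delta> * s)"
        unfolding exp_add[symmetric] using 1 pos by (simp add: algebra_simps)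
      also have "\<dots> \<le> D * exp (- \<delta> * s)" using D by (intro mult_right_mono) auto
      finally have "1 * M \<le> (D * exp (- \<delta> * s)) * M" using M0 by (intro mult_right_mono) auto
      then have "M\<^sub>0 \<le> D * (M powr (1 - \<alpha>) * B powr \<alpha>)" unfolding geo using nn by (simp add: mult.assoc)
      then show ?thesis unfolding mx using second by (simp add: mult.assoc)
    next
      case 2
      then have "M\<^sub>0 \<le> C * (exp (- \<delta> * s) * M + exp (\<mu> * s) * B)" by (intro est) auto
      also have "\<dots> = (2 * C) * (exp (- \<delta> * s) * M)" unfolding balance by simp
      also have "\<dots> \<le> D * (exp (- \<delta> * s) * M)" using D M0 by (intro mult_right_mono) auto
      finally have "M\<^sub>0 \<le> D * (M powr (1 - \<alpha>) * B powr \<alpha>)" unfolding geo .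
      then show ?thesis unfolding mx using second by (simp add: mult.assoc)
    next
      case 3
      then have "1 / h \<le> s" using pos by (simp add: field_simps)
      then have "(\<delta> + \<mu>) * (1 / h) \<le> (\<delta> + \<mu>) * s" using pos by (intro mult_left_mono) auto
      then have "exp ((\<delta> + \<mu>) * (1 / h)) \<le> exp ((\<delta> + \<mu>) * s)" by (simp only: exp_le_cancel_iff)
      then have "exp ((\<delta> + \<mu>) * (1 / h)) * B \<le> M" unfolding es using \<open>0 < B\<close> by (simp add: field_simps)
      then have "exp (- \<delta> * (1 / h)) * (exp ((\<delta> + \<mu>) * (1 / h)) * B) \<le> exp (- \<delta> * (1 / h)) * M" by simp
      moreover have "exp (- \<delta> * (1 / h)) * (exp ((\<delta> + \<mu>) * (1 / h)) * B) = exp (\<mu> * (1 / h)) * B"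
        unfolding mult.assoc[symmetric] exp_add[symmetric] by (simp add: add_divide_distrib)
      ultimately have b: "exp (\<mu> * (1 / h)) * B \<le> exp (- \<delta> * (1 / h)) * M" by linarith
      have "M\<^sub>0 \<le> C * (exp (- \<delta> * (1 / h)) * M + exp (\<mu> * (1 / h)) * B)" by (rule est[OF \<tau>h])
      also have "\<dots> \<le> C * (exp (- \<delta> * (1 / h)) * M + exp (- \<delta> * (1 / h)) * M)"
        using b pos by (intro mult_left_mono add_left_mono) auto
      also have "\<dots> = (2 * C) * (exp (- \<delta> / h) * M)" by simp
      also have "\<dots> \<le> D * (exp (- \<delta> / h) * M)" using D M0 by (intro mult_right_mono) auto
      finally show ?thesis using first by (simp add: mult.assoc)
    qed
  qed
qed

theorem theorem5:
  "\<exists>r\<^sub>0 \<alpha> :: real. 0 < r\<^sub>0 \<and> r\<^sub>0 < 1 \<and> 0 < \<alpha> \<and> \<alpha> < 1 \<and>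
    (\<forall>\<Lambda>\<ge>0. \<exists>h\<^sub>0>0. \<exists>C>1. \<exists>c>0.
      \<forall>h (V :: (real ^ 'd::finite) \<times> real \<Rightarrow> real) u U.
        0 < h \<and> h < h\<^sub>0 \<and>
        V \<in> borel_measurable (half_space_measure h) \<and>
        bounded (V ` (mesh h \<times> {0<..})) \<and>
        esssup (half_space_measure h) (\<lambda>z. ereal \<bar>V z\<bar>) = ereal \<Lambda> \<and>
        u \<in> H1_space h \<and>
        is_solution h V u U \<longrightarrow>
        L2_norm (half_space_measure h) (half_ball h r\<^sub>0) U
          \<le> C * max (L2_norm (half_space_measure h) (half_ball h 1) U)
                    (boundary_data_norm h u U) powr (1 - \<alpha>)
              * boundary_data_norm h u U powr \<alpha>
            + C * exp (- c / h) * L2_norm (half_space_measure h) (half_ball h 1) U)"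
proof -
  obtain a a' a'' L where "cutoff_profile a a' a'' L" using exists_cutoff_profile by blast
  then interpret cutoff_profile a a' a'' L .
  define d where "d = real CARD('d)"
  \<comment> \<open>Everything happens in the box \<open>|x\<^sub>k| \<le> 9 \<rho>\<close>, \<open>0 \<le> t \<le> 8 \<rho>\<close>, which lies in the unit half
    ball because \<open>(d + 1) (9 \<rho>)\<^sup>2 < 1\<close>.\<close>
  define \<rho> where "\<rho> = 1 / (20 * (1 + real CARD('d)))"
  define A where "A = 4 + 48 * real CARD('d)"
  define r0 where "r0 = \<rho>\<^sup>2 / (24 * A)"
  define \<kappa> where "\<kappa> = \<rho>\<^sup>2 / 8"
  have d1: "1 \<le> d" unfolding d_def by (simp add: Suc_leI)
  have \<rho>0: "0 < \<rho>" "\<rho> \<le> 1 / 40" "(1 + d) * \<rho>\<^sup>2 \<le> 1 / 400"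
  proof -
    show "0 < \<rho>" "\<rho> \<le> 1 / 40" unfolding \<rho>_def using d1 by (auto simp: d_def[symmetric] field_simps)
    have "(1 + d) * \<rho> = 1 / 20" unfolding \<rho>_def using d1 by (simp add: d_def[symmetric] field_simps)
    then have "(1 + d) * \<rho>\<^sup>2 = \<rho> / 20" by (simp add: power2_eq_square flip: mult.assoc)
    then show "(1 + d) * \<rho>\<^sup>2 \<le> 1 / 400" using \<open>\<rho> \<le> 1 / 40\<close> by simp
  qed
  have A4: "4 \<le> A" unfolding A_def by simp
  have r0: "0 < r0" "r0 \<le> \<rho>"
  proof -
    show "0 < r0" using \<rho>0 A4 by (simp add: r0_def)
    have "\<rho>\<^sup>2 \<le> \<rho> * 1" using \<rho>0 unfolding power2_eq_square by (intro mult_left_mono) auto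
    also have "\<rho> * 1 \<le> \<rho> * (24 * A)" using \<rho>0 A4 by (intro mult_left_mono) auto
    finally show "r0 \<le> \<rho>" unfolding r0_def using A4 by (simp add: field_simps)
  qed
  have \<kappa>0: "0 < \<kappa>" using \<rho>0 by (simp add: \<kappa>_def)
  define \<delta> \<mu> where "\<delta> = \<kappa> / 2" and "\<mu> = (\<kappa> + 1) / 2"
  have \<delta>\<mu>: "0 < \<delta>" "0 < \<mu>" using \<kappa>0 by (auto simp: \<delta>_def \<mu>_def)
  define \<alpha> where "\<alpha> = \<delta> / (\<delta> + \<mu>)"
  have \<alpha>: "0 < \<alpha>" "\<alpha> < 1" using \<delta>\<mu> by (auto simp: \<alpha>_def)
  define K where "K \<Lambda> = 4 * commutator_constant d \<rho> * (2 * ((L / \<rho>)\<^sup>2 + \<Lambda> + d * (L / \<rho>)\<^sup>2) + 3) + 128 * A ^ 5" for \<Lambda>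
  have K0: "0 \<le> K \<Lambda>" if "0 \<le> \<Lambda>" for \<Lambda>
    using that d1 A4 by (auto simp: K_def commutator_constant_def intro!: add_nonneg_nonneg mult_nonneg_nonneg)
  have main: "L2_norm (half_space_measure h) (half_ball h r0) U
          \<le> (2 * sqrt (K \<Lambda>) + exp (\<delta> * (1 + 4 * \<Lambda>\<^sup>2)) + 1)
              * max (L2_norm (half_space_measure h) (half_ball h 1) U)
                    (boundary_data_norm h u U) powr (1 - \<alpha>)
              * boundary_data_norm h u U powr \<alpha>
            + (2 * sqrt (K \<Lambda>) + exp (\<delta> * (1 + 4 * \<Lambda>\<^sup>2)) + 1) * exp (- \<delta> / h)
              * L2_norm (half_space_measure h) (half_ball h 1) U"
    if \<Lambda>: "0 \<le> \<Lambda>" and h: "0 < h" "h < min (\<rho> / 2) (1 / (1 + 4 * \<Lambda>\<^sup>2))"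
      and V: "V \<in> borel_measurable (half_space_measure h)"
        "esssup (half_space_measure h) (\<lambda>z. ereal \<bar>V z\<bar>) = ereal \<Lambda>"
      and sol: "is_solution h V u U"
    for \<Lambda> h and V U :: "(real ^ 'd) \<times> real \<Rightarrow> real" and u
  proof -
    obtain F F' F'' Z where F: "\<And>x T. lipschitz_primitive T (F x) (F' x)" "\<And>x T. lipschitz_primitive T (F' x) (F'' x)"
        "\<And>x t. x \<in> mesh h \<Longrightarrow> \<bar>F'' x t + discrete_laplacian h (\<lambda>y. F y t) x\<bar> \<le> \<Lambda> * \<bar>F x t\<bar>"
      and Z: "\<And>x. x \<in> mesh h \<Longrightarrow> negligible (Z x)"
        "\<And>x t. x \<in> mesh h \<Longrightarrow> 0 < t \<Longrightarrow> t \<notin> Z x \<Longrightarrow> U (x, t) = F x t"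
      and F0: "\<And>x. x \<in> mesh h \<Longrightarrow> F x 0 = u x" "\<And>x. x \<in> mesh h \<Longrightarrow> F' x 0 = normal_derivative U x"
      and Fc: "\<And>x. continuous_on {0..} (F x)"
      using solution_representative[OF h(1) \<Lambda> V sol] by blast
    have meas: "(\<lambda>t. U (x, t)) \<in> borel_measurable (lebesgue_on {0<..})" if "x \<in> mesh h" for x
      using sol that unfolding is_solution_def H2_loc_def L2_loc_def by blast
    define hd where "hd = h ^ CARD('d)"
    have hd0: "0 \<le> hd" using h by (simp add: hd_def)
    define X where "X r = {x \<in> mesh h :: (real ^ 'd) set. norm x < r}" for r
    have finX: "finite (X r)" for r unfolding X_def by (rule finite_mesh_ball[OF h(1)])
    define J where "J x s = integral {0..s} (\<lambda>t. (F x t)\<^sup>2)" for x s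
    have Fi: "(\<lambda>t. (F x t)\<^sup>2) integrable_on {0..s}" for x s
      by (intro integrable_continuous_real continuous_intros continuous_on_subset[OF Fc]) auto
    have Jmono: "J x s \<le> J x s'" if "s \<le> s'" for x s s'
      unfolding J_def using that by (intro integral_subset_le Fi) auto
    have J0: "0 \<le> J x s" for x s unfolding J_def by (intro Henstock_Kurzweil_Integration.integral_nonneg Fi) auto
    define M where "M r = L2_norm (half_space_measure h) (half_ball h r) U" for r
    have M2: "M r = sqrt (hd * (\<Sum>x\<in>X r. J x (sqrt (r\<^sup>2 - (norm x)\<^sup>2))))" if "0 < r" for r
      unfolding M_def L2_norm_def J_def X_def hd_def
      by (subst half_ball_integral(2)[OF h(1) that Z Fc meas]) simp_all
    define Q where "Q = (mesh_box h (9 * \<rho>) :: (real ^ 'd) set)"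
    define N where "N = integral {0..8 * \<rho>} (\<lambda>t. \<Sum>x\<in>Q. (F x t)\<^sup>2)"
    define B where "B = (\<Sum>x\<in>Q. (F x 0)\<^sup>2 + (F' x 0)\<^sup>2)"
    define Bd where "Bd = boundary_data_norm h u U"
    have Q1: "(norm x)\<^sup>2 \<le> d * (9 * \<rho>)\<^sup>2" if "x \<in> Q" for x
    proof -
      have "(norm x)\<^sup>2 = (\<Sum>k\<in>UNIV. (x $ k)\<^sup>2)"
        unfolding norm_vec_def L2_set_def by (simp add: sum_nonneg)
      also have "\<dots> \<le> (\<Sum>k\<in>(UNIV :: 'd set). (9 * \<rho>)\<^sup>2)"
        using that by (intro sum_mono square_le_if_abs_le) (auto simp: Q_def mesh_box_def)
      finally show ?thesis by (simp add: d_def)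
    qed
    have Q2: "(norm x)\<^sup>2 + (8 * \<rho>)\<^sup>2 < 1" if "x \<in> Q" for x
    proof -
      have "81 * ((1 + d) * \<rho>\<^sup>2) = d * (9 * \<rho>)\<^sup>2 + (8 * \<rho>)\<^sup>2 + 17 * \<rho>\<^sup>2"
        by (simp add: power_mult_distrib algebra_simps)
      then have "(norm x)\<^sup>2 + (8 * \<rho>)\<^sup>2 \<le> 81 * ((1 + d) * \<rho>\<^sup>2)"
        using Q1[OF that] zero_le_power2[of \<rho>] by linarith
      then show ?thesis using \<rho>0(3) by linarith
    qed
    have QX: "Q \<subseteq> X 1"
    proof
      fix x assume x: "x \<in> Q"
      have "(norm x)\<^sup>2 < 1\<^sup>2" using Q2[OF x] zero_le_power2[of "8 * \<rho>"] unfolding one_power2 by linarith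
      then have "norm x < 1" by (rule power2_less_imp_less) simp
      then show "x \<in> X 1" using x by (simp add: X_def Q_def mesh_box_def)
    qed
    have Nle: "hd * N \<le> (M 1)\<^sup>2"
    proof -
      have "N = (\<Sum>x\<in>Q. J x (8 * \<rho>))" unfolding N_def J_def
        by (rule integral_sum) (auto intro: Fi simp: Q_def finite_mesh_box[OF h(1)])
      also have "\<dots> \<le> (\<Sum>x\<in>Q. J x (sqrt (1\<^sup>2 - (norm x)\<^sup>2)))"
      proof (intro sum_mono Jmono)
        fix x assume "x \<in> Q"
        then have "(8 * \<rho>)\<^sup>2 \<le> 1\<^sup>2 - (norm x)\<^sup>2" using Q2 by fastforce
        then show "8 * \<rho> \<le> sqrt (1\<^sup>2 - (norm x)\<^sup>2)" by (rule real_le_rsqrt)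
      qed
      also have "\<dots> \<le> (\<Sum>x\<in>X 1. J x (sqrt (1\<^sup>2 - (norm x)\<^sup>2)))"
        by (intro sum_mono2 finX QX J0)
      finally have "hd * N \<le> hd * (\<Sum>x\<in>X 1. J x (sqrt (1\<^sup>2 - (norm x)\<^sup>2)))" using hd0 by (rule mult_left_mono)
      also have "\<dots> = (M 1)\<^sup>2" unfolding M2[OF zero_less_one] using hd0 J0
        by (intro real_sqrt_pow2[symmetric] mult_nonneg_nonneg sum_nonneg) auto
      finally show ?thesis .
    qed
    have Mle: "M r0 \<le> M 1"
      unfolding M2[OF zero_less_one] M2[OF r0(1)]
    proof (intro real_sqrt_le_mono mult_left_mono[OF _ hd0])
      have r01: "r0 \<le> 1" using r0 \<rho>0 by linarith
      have "(\<Sum>x\<in>X r0. J x (sqrt (r0\<^sup>2 - (norm x)\<^sup>2))) \<le> (\<Sum>x\<in>X r0. J x (sqrt (1\<^sup>2 - (norm x)\<^sup>2)))"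
        using r0 r01 by (intro sum_mono Jmono real_sqrt_le_mono diff_right_mono power_mono) auto
      also have "\<dots> \<le> (\<Sum>x\<in>X 1. J x (sqrt (1\<^sup>2 - (norm x)\<^sup>2)))"
        using r01 by (intro sum_mono2 finX J0) (auto simp: X_def)
      finally show "(\<Sum>x\<in>X r0. J x (sqrt (r0\<^sup>2 - (norm x)\<^sup>2))) \<le> (\<Sum>x\<in>X 1. J x (sqrt (1\<^sup>2 - (norm x)\<^sup>2)))" .
    qed
    have M10: "0 \<le> M 1" "0 \<le> M r0"
      using M2[OF zero_less_one] M2[OF r0(1)] hd0 J0 by (auto intro!: mult_nonneg_nonneg sum_nonneg)
    have small: "(M r0)\<^sup>2 \<le> hd * integral {0..r0} (\<lambda>t. \<Sum>x\<in>{x \<in> Q. norm x < r0}. (F x t)\<^sup>2)"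
    proof -
      have XQ: "X r0 = {x \<in> Q. norm x < r0}"
      proof -
        have "\<bar>x $ k\<bar> \<le> 9 * \<rho>" if "norm x < r0" for x :: "real ^ 'd" and k
          using component_le_norm_cart[of x k] that r0 \<rho>0 by linarith
        then show ?thesis by (auto simp: X_def Q_def mesh_box_def)
      qed
      have "(M r0)\<^sup>2 = hd * (\<Sum>x\<in>X r0. J x (sqrt (r0\<^sup>2 - (norm x)\<^sup>2)))"
        unfolding M2[OF r0(1)] using hd0 J0 by (intro real_sqrt_pow2 mult_nonneg_nonneg sum_nonneg) auto
      also have "\<dots> \<le> hd * (\<Sum>x\<in>X r0. J x r0)"
        using r0 by (intro mult_left_mono[OF _ hd0] sum_mono Jmono real_le_lsqrt) auto
      also have "(\<Sum>x\<in>X r0. J x r0) = integral {0..r0} (\<lambda>t. \<Sum>x\<in>X r0. (F x t)\<^sup>2)"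
        unfolding J_def by (rule integral_sum[symmetric]) (auto intro: Fi finX)
      finally show ?thesis unfolding XQ .
    qed
    have Bd: "hd * B \<le> Bd\<^sup>2" "0 \<le> Bd"
    proof -
      define p q where "p = L2_norm (mesh_measure h) (boundary_ball h 1) u"
        and "q = L2_norm (mesh_measure h) (boundary_ball h 1) (normal_derivative U)"
      have p: "p = sqrt (hd * (\<Sum>x\<in>X 1. (u x)\<^sup>2))" and q: "q = sqrt (hd * (\<Sum>x\<in>X 1. (normal_derivative U x)\<^sup>2))"
        unfolding p_def q_def hd_def X_def by (rule L2_norm_boundary_ball[OF h(1)])+
      have pq0: "0 \<le> p" "0 \<le> q" unfolding p q using hd0 by (auto intro!: mult_nonneg_nonneg sum_nonneg)
      have pq: "p + q \<le> Bd"
        unfolding Bd_def boundary_data_norm_def H1_norm_boundary_ball_def p_def q_def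
        by (simp add: L2_norm_def set_lebesgue_integral_def integral_nonneg_AE)
      show "0 \<le> Bd" using pq pq0 by linarith
      have "B = (\<Sum>x\<in>Q. (u x)\<^sup>2) + (\<Sum>x\<in>Q. (normal_derivative U x)\<^sup>2)"
        unfolding B_def sum.distrib[symmetric] by (intro sum.cong refl) (auto simp: F0 Q_def mesh_box_def)
      also have "\<dots> \<le> (\<Sum>x\<in>X 1. (u x)\<^sup>2) + (\<Sum>x\<in>X 1. (normal_derivative U x)\<^sup>2)"
        by (intro add_mono sum_mono2 finX QX) auto
      finally have "hd * B \<le> hd * ((\<Sum>x\<in>X 1. (u x)\<^sup>2) + (\<Sum>x\<in>X 1. (normal_derivative U x)\<^sup>2))"
        using hd0 by (rule mult_left_mono)
      also have "\<dots> = p\<^sup>2 + q\<^sup>2"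
        unfolding p q using hd0 by (subst (1 2) real_sqrt_pow2) (auto intro!: mult_nonneg_nonneg sum_nonneg simp: distrib_left)
      also have "\<dots> \<le> (p + q)\<^sup>2" using pq0 by (simp add: power2_sum)
      also have "\<dots> \<le> Bd\<^sup>2" using pq pq0 by (intro power_mono) auto
      finally show "hd * B \<le> Bd\<^sup>2" .
    qed
    have \<tau>h: "(1 + 4 * \<Lambda>\<^sup>2) * h \<le> 1"
    proof -
      have "0 < 1 + 4 * \<Lambda>\<^sup>2" using zero_le_power2[of \<Lambda>] by linarith
      then show ?thesis using h by (simp add: field_simps)
    qed
    have est: "M r0 \<le> sqrt (K \<Lambda>) * (exp (- \<delta> * \<tau>) * M 1 + exp (\<mu> * \<tau>) * Bd)"
      if \<tau>: "1 + 4 * \<Lambda>\<^sup>2 \<le> \<tau>" "\<tau> * h \<le> 1" for \<tau>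
    proof -
      define p q where "p = exp (- \<delta> * \<tau>) * M 1" and "q = exp (\<mu> * \<tau>) * Bd"
      have pq0: "0 \<le> p" "0 \<le> q" using M10 Bd by (auto simp: p_def q_def)
      have e: "exp (- (\<kappa> * \<tau>)) = (exp (- \<delta> * \<tau>))\<^sup>2" "exp ((\<kappa> + 1) * \<tau>) = (exp (\<mu> * \<tau>))\<^sup>2"
        unfolding \<delta>_def \<mu>_def by (simp_all add: power2_eq_square field_simps flip: exp_add)
      have "integral {0..r0} (\<lambda>t. \<Sum>x\<in>{x \<in> Q. norm x < r0}. (F x t)\<^sup>2) \<le>
          K \<Lambda> * (exp (- (\<kappa> * \<tau>)) * N + exp ((\<kappa> + 1) * \<tau>) * B)"
        unfolding K_def \<kappa>_def N_def B_def Q_def d_def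
        by (rule local_estimate[OF \<rho>_def A_def r0_def h(1) _ \<Lambda> \<tau> F(1,2)]) (use h F(3) in auto)
      then have "(M r0)\<^sup>2 \<le> hd * (K \<Lambda> * (exp (- (\<kappa> * \<tau>)) * N + exp ((\<kappa> + 1) * \<tau>) * B))"
        using small mult_left_mono[OF _ hd0] order_trans by blast
      also have "\<dots> = K \<Lambda> * ((exp (- \<delta> * \<tau>))\<^sup>2 * (hd * N) + (exp (\<mu> * \<tau>))\<^sup>2 * (hd * B))"
        unfolding e by (simp add: algebra_simps)
      also have "\<dots> \<le> K \<Lambda> * ((exp (- \<delta> * \<tau>))\<^sup>2 * (M 1)\<^sup>2 + (exp (\<mu> * \<tau>))\<^sup>2 * Bd\<^sup>2)"
        using Nle Bd K0[OF \<Lambda>] by (intro mult_left_mono add_mono) auto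
      also have "\<dots> = K \<Lambda> * (p\<^sup>2 + q\<^sup>2)" by (simp add: p_def q_def power_mult_distrib)
      also have "\<dots> \<le> K \<Lambda> * (p + q)\<^sup>2"
        using K0[OF \<Lambda>] pq0 by (intro mult_left_mono) (auto simp: power2_sum)
      also have "\<dots> = (sqrt (K \<Lambda>) * (p + q))\<^sup>2" using K0[OF \<Lambda>] by (simp add: power_mult_distrib)
      finally have "M r0 \<le> sqrt (K \<Lambda>) * (p + q)"
        by (rule power2_le_imp_le) (use K0[OF \<Lambda>] pq0 in auto)
      then show ?thesis unfolding p_def q_def .
    qed
    show ?thesis
      using optimise_exponential_weights[OF \<delta>\<mu> h(1) _ Bd(2) Mle _ \<tau>h M10(1) est] K0[OF \<Lambda>]
      unfolding \<alpha>_def M_def Bd_def by simp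
  qed
  show ?thesis
  proof (rule exI[of _ r0], rule exI[of _ \<alpha>], intro conjI allI impI)
    show "0 < r0" "r0 < 1" "0 < \<alpha>" "\<alpha> < 1" using r0 \<rho>0 \<alpha> by auto
    fix \<Lambda> :: real assume \<Lambda>: "0 \<le> \<Lambda>"
    define C where "C = 2 * sqrt (K \<Lambda>) + exp (\<delta> * (1 + 4 * \<Lambda>\<^sup>2)) + 1"
    have "0 < 1 + 4 * \<Lambda>\<^sup>2" using zero_le_power2[of \<Lambda>] by linarith
    then have h0: "0 < min (\<rho> / 2) (1 / (1 + 4 * \<Lambda>\<^sup>2))" using \<rho>0 by simp
    have C1: "1 < C" unfolding C_def using K0[OF \<Lambda>] by (simp add: add_nonneg_pos)
    show "\<exists>h\<^sub>0>0. \<exists>C>1. \<exists>c>0.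
      \<forall>h (V :: (real ^ 'd) \<times> real \<Rightarrow> real) u U.
        0 < h \<and> h < h\<^sub>0 \<and>
        V \<in> borel_measurable (half_space_measure h) \<and>
        bounded (V ` (mesh h \<times> {0<..})) \<and>
        esssup (half_space_measure h) (\<lambda>z. ereal \<bar>V z\<bar>) = ereal \<Lambda> \<and>
        u \<in> H1_space h \<and>
        is_solution h V u U \<longrightarrow>
        L2_norm (half_space_measure h) (half_ball h r0) U
          \<le> C * max (L2_norm (half_space_measure h) (half_ball h 1) U)
                    (boundary_data_norm h u U) powr (1 - \<alpha>)
              * boundary_data_norm h u U powr \<alpha>
            + C * exp (- c / h) * L2_norm (half_space_measure h) (half_ball h 1) U"
      by (rule exI[of _ "min (\<rho> / 2) (1 / (1 + 4 * \<Lambda>\<^sup>2))"], rule conjI[OF h0], rule exI[of _ C], rule conjI[OF C1],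
          rule exI[of _ \<delta>], rule conjI[OF \<delta>\<mu>(1)]) (auto simp only: C_def intro!: main[OF \<Lambda>])
  qed
qed

end
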